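(* Let $K$ be a commutative ring and let $M|N$ be a depth two, irreducible Frobenius extension of $K$-algebras with Frobenius homomorphism $E$ and dual bases $\{x_j\},\{y_j\}$. Let $\hat A=C_{M_1}(N)$ with the Hopf algebra structure (coproduct $a\mapsto a_{(1)}\otimes a_{(2)}$, antipode $\hat S$) transported from $A=\mathrm{End}({}_NM_N)$ along the algebra isomorphism $\psi_A:A\to\hat A$, $\psi_A(\alpha)=\sum_j\alpha(x_j)e_1y_j$. Then for all $a\in\hat A$ and $m\in M$, $$E_M(ame_1)=a_{(1)}\,m\,\hat S(a_{(2)})$$ in $M_1$.
   Context: A $K$-algebra extension $N\to M$ is irreducible if its centralizer $R=C_M(N)$ equals $K1_M$ ($K$ being identified with $R$ via $k\mapsto k1_M$). It is D2 (depth two) if $M\otimes_NM$ is isomorphic to a direct summand of $\oplus^n\,{}_NM_M$ as an $N$-$M$-bimodule and of $\oplus^m\,{}_MM_N$ as an $M$-$N$-bimodule, for some $n,m\ge1$. It is Frobenius if there are an $N$-$N$-bimodule map $E:M\to N$ (Frobenius homomorphism) and finitely many $x_j,y_j\in M$ (dual bases) with $\sum_jx_jE(y_jm)=m=\sum_jE(mx_j)y_j$ for all $m\in M$. $M_1=M\otimes_NM$ is the ring with multiplication $(m\otimes m')(m''\otimes m''')=mE(m'm'')\otimes m'''$ and unit $\sum_jx_j\otimes y_j$; $M$ is regarded as a subring via $m\mapsto\sum_jmx_j\otimes y_j$; $e_1=1\otimes1$, so $m\otimes m'=me_1m'$; $E_M:M_1\to M$ is $E_M(me_1m')=mm'$.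 $A=\mathrm{End}({}_NM_N)$ is a Hopf algebra over $K$ (known): multiplication is composition, $\Delta(\alpha)=\sum_i\alpha(-\,b_i^1)b_i^2\otimes_K\beta_i$, $\varepsilon(\alpha)=\alpha(1)$, with antipode $S(\alpha)=\sum_{i,j}E(-\,b_i^1)b_i^2\,\alpha(\beta_i(x_j))y_j$, where $b_i=b_i^1\otimes b_i^2\in(M\otimes_NM)^N$, $\beta_i\in A$ are finite families (a left D2 quasibasis) satisfying $\sum_ib_i^1\otimes b_i^2\beta_i(m)=m\otimes1$ for all $m\in M$; here $X^N$ denotes the elements of $X$ commuting with $N$. *)

theory Defs
  imports "HOL-Algebra.Module" "HOL-Algebra.Generated_Groups" "HOL-Algebra.Free_Abelian_Groups"
begin

section \<open>Algebras over a commutative ring, and their extensions\<close>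

text \<open>The library's locale \<^locale>\<open>algebra\<close> requires a commutative multiplication.\<close>

locale assoc_algebra = module K A + ring A for K (structure) and A (structure) +
  assumes smult_mult_left: "\<lbrakk>k \<in> carrier K; a \<in> carrier A; b \<in> carrier A\<rbrakk>
      \<Longrightarrow> (k \<odot>\<^bsub>A\<^esub> a) \<otimes>\<^bsub>A\<^esub> b = k \<odot>\<^bsub>A\<^esub> (a \<otimes>\<^bsub>A\<^esub> b)"
    and smult_mult_right: "\<lbrakk>k \<in> carrier K; a \<in> carrier A; b \<in> carrier A\<rbrakk>
      \<Longrightarrow> a \<otimes>\<^bsub>A\<^esub> (k \<odot>\<^bsub>A\<^esub> b) = k \<odot>\<^bsub>A\<^esub> (a \<otimes>\<^bsub>A\<^esub> b)"

text \<open>An extension is given by its structure map \<open>\<iota>\<close>, which need not be injective; \<open>N\<close> acts on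
  \<open>M\<close> and on everything built from \<open>M\<close> through \<open>\<iota>\<close>.\<close>

locale algebra_extension =
  N: assoc_algebra K N + M: assoc_algebra K M
  for K :: "('k, 'kz) ring_scheme" and N :: "('k, 'n, 'nz) module_scheme"
    and M :: "('k, 'm, 'mz) module_scheme" +
  fixes \<iota> :: "'n \<Rightarrow> 'm"
  assumes hom: "\<iota> \<in> ring_hom N M"
    and hom_smult: "\<lbrakk>k \<in> carrier K; n \<in> carrier N\<rbrakk> \<Longrightarrow> \<iota> (k \<odot>\<^bsub>N\<^esub> n) = k \<odot>\<^bsub>M\<^esub> \<iota> n"

definition centralizer :: "('a, 'z) ring_scheme \<Rightarrow> 'a set \<Rightarrow> 'a set" where
  "centralizer R S = {a \<in> carrier R. \<forall>s \<in> S. a \<otimes>\<^bsub>R\<^esub> s = s \<otimes>\<^bsub>R\<^esub> a}"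

text \<open>Bijectivity, and not just surjectivity, onto the centralizer is what allows one to identify
  it with \<open>K\<close>.\<close>

definition irreducible_extension ::
  "('k, 'kz) ring_scheme \<Rightarrow> ('n, 'nz) ring_scheme \<Rightarrow> ('k, 'm, 'mz) module_scheme \<Rightarrow> ('n \<Rightarrow> 'm) \<Rightarrow> bool"
where
  "irreducible_extension K N M \<iota> \<longleftrightarrow>
     bij_betw (\<lambda>k. k \<odot>\<^bsub>M\<^esub> \<one>\<^bsub>M\<^esub>) (carrier K) (centralizer M (\<iota> ` carrier N))"


section \<open>Bimodules\<close>

text \<open>As with the library's \<^typ>\<open>('a, 'b) module\<close>, the fields \<^const>\<open>monoid.mult\<close> and
  \<^const>\<open>one\<close> inherited from \<^typ>\<open>'a ring\<close> play no role.\<close>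

record ('l, 'x, 'r) bimodule = "'x ring" +
  lact :: "'l \<Rightarrow> 'x \<Rightarrow> 'x"
  ract :: "'x \<Rightarrow> 'r \<Rightarrow> 'x"

definition bimod_hom :: "('l, 'lz) ring_scheme \<Rightarrow> ('r, 'rz) ring_scheme \<Rightarrow>
  ('l, 'x, 'r, 'xz) bimodule_scheme \<Rightarrow> ('l, 'y, 'r, 'yz) bimodule_scheme \<Rightarrow> ('x \<Rightarrow> 'y) set"
where
  "bimod_hom L R X Y = {h \<in> carrier X \<rightarrow> carrier Y.
     (\<forall>u \<in> carrier X. \<forall>v \<in> carrier X. h (u \<oplus>\<^bsub>X\<^esub> v) = h u \<oplus>\<^bsub>Y\<^esub> h v) \<and>
     (\<forall>l \<in> carrier L. \<forall>u \<in> carrier X. h (lact X l u) = lact Y l (h u)) \<and>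
     (\<forall>u \<in> carrier X. \<forall>r \<in> carrier R. h (ract X u r) = ract Y (h u) r)}"

definition sub_bimodule :: "('l, 'lz) ring_scheme \<Rightarrow> ('r, 'rz) ring_scheme \<Rightarrow>
  ('l, 'x, 'r, 'xz) bimodule_scheme \<Rightarrow> 'x set \<Rightarrow> bool"
where
  "sub_bimodule L R X P \<longleftrightarrow> subgroup P (add_monoid X) \<and>
     (\<forall>l \<in> carrier L. \<forall>u \<in> P. lact X l u \<in> P) \<and> (\<forall>u \<in> P. \<forall>r \<in> carrier R. ract X u r \<in> P)"

definition bimod_power :: "nat \<Rightarrow> ('l, 'x, 'r, 'xz) bimodule_scheme \<Rightarrow> ('l, nat \<Rightarrow> 'x, 'r) bimodule"
where
  "bimod_power n X = \<lparr>carrier = {..<n} \<rightarrow>\<^sub>E carrier X, monoid.mult = undefined, one = undefined,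
     ring.zero = (\<lambda>i\<in>{..<n}. \<zero>\<^bsub>X\<^esub>), add = (\<lambda>u v. \<lambda>i\<in>{..<n}. u i \<oplus>\<^bsub>X\<^esub> v i),
     lact = (\<lambda>l u. \<lambda>i\<in>{..<n}. lact X l (u i)), ract = (\<lambda>u r. \<lambda>i\<in>{..<n}. ract X (u i) r)\<rparr>"

text \<open>\<open>X\<close> is isomorphic to a direct summand \<open>P\<close> of \<open>Y\<close>, with complement \<open>Q\<close>.\<close>

definition iso_direct_summand :: "('l, 'lz) ring_scheme \<Rightarrow> ('r, 'rz) ring_scheme \<Rightarrow>
  ('l, 'x, 'r, 'xz) bimodule_scheme \<Rightarrow> ('l, 'y, 'r, 'yz) bimodule_scheme \<Rightarrow> bool"
where
  "iso_direct_summand L R X Y \<longleftrightarrow> (\<exists>P Q. sub_bimodule L R Y P \<and> sub_bimodule L R Y Q \<and>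
     P \<inter> Q = {\<zero>\<^bsub>Y\<^esub>} \<and> (\<forall>v \<in> carrier Y. \<exists>p \<in> P. \<exists>q \<in> Q. v = p \<oplus>\<^bsub>Y\<^esub> q) \<and>
     (\<exists>h \<in> bimod_hom L R X Y. bij_betw h (carrier X) P))"

text \<open>A ring \<open>M\<close> as a bimodule over two rings acting through \<open>f\<close> on the left and \<open>g\<close> on the right.\<close>

definition reg_bimod :: "('l \<Rightarrow> 'm) \<Rightarrow> ('m, 'z) ring_scheme \<Rightarrow> ('r \<Rightarrow> 'm) \<Rightarrow> ('l, 'm, 'r) bimodule" where
  "reg_bimod f M g = \<lparr>carrier = carrier M, monoid.mult = undefined, one = undefined,
     ring.zero = \<zero>\<^bsub>M\<^esub>, add = add M, lact = (\<lambda>l u. f l \<otimes>\<^bsub>M\<^esub> u), ract = (\<lambda>u r. u \<otimes>\<^bsub>M\<^esub> g r)\<rparr>"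

text \<open>A module over a commutative ring, with the scalars acting on both sides.\<close>

definition sym_bimod :: "('k, 'x, 'z) module_scheme \<Rightarrow> ('k, 'x, 'k) bimodule" where
  "sym_bimod X = \<lparr>carrier = carrier X, monoid.mult = undefined, one = undefined,
     ring.zero = \<zero>\<^bsub>X\<^esub>, add = add X, lact = (\<lambda>k u. k \<odot>\<^bsub>X\<^esub> u), ract = (\<lambda>u k. k \<odot>\<^bsub>X\<^esub> u)\<rparr>"


section \<open>Tensor products over a possibly noncommutative ring\<close>

text \<open>\<open>X \<otimes>\<^sub>R Y\<close> is the free abelian group on \<open>X \<times> Y\<close> modulo biadditivity and \<open>R\<close>-balancedness.\<close>

definition tensor_relators :: "('r, 'rz) ring_scheme \<Rightarrow> ('l, 'x, 'r, 'xz) bimodule_scheme \<Rightarrow>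
  ('r, 'y, 's, 'yz) bimodule_scheme \<Rightarrow> ('x \<times> 'y \<Rightarrow>\<^sub>0 int) set"
where
  "tensor_relators R X Y =
     {frag_of (u \<oplus>\<^bsub>X\<^esub> u', v) - frag_of (u, v) - frag_of (u', v) | u u' v.
        u \<in> carrier X \<and> u' \<in> carrier X \<and> v \<in> carrier Y} \<union>
     {frag_of (u, v \<oplus>\<^bsub>Y\<^esub> v') - frag_of (u, v) - frag_of (u, v') | u v v'.
        u \<in> carrier X \<and> v \<in> carrier Y \<and> v' \<in> carrier Y} \<union>
     {frag_of (ract X u r, v) - frag_of (u, lact Y r v) | u r v.
        u \<in> carrier X \<and> r \<in> carrier R \<and> v \<in> carrier Y}"

definition tensor_subgroup :: "('r, 'rz) ring_scheme \<Rightarrow> ('l, 'x, 'r, 'xz) bimodule_scheme \<Rightarrow>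
  ('r, 'y, 's, 'yz) bimodule_scheme \<Rightarrow> ('x \<times> 'y \<Rightarrow>\<^sub>0 int) set"
where
  "tensor_subgroup R X Y =
     generate (free_Abelian_group (carrier X \<times> carrier Y)) (tensor_relators R X Y)"

definition tensor_group :: "('r, 'rz) ring_scheme \<Rightarrow> ('l, 'x, 'r, 'xz) bimodule_scheme \<Rightarrow>
  ('r, 'y, 's, 'yz) bimodule_scheme \<Rightarrow> ('x \<times> 'y \<Rightarrow>\<^sub>0 int) set monoid"
where
  "tensor_group R X Y =
     free_Abelian_group (carrier X \<times> carrier Y) Mod tensor_subgroup R X Y"

definition tensor_elem :: "('r, 'rz) ring_scheme \<Rightarrow> ('l, 'x, 'r, 'xz) bimodule_scheme \<Rightarrow>
  ('r, 'y, 's, 'yz) bimodule_scheme \<Rightarrow> 'x \<Rightarrow> 'y \<Rightarrow> ('x \<times> 'y \<Rightarrow>\<^sub>0 int) set"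
where
  "tensor_elem R X Y u v =
     tensor_subgroup R X Y #>\<^bsub>free_Abelian_group (carrier X \<times> carrier Y)\<^esub> frag_of (u, v)"

text \<open>The additive map with \<open>u \<otimes> v \<mapsto> f u v\<close>, for biadditive balanced \<open>f\<close>: the common value, on the
  representatives of a class, of the additive extension of \<open>f\<close> to the free abelian group.\<close>

definition tensor_lift :: "('g, 'z) ring_scheme \<Rightarrow> ('x \<Rightarrow> 'y \<Rightarrow> 'g) \<Rightarrow> ('x \<times> 'y \<Rightarrow>\<^sub>0 int) set \<Rightarrow> 'g" where
  "tensor_lift G f t = the_elem
     ((\<lambda>c. \<Oplus>\<^bsub>G\<^esub>p \<in> Poly_Mapping.keys c. [Poly_Mapping.lookup c p] \<cdot>\<^bsub>G\<^esub> f (fst p) (snd p)) ` t)"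

text \<open>The outer actions are \<open>l (u \<otimes> v) = l u \<otimes> v\<close> and \<open>(u \<otimes> v) s = u \<otimes> v s\<close>.\<close>

definition tensor_add :: "('r, 'rz) ring_scheme \<Rightarrow> ('l, 'x, 'r, 'xz) bimodule_scheme \<Rightarrow>
  ('r, 'y, 's, 'yz) bimodule_scheme \<Rightarrow> ('x \<times> 'y \<Rightarrow>\<^sub>0 int) set ring"
where
  "tensor_add R X Y = \<lparr>carrier = carrier (tensor_group R X Y),
     monoid.mult = undefined, one = undefined,
     ring.zero = \<one>\<^bsub>tensor_group R X Y\<^esub>, add = monoid.mult (tensor_group R X Y)\<rparr>"

definition tensor :: "('r, 'rz) ring_scheme \<Rightarrow> ('l, 'x, 'r, 'xz) bimodule_scheme \<Rightarrow>
  ('r, 'y, 's, 'yz) bimodule_scheme \<Rightarrow> ('l, ('x \<times> 'y \<Rightarrow>\<^sub>0 int) set, 's) bimodule"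
where
  "tensor R X Y = \<lparr>carrier = carrier (tensor_add R X Y), monoid.mult = undefined, one = undefined,
     ring.zero = \<zero>\<^bsub>tensor_add R X Y\<^esub>, add = add (tensor_add R X Y),
     lact = (\<lambda>l. tensor_lift (tensor_add R X Y) (\<lambda>u v. tensor_elem R X Y (lact X l u) v)),
     ract = (\<lambda>t s. tensor_lift (tensor_add R X Y) (\<lambda>u v. tensor_elem R X Y u (ract Y v s)) t)\<rparr>"


section \<open>Depth two and Frobenius extensions\<close>

text \<open>\<open>M \<otimes>\<^sub>N M\<close> with the actions of two rings through \<open>f\<close> and \<open>g\<close>. The carrier and the
  pure tensors do not depend on \<open>f\<close> and \<open>g\<close>.\<close>

definition tensor_square :: "('n, 'nz) ring_scheme \<Rightarrow> ('m, 'mz) ring_scheme \<Rightarrow> ('n \<Rightarrow> 'm) \<Rightarrow>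
  ('l \<Rightarrow> 'm) \<Rightarrow> ('r \<Rightarrow> 'm) \<Rightarrow> ('l, ('m \<times> 'm \<Rightarrow>\<^sub>0 int) set, 'r) bimodule"
where
  "tensor_square N M \<iota> f g = tensor N (reg_bimod f M \<iota>) (reg_bimod \<iota> M g)"

definition ptensor :: "('n, 'nz) ring_scheme \<Rightarrow> ('m, 'mz) ring_scheme \<Rightarrow> ('n \<Rightarrow> 'm) \<Rightarrow>
  'm \<Rightarrow> 'm \<Rightarrow> ('m \<times> 'm \<Rightarrow>\<^sub>0 int) set"
where
  "ptensor N M \<iota> u v = tensor_elem N (reg_bimod id M \<iota>) (reg_bimod \<iota> M id) u v"

definition depth_two :: "('n, 'nz) ring_scheme \<Rightarrow> ('m, 'mz) ring_scheme \<Rightarrow> ('n \<Rightarrow> 'm) \<Rightarrow> bool" where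
  "depth_two N M \<iota> \<longleftrightarrow>
     (\<exists>n\<ge>1. iso_direct_summand N M
        (tensor_square N M \<iota> \<iota> id) (bimod_power n (reg_bimod \<iota> M id))) \<and>
     (\<exists>m\<ge>1. iso_direct_summand M N
        (tensor_square N M \<iota> id \<iota>) (bimod_power m (reg_bimod id M \<iota>)))"

definition frobenius_system :: "('n, 'nz) ring_scheme \<Rightarrow> ('m, 'mz) ring_scheme \<Rightarrow> ('n \<Rightarrow> 'm) \<Rightarrow>
  ('m \<Rightarrow> 'n) \<Rightarrow> nat \<Rightarrow> (nat \<Rightarrow> 'm) \<Rightarrow> (nat \<Rightarrow> 'm) \<Rightarrow> bool"
where
  "frobenius_system N M \<iota> E r x y \<longleftrightarrow>
     E \<in> bimod_hom N N (reg_bimod \<iota> M \<iota>) (reg_bimod id N id) \<and>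
     x \<in> {..<r} \<rightarrow> carrier M \<and> y \<in> {..<r} \<rightarrow> carrier M \<and>
     (\<forall>m \<in> carrier M.
        (\<Oplus>\<^bsub>M\<^esub>j\<in>{..<r}. x j \<otimes>\<^bsub>M\<^esub> \<iota> (E (y j \<otimes>\<^bsub>M\<^esub> m))) = m \<and>
        (\<Oplus>\<^bsub>M\<^esub>j\<in>{..<r}. \<iota> (E (m \<otimes>\<^bsub>M\<^esub> x j)) \<otimes>\<^bsub>M\<^esub> y j) = m)"


section \<open>The basic construction\<close>

definition basic_construction :: "('n, 'nz) ring_scheme \<Rightarrow> ('k, 'm, 'mz) module_scheme \<Rightarrow> ('n \<Rightarrow> 'm) \<Rightarrow>
  ('m \<Rightarrow> 'n) \<Rightarrow> nat \<Rightarrow> (nat \<Rightarrow> 'm) \<Rightarrow> (nat \<Rightarrow> 'm) \<Rightarrow> ('k, ('m \<times> 'm \<Rightarrow>\<^sub>0 int) set) module"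
where
  "basic_construction N M \<iota> E r x y = (let T = tensor_square N M \<iota> id id in
     \<lparr>carrier = carrier T,
      monoid.mult = (\<lambda>s t. tensor_lift T (\<lambda>m m'. tensor_lift T (\<lambda>m'' m'''.
         ptensor N M \<iota> (m \<otimes>\<^bsub>M\<^esub> \<iota> (E (m' \<otimes>\<^bsub>M\<^esub> m''))) m''') t) s),
      one = (\<Oplus>\<^bsub>T\<^esub>j\<in>{..<r}. ptensor N M \<iota> (x j) (y j)),
      ring.zero = \<zero>\<^bsub>T\<^esub>, add = add T,
      smult = (\<lambda>k. tensor_lift T (\<lambda>m m'. ptensor N M \<iota> (k \<odot>\<^bsub>M\<^esub> m) m'))\<rparr>)"

text \<open>The inclusion of \<open>M\<close> into the basic construction.\<close>

definition basic_incl :: "('n, 'nz) ring_scheme \<Rightarrow> ('m, 'mz) ring_scheme \<Rightarrow> ('n \<Rightarrow> 'm) \<Rightarrow>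
  nat \<Rightarrow> (nat \<Rightarrow> 'm) \<Rightarrow> (nat \<Rightarrow> 'm) \<Rightarrow> 'm \<Rightarrow> ('m \<times> 'm \<Rightarrow>\<^sub>0 int) set"
where
  "basic_incl N M \<iota> r x y m =
     (\<Oplus>\<^bsub>tensor_square N M \<iota> id id\<^esub>j\<in>{..<r}. ptensor N M \<iota> (m \<otimes>\<^bsub>M\<^esub> x j) (y j))"

definition jones_idem :: "('n, 'nz) ring_scheme \<Rightarrow> ('m, 'mz) ring_scheme \<Rightarrow> ('n \<Rightarrow> 'm) \<Rightarrow>
  ('m \<times> 'm \<Rightarrow>\<^sub>0 int) set"
where
  "jones_idem N M \<iota> = ptensor N M \<iota> \<one>\<^bsub>M\<^esub> \<one>\<^bsub>M\<^esub>"

definition frob_E\<^sub>M :: "('m, 'mz) ring_scheme \<Rightarrow> ('m \<times> 'm \<Rightarrow>\<^sub>0 int) set \<Rightarrow> 'm" where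
  "frob_E\<^sub>M M = tensor_lift M (\<lambda>m m'. m \<otimes>\<^bsub>M\<^esub> m')"


section \<open>The Hopf algebra structure on the bimodule endomorphisms\<close>

text \<open>Endomorphisms are extensional functions: they are \<^const>\<open>undefined\<close> outside \<^term>\<open>carrier M\<close>.\<close>

definition bimod_End :: "('n, 'nz) ring_scheme \<Rightarrow> ('k, 'm, 'mz) module_scheme \<Rightarrow> ('n \<Rightarrow> 'm) \<Rightarrow>
  ('k, 'm \<Rightarrow> 'm) module"
where
  "bimod_End N M \<iota> =
     \<lparr>carrier = bimod_hom N N (reg_bimod \<iota> M \<iota>) (reg_bimod \<iota> M \<iota>) \<inter> extensional (carrier M),
      monoid.mult = compose (carrier M), one = (\<lambda>z\<in>carrier M. z),
      ring.zero = (\<lambda>z\<in>carrier M. \<zero>\<^bsub>M\<^esub>), add = (\<lambda>\<alpha> \<beta>. \<lambda>z\<in>carrier M. \<alpha> z \<oplus>\<^bsub>M\<^esub> \<beta> z),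
      smult = (\<lambda>k \<alpha>. \<lambda>z\<in>carrier M. k \<odot>\<^bsub>M\<^esub> \<alpha> z)\<rparr>"

text \<open>A depth two extension has such a family: lemma \<open>depth_two_imp_left_D2_quasibasis\<close> below.\<close>

definition left_D2_quasibasis :: "('n, 'nz) ring_scheme \<Rightarrow> ('k, 'm, 'mz) module_scheme \<Rightarrow> ('n \<Rightarrow> 'm) \<Rightarrow>
  nat \<Rightarrow> (nat \<Rightarrow> ('m \<times> 'm \<Rightarrow>\<^sub>0 int) set) \<Rightarrow> (nat \<Rightarrow> 'm \<Rightarrow> 'm) \<Rightarrow> bool"
where
  "left_D2_quasibasis N M \<iota> s b \<beta> \<longleftrightarrow>
     (\<forall>i<s. b i \<in> carrier (tensor_square N M \<iota> \<iota> \<iota>) \<and>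
        (\<forall>n \<in> carrier N. lact (tensor_square N M \<iota> \<iota> \<iota>) n (b i) = ract (tensor_square N M \<iota> \<iota> \<iota>) (b i) n)) \<and>
     (\<forall>i<s. \<beta> i \<in> carrier (bimod_End N M \<iota>)) \<and>
     (\<forall>m \<in> carrier M. (\<Oplus>\<^bsub>tensor_square N M \<iota> id id\<^esub>i\<in>{..<s}.
        ract (tensor_square N M \<iota> id id) (b i) (\<beta> i m)) = ptensor N M \<iota> m \<one>\<^bsub>M\<^esub>)"

definition End_coproduct :: "('k, 'kz) ring_scheme \<Rightarrow> ('n, 'nz) ring_scheme \<Rightarrow>
  ('k, 'm, 'mz) module_scheme \<Rightarrow> ('n \<Rightarrow> 'm) \<Rightarrow>
  nat \<Rightarrow> (nat \<Rightarrow> ('m \<times> 'm \<Rightarrow>\<^sub>0 int) set) \<Rightarrow> (nat \<Rightarrow> 'm \<Rightarrow> 'm) \<Rightarrow>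
  ('m \<Rightarrow> 'm) \<Rightarrow> (('m \<Rightarrow> 'm) \<times> ('m \<Rightarrow> 'm) \<Rightarrow>\<^sub>0 int) set"
where
  "End_coproduct K N M \<iota> s b \<beta> \<alpha> = (let A = sym_bimod (bimod_End N M \<iota>) in
     \<Oplus>\<^bsub>tensor K A A\<^esub>i\<in>{..<s}. tensor_elem K A A
       (\<lambda>z\<in>carrier M. tensor_lift M (\<lambda>b\<^sub>1 b\<^sub>2. \<alpha> (z \<otimes>\<^bsub>M\<^esub> b\<^sub>1) \<otimes>\<^bsub>M\<^esub> b\<^sub>2) (b i)) (\<beta> i))"

definition End_antipode :: "('k, 'm, 'mz) module_scheme \<Rightarrow> ('n \<Rightarrow> 'm) \<Rightarrow>
  ('m \<Rightarrow> 'n) \<Rightarrow> nat \<Rightarrow> (nat \<Rightarrow> 'm) \<Rightarrow> (nat \<Rightarrow> 'm) \<Rightarrow>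
  nat \<Rightarrow> (nat \<Rightarrow> ('m \<times> 'm \<Rightarrow>\<^sub>0 int) set) \<Rightarrow> (nat \<Rightarrow> 'm \<Rightarrow> 'm) \<Rightarrow> ('m \<Rightarrow> 'm) \<Rightarrow> 'm \<Rightarrow> 'm"
where
  "End_antipode M \<iota> E r x y s b \<beta> \<alpha> = (\<lambda>z\<in>carrier M. \<Oplus>\<^bsub>M\<^esub>i\<in>{..<s}. \<Oplus>\<^bsub>M\<^esub>j\<in>{..<r}.
     tensor_lift M (\<lambda>b\<^sub>1 b\<^sub>2. \<iota> (E (z \<otimes>\<^bsub>M\<^esub> b\<^sub>1)) \<otimes>\<^bsub>M\<^esub> b\<^sub>2 \<otimes>\<^bsub>M\<^esub> \<alpha> (\<beta> i (x j)) \<otimes>\<^bsub>M\<^esub> y j) (b i))"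


section \<open>The transported structure on the centralizer\<close>

definition hat_A :: "('n, 'nz) ring_scheme \<Rightarrow> ('k, 'm, 'mz) module_scheme \<Rightarrow> ('n \<Rightarrow> 'm) \<Rightarrow>
  ('m \<Rightarrow> 'n) \<Rightarrow> nat \<Rightarrow> (nat \<Rightarrow> 'm) \<Rightarrow> (nat \<Rightarrow> 'm) \<Rightarrow> ('k, ('m \<times> 'm \<Rightarrow>\<^sub>0 int) set) module"
where
  "hat_A N M \<iota> E r x y = (let M\<^sub>1 = basic_construction N M \<iota> E r x y in
     M\<^sub>1\<lparr>carrier := centralizer M\<^sub>1 ((\<lambda>n. basic_incl N M \<iota> r x y (\<iota> n)) ` carrier N)\<rparr>)"

definition psi_A :: "('n, 'nz) ring_scheme \<Rightarrow> ('k, 'm, 'mz) module_scheme \<Rightarrow> ('n \<Rightarrow> 'm) \<Rightarrow>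
  ('m \<Rightarrow> 'n) \<Rightarrow> nat \<Rightarrow> (nat \<Rightarrow> 'm) \<Rightarrow> (nat \<Rightarrow> 'm) \<Rightarrow> ('m \<Rightarrow> 'm) \<Rightarrow> ('m \<times> 'm \<Rightarrow>\<^sub>0 int) set"
where
  "psi_A N M \<iota> E r x y \<alpha> =
     (let M\<^sub>1 = basic_construction N M \<iota> E r x y; incl = basic_incl N M \<iota> r x y in
      \<Oplus>\<^bsub>M\<^sub>1\<^esub>j\<in>{..<r}. incl (\<alpha> (x j)) \<otimes>\<^bsub>M\<^sub>1\<^esub> jones_idem N M \<iota> \<otimes>\<^bsub>M\<^sub>1\<^esub> incl (y j))"

definition psi_A_inv :: "('n, 'nz) ring_scheme \<Rightarrow> ('k, 'm, 'mz) module_scheme \<Rightarrow> ('n \<Rightarrow> 'm) \<Rightarrow>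
  ('m \<Rightarrow> 'n) \<Rightarrow> nat \<Rightarrow> (nat \<Rightarrow> 'm) \<Rightarrow> (nat \<Rightarrow> 'm) \<Rightarrow> ('m \<times> 'm \<Rightarrow>\<^sub>0 int) set \<Rightarrow> 'm \<Rightarrow> 'm"
where
  "psi_A_inv N M \<iota> E r x y =
     the_inv_into (carrier (bimod_End N M \<iota>)) (psi_A N M \<iota> E r x y)"

text \<open>\<open>(\<psi>\<^sub>A \<otimes> \<psi>\<^sub>A) \<circ> \<Delta> \<circ> \<psi>\<^sub>A\<inverse>\<close>, with values in the tensor square over \<open>K\<close>.\<close>

definition hat_coproduct :: "('k, 'kz) ring_scheme \<Rightarrow> ('n, 'nz) ring_scheme \<Rightarrow>
  ('k, 'm, 'mz) module_scheme \<Rightarrow> ('n \<Rightarrow> 'm) \<Rightarrow> ('m \<Rightarrow> 'n) \<Rightarrow> nat \<Rightarrow> (nat \<Rightarrow> 'm) \<Rightarrow> (nat \<Rightarrow> 'm) \<Rightarrow>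
  nat \<Rightarrow> (nat \<Rightarrow> ('m \<times> 'm \<Rightarrow>\<^sub>0 int) set) \<Rightarrow> (nat \<Rightarrow> 'm \<Rightarrow> 'm) \<Rightarrow>
  ('m \<times> 'm \<Rightarrow>\<^sub>0 int) set \<Rightarrow> (('m \<times> 'm \<Rightarrow>\<^sub>0 int) set \<times> ('m \<times> 'm \<Rightarrow>\<^sub>0 int) set \<Rightarrow>\<^sub>0 int) set"
where
  "hat_coproduct K N M \<iota> E r x y s b \<beta> a =
     (let B = sym_bimod (hat_A N M \<iota> E r x y); \<psi> = psi_A N M \<iota> E r x y in
      tensor_lift (tensor K B B) (\<lambda>\<gamma> \<delta>. tensor_elem K B B (\<psi> \<gamma>) (\<psi> \<delta>))
        (End_coproduct K N M \<iota> s b \<beta> (psi_A_inv N M \<iota> E r x y a)))"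

definition hat_antipode :: "('n, 'nz) ring_scheme \<Rightarrow>
  ('k, 'm, 'mz) module_scheme \<Rightarrow> ('n \<Rightarrow> 'm) \<Rightarrow> ('m \<Rightarrow> 'n) \<Rightarrow> nat \<Rightarrow> (nat \<Rightarrow> 'm) \<Rightarrow> (nat \<Rightarrow> 'm) \<Rightarrow>
  nat \<Rightarrow> (nat \<Rightarrow> ('m \<times> 'm \<Rightarrow>\<^sub>0 int) set) \<Rightarrow> (nat \<Rightarrow> 'm \<Rightarrow> 'm) \<Rightarrow>
  ('m \<times> 'm \<Rightarrow>\<^sub>0 int) set \<Rightarrow> ('m \<times> 'm \<Rightarrow>\<^sub>0 int) set"
where
  "hat_antipode N M \<iota> E r x y s b \<beta> a =
     psi_A N M \<iota> E r x y (End_antipode M \<iota> E r x y s b \<beta> (psi_A_inv N M \<iota> E r x y a))"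


section \<open>Tensor maps are well defined, and depth two gives a left quasibasis\<close>

definition frag_ext :: "('g,'gz) ring_scheme \<Rightarrow> ('p \<Rightarrow> 'g) \<Rightarrow> ('p \<Rightarrow>\<^sub>0 int) \<Rightarrow> 'g" where
 "frag_ext G f c = (\<Oplus>\<^bsub>G\<^esub>p \<in> Poly_Mapping.keys c. [Poly_Mapping.lookup c p] \<cdot>\<^bsub>G\<^esub> f p)"

context abelian_group begin
lemma apow_closed: "a \<in> carrier G \<Longrightarrow> [(k::int)] \<cdot> a \<in> carrier G"
  using add.int_pow_closed[of a k] by (simp add: add_pow_def)
lemma apow_0: "[(0::int)] \<cdot> a = \<zero>"
  by (simp add: add_pow_def)
lemma apow_1: "a \<in> carrier G \<Longrightarrow> [(1::int)] \<cdot> a = a"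
  using add.int_pow_1[of a] by (simp add: add_pow_def)
lemma apow_add: "a \<in> carrier G \<Longrightarrow> [(k + l::int)] \<cdot> a = [k] \<cdot> a \<oplus> [l] \<cdot> a"
  using add.int_pow_mult[of a k l] by (simp add: add_pow_def)
end

lemma frag_ext_superset:
  assumes "abelian_group G" "finite S" "Poly_Mapping.keys c \<subseteq> S" "f ` S \<subseteq> carrier G"
  shows "frag_ext G f c = (\<Oplus>\<^bsub>G\<^esub>p \<in> S. [Poly_Mapping.lookup c p] \<cdot>\<^bsub>G\<^esub> f p)"
proof -
  interpret abelian_group G by fact
  show ?thesis unfolding frag_ext_def
    by (rule add.finprod_mono_neutral_cong_left)
       (use assms in \<open>auto simp: Poly_Mapping.in_keys_iff apow_closed image_subset_iff apow_0\<close>)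
qed

lemma frag_ext_closed:
  assumes "abelian_group G" "f ` S \<subseteq> carrier G" "Poly_Mapping.keys c \<subseteq> S"
  shows "frag_ext G f c \<in> carrier G"
proof -
  interpret abelian_group G by fact
  show ?thesis unfolding frag_ext_def
    by (rule finsum_closed) (use assms in \<open>auto simp: image_subset_iff intro!: apow_closed\<close>)
qed

lemma frag_ext_add:
  assumes "abelian_group G" "f ` S \<subseteq> carrier G" "Poly_Mapping.keys c \<subseteq> S" "Poly_Mapping.keys d \<subseteq> S"
  shows "frag_ext G f (c + d) = frag_ext G f c \<oplus>\<^bsub>G\<^esub> frag_ext G f d"
proof -
  interpret abelian_group G by fact
  let ?U = "Poly_Mapping.keys c \<union> Poly_Mapping.keys d"
  have U: "finite ?U" "f ` ?U \<subseteq> carrier G" using assms by auto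
  have "frag_ext G f (c + d) = (\<Oplus>\<^bsub>G\<^esub>p \<in> ?U. [Poly_Mapping.lookup (c + d) p] \<cdot>\<^bsub>G\<^esub> f p)"
    by (rule frag_ext_superset) (use U assms Poly_Mapping.keys_add[of c d] in auto)
  also have "\<dots> = (\<Oplus>\<^bsub>G\<^esub>p \<in> ?U. [Poly_Mapping.lookup c p] \<cdot>\<^bsub>G\<^esub> f p \<oplus>\<^bsub>G\<^esub> [Poly_Mapping.lookup d p] \<cdot>\<^bsub>G\<^esub> f p)"
    by (rule finsum_cong') (use U in \<open>auto simp: image_subset_iff lookup_add apow_add intro!: apow_closed add.m_closed\<close>)
  also have "\<dots> = (\<Oplus>\<^bsub>G\<^esub>p \<in> ?U. [Poly_Mapping.lookup c p] \<cdot>\<^bsub>G\<^esub> f p) \<oplus>\<^bsub>G\<^esub> (\<Oplus>\<^bsub>G\<^esub>p \<in> ?U. [Poly_Mapping.lookup d p] \<cdot>\<^bsub>G\<^esub> f p)"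
    by (rule finsum_addf) (use U in \<open>auto simp: image_subset_iff intro!: apow_closed\<close>)
  also have "\<dots> = frag_ext G f c \<oplus>\<^bsub>G\<^esub> frag_ext G f d"
    using frag_ext_superset[OF assms(1) U(1), of c f] frag_ext_superset[OF assms(1) U(1), of d f] U by auto
  finally show ?thesis .
qed

lemma frag_ext_single:
  assumes "abelian_group G" "f p \<in> carrier G"
  shows "frag_ext G f (frag_of p) = f p"
proof -
  interpret abelian_group G by fact
  show ?thesis unfolding frag_ext_def using assms
    by (simp add: apow_1)
qed

lemma frag_ext_hom:
  assumes "abelian_group G" "f ` S \<subseteq> carrier G"
  shows "group_hom (free_Abelian_group S) (add_monoid G) (frag_ext G f)"
proof -
  interpret G: abelian_group G by fact
  show ?thesis
    unfolding group_hom_def group_hom_axioms_def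
    using assms by (auto simp: hom_def frag_ext_add[of _ _ S] frag_ext_closed[of _ _ S] G.add.is_group)
qed

locale tensor_data =
  fixes R :: "('r,'rz) ring_scheme" and X :: "('l,'x,'r,'xz) bimodule_scheme"
    and Y :: "('r,'y,'s,'yz) bimodule_scheme"
  assumes X: "abelian_group X" and Y: "abelian_group Y"
    and ract: "\<And>u r. \<lbrakk>u \<in> carrier X; r \<in> carrier R\<rbrakk> \<Longrightarrow> ract X u r \<in> carrier X"
    and lact: "\<And>r v. \<lbrakk>r \<in> carrier R; v \<in> carrier Y\<rbrakk> \<Longrightarrow> lact Y r v \<in> carrier Y"
begin

sublocale X: abelian_group X by (rule X)
sublocale Y: abelian_group Y by (rule Y)

abbreviation (input) "FF \<equiv> free_Abelian_group (carrier X \<times> carrier Y)"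
abbreviation (input) "TT \<equiv> tensor_add R X Y"
abbreviation (input) "HH \<equiv> tensor_subgroup R X Y"

sublocale FF: comm_group FF by (rule abelian_free_Abelian_group)

lemma rel_sub: "tensor_relators R X Y \<subseteq> carrier FF"
proof -
  have "frag_of a - frag_of b - frag_of c \<in> carrier FF" "frag_of a - frag_of b \<in> carrier FF"
    if "a \<in> carrier X \<times> carrier Y" "b \<in> carrier X \<times> carrier Y" "c \<in> carrier X \<times> carrier Y" for a b c
  proof -
    have "Poly_Mapping.keys (frag_of a - frag_of b) \<subseteq> {a,b}"
      "Poly_Mapping.keys (frag_of a - frag_of b - frag_of c) \<subseteq> {a,b,c}"
      using keys_diff[of "frag_of a" "frag_of b"] keys_diff[of "frag_of a - frag_of b" "frag_of c"] by auto
    then show "frag_of a - frag_of b - frag_of c \<in> carrier FF" "frag_of a - frag_of b \<in> carrier FF"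
      using that by auto
  qed
  then show ?thesis
    unfolding tensor_relators_def by (auto simp: ract lact)
qed

lemma sub: "subgroup HH FF"
  unfolding tensor_subgroup_def by (rule FF.generate_is_subgroup[OF rel_sub])

sublocale HH: normal HH FF
  by (rule FF.normal_iff_subgroup[THEN iffD2, OF sub])

lemma tensor_group: "comm_group (tensor_group R X Y)"
  unfolding tensor_group_def by (rule FF.abelian_FactGroup[OF sub])

lemma TT: "abelian_group TT"
proof -
  interpret g: comm_group "tensor_group R X Y" by (rule tensor_group)
  show ?thesis
    unfolding tensor_add_def
    by (intro abelian_groupI; simp only: ring.simps partial_object.simps monoid.simps;
        (rule g.m_closed g.one_closed g.m_assoc g.m_comm g.l_one g.l_inv_ex; assumption)?)
qed

lemma carr: "carrier TT = (\<lambda>c. HH #>\<^bsub>FF\<^esub> c) ` carrier FF"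
  by (simp add: tensor_add_def tensor_group_def carrier_FactGroup)

lemma elem_closed: "u \<in> carrier X \<Longrightarrow> v \<in> carrier Y \<Longrightarrow> tensor_elem R X Y u v \<in> carrier TT"
  by (auto simp: tensor_elem_def carr)

lemma add_cosets: "c \<in> carrier FF \<Longrightarrow> d \<in> carrier FF \<Longrightarrow>
   (HH #>\<^bsub>FF\<^esub> c) \<oplus>\<^bsub>TT\<^esub> (HH #>\<^bsub>FF\<^esub> d) = HH #>\<^bsub>FF\<^esub> (c + d)"
  by (simp add: tensor_add_def tensor_group_def HH.rcos_sum)

lemma coset_eq:
  assumes "c \<in> carrier FF" "d \<in> carrier FF" "c - d \<in> HH"
  shows "HH #>\<^bsub>FF\<^esub> c = HH #>\<^bsub>FF\<^esub> d"
proof (rule FF.repr_independence[OF _ _ sub, symmetric])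
  show "d \<in> carrier FF" by fact
  have "c = (c - d) \<otimes>\<^bsub>FF\<^esub> d" by simp
  then show "c \<in> HH #>\<^bsub>FF\<^esub> d" using assms(3) unfolding r_coset_def by blast
qed

lemma frag_closed: "u \<in> carrier X \<Longrightarrow> v \<in> carrier Y \<Longrightarrow> frag_of (u, v) \<in> carrier FF"
  by simp

lemma rel_in: "t \<in> tensor_relators R X Y \<Longrightarrow> t \<in> HH"
  unfolding tensor_subgroup_def by (rule generate.incl)

lemma elem_addl:
  assumes "u \<in> carrier X" "u' \<in> carrier X" "v \<in> carrier Y"
  shows "tensor_elem R X Y (u \<oplus>\<^bsub>X\<^esub> u') v = tensor_elem R X Y u v \<oplus>\<^bsub>TT\<^esub> tensor_elem R X Y u' v"
  unfolding tensor_elem_def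
proof (subst add_cosets)
  have c: "frag_of (u, v) + frag_of (u', v) \<in> carrier FF"
    using FF.m_closed[OF frag_closed frag_closed, of u v u' v] assms by (simp only: mult_free_Abelian_group)
  have "frag_of (u \<oplus>\<^bsub>X\<^esub> u', v) - (frag_of (u, v) + frag_of (u', v)) \<in> HH"
    by (rule rel_in) (use assms in \<open>auto simp: tensor_relators_def diff_diff_eq[symmetric]\<close>)
  then show "HH #>\<^bsub>FF\<^esub> frag_of (u \<oplus>\<^bsub>X\<^esub> u', v) = HH #>\<^bsub>FF\<^esub> (frag_of (u, v) + frag_of (u', v))"
    by (rule coset_eq[rotated 2]) (use assms c in \<open>auto intro!: frag_closed simp del: carrier_free_Abelian_group_iff frag_of_in_free_Abelian_group\<close>)
qed (use assms in \<open>auto\<close>)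

lemma elem_addr:
  assumes "u \<in> carrier X" "v \<in> carrier Y" "v' \<in> carrier Y"
  shows "tensor_elem R X Y u (v \<oplus>\<^bsub>Y\<^esub> v') = tensor_elem R X Y u v \<oplus>\<^bsub>TT\<^esub> tensor_elem R X Y u v'"
  unfolding tensor_elem_def
proof (subst add_cosets)
  have c: "frag_of (u, v) + frag_of (u, v') \<in> carrier FF"
    using FF.m_closed[OF frag_closed frag_closed, of u v u v'] assms by (simp only: mult_free_Abelian_group)
  have "frag_of (u, v \<oplus>\<^bsub>Y\<^esub> v') - (frag_of (u, v) + frag_of (u, v')) \<in> HH"
    by (rule rel_in) (use assms in \<open>auto simp: tensor_relators_def diff_diff_eq[symmetric]\<close>)
  then show "HH #>\<^bsub>FF\<^esub> frag_of (u, v \<oplus>\<^bsub>Y\<^esub> v') = HH #>\<^bsub>FF\<^esub> (frag_of (u, v) + frag_of (u, v'))"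
    by (rule coset_eq[rotated 2]) (use assms c in \<open>auto intro!: frag_closed simp del: carrier_free_Abelian_group_iff frag_of_in_free_Abelian_group\<close>)
qed (use assms in \<open>auto\<close>)

lemma elem_bal:
  assumes "u \<in> carrier X" "r \<in> carrier R" "v \<in> carrier Y"
  shows "tensor_elem R X Y (ract X u r) v = tensor_elem R X Y u (lact Y r v)"
  unfolding tensor_elem_def
proof (rule coset_eq)
  show "frag_of (ract X u r, v) - frag_of (u, lact Y r v) \<in> HH"
    by (rule rel_in) (use assms in \<open>unfold tensor_relators_def, blast\<close>)
qed (use assms ract lact in auto)

context
  fixes G :: "('g, 'gz) ring_scheme" and f :: "'x \<Rightarrow> 'y \<Rightarrow> 'g"
  assumes G: "abelian_group G"
    and cl: "\<And>u v. u \<in> carrier X \<Longrightarrow> v \<in> carrier Y \<Longrightarrow> f u v \<in> carrier G"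
    and addl: "\<And>u u' v. u \<in> carrier X \<Longrightarrow> u' \<in> carrier X \<Longrightarrow> v \<in> carrier Y \<Longrightarrow> f (u \<oplus>\<^bsub>X\<^esub> u') v = f u v \<oplus>\<^bsub>G\<^esub> f u' v"
    and addr: "\<And>u v v'. u \<in> carrier X \<Longrightarrow> v \<in> carrier Y \<Longrightarrow> v' \<in> carrier Y \<Longrightarrow> f u (v \<oplus>\<^bsub>Y\<^esub> v') = f u v \<oplus>\<^bsub>G\<^esub> f u v'"
    and bal: "\<And>u r v. u \<in> carrier X \<Longrightarrow> r \<in> carrier R \<Longrightarrow> v \<in> carrier Y \<Longrightarrow> f (ract X u r) v = f u (lact Y r v)"
begin

interpretation G: abelian_group G by (rule G)

lemma lift_hom: "group_hom FF (add_monoid G) (frag_ext G (\<lambda>p. f (fst p) (snd p)))"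
  by (rule frag_ext_hom[OF G]) (auto simp: cl)

interpretation h: group_hom FF "add_monoid G" "frag_ext G (\<lambda>p. f (fst p) (snd p))"
  by (rule lift_hom)

lemma ext_elem: "u \<in> carrier X \<Longrightarrow> v \<in> carrier Y \<Longrightarrow> frag_ext G (\<lambda>p. f (fst p) (snd p)) (frag_of (u,v)) = f u v"
  by (subst frag_ext_single) (auto simp: G cl)

lemma ext_diff: assumes "c \<in> carrier FF" "d \<in> carrier FF"
  shows "frag_ext G (\<lambda>p. f (fst p) (snd p)) (c - d) =
     frag_ext G (\<lambda>p. f (fst p) (snd p)) c \<ominus>\<^bsub>G\<^esub> frag_ext G (\<lambda>p. f (fst p) (snd p)) d"
proof -
  have "c - d = c \<otimes>\<^bsub>FF\<^esub> inv\<^bsub>FF\<^esub> d"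
    using assms by simp
  moreover have "inv\<^bsub>FF\<^esub> d \<in> carrier FF" by (rule FF.inv_closed[OF assms(2)])
  ultimately show ?thesis using h.hom_mult[OF assms(1), of "inv\<^bsub>FF\<^esub> d"] h.hom_inv[OF assms(2)]
    by (simp only: a_minus_def a_inv_def monoid.simps)
qed

lemma sub_kernel: "HH \<subseteq> kernel FF (add_monoid G) (frag_ext G (\<lambda>p. f (fst p) (snd p)))"
proof -
  let ?h = "frag_ext G (\<lambda>p. f (fst p) (snd p))"
  have d2: "?h (frag_of a - frag_of b) = ?h (frag_of a) \<ominus>\<^bsub>G\<^esub> ?h (frag_of b)"
    if "a \<in> carrier X \<times> carrier Y" "b \<in> carrier X \<times> carrier Y" for a b
    by (rule ext_diff) (use that in auto)
  have d3: "?h (frag_of a - frag_of b - frag_of c) = ?h (frag_of a) \<ominus>\<^bsub>G\<^esub> ?h (frag_of b) \<ominus>\<^bsub>G\<^esub> ?h (frag_of c)"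
    if "a \<in> carrier X \<times> carrier Y" "b \<in> carrier X \<times> carrier Y" "c \<in> carrier X \<times> carrier Y" for a b c
  proof (subst ext_diff)
    show "frag_of a - frag_of b \<in> carrier FF"
      using that keys_diff[of "frag_of a" "frag_of b"] by auto
  qed (use that d2 in auto)
  have z: "g1 \<oplus>\<^bsub>G\<^esub> g2 \<ominus>\<^bsub>G\<^esub> g1 \<ominus>\<^bsub>G\<^esub> g2 = \<zero>\<^bsub>G\<^esub>" if "g1 \<in> carrier G" "g2 \<in> carrier G" for g1 g2
    using that by (metis G.a_comm G.add.inv_solve_right' G.add.m_closed G.minus_closed G.minus_eq G.r_neg)
  have "tensor_relators R X Y \<subseteq> kernel FF (add_monoid G) ?h"
  proof
    fix t assume t: "t \<in> tensor_relators R X Y"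
    then have tc: "t \<in> carrier FF" by (rule subsetD[OF rel_sub])
    have "?h t = \<zero>\<^bsub>G\<^esub>"
      using t unfolding tensor_relators_def
    proof (elim UnE CollectE exE conjE)
      fix u u' v assume *: "t = frag_of (u \<oplus>\<^bsub>X\<^esub> u', v) - frag_of (u, v) - frag_of (u', v)"
        "u \<in> carrier X" "u' \<in> carrier X" "v \<in> carrier Y"
      show ?thesis unfolding *(1) using * by (subst d3) (auto simp: ext_elem addl z cl)
    next
      fix u v v' assume *: "t = frag_of (u, v \<oplus>\<^bsub>Y\<^esub> v') - frag_of (u, v) - frag_of (u, v')"
        "u \<in> carrier X" "v \<in> carrier Y" "v' \<in> carrier Y"
      show ?thesis unfolding *(1) using * by (subst d3) (auto simp: ext_elem addr z cl)
    next
      fix u r v assume *: "t = frag_of (ract X u r, v) - frag_of (u, lact Y r v)"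
        "u \<in> carrier X" "r \<in> carrier R" "v \<in> carrier Y"
      show ?thesis unfolding *(1) using * by (subst d2) (auto simp: ext_elem bal cl ract lact G.minus_eq G.r_neg)
    qed
    then show "t \<in> kernel FF (add_monoid G) ?h" using tc unfolding kernel_def by (intro CollectI conjI) simp_all
  qed
  then show ?thesis unfolding tensor_subgroup_def
    by (rule FF.generate_subgroup_incl[OF _ h.subgroup_kernel])
qed

lemma lift_coset: assumes "c \<in> carrier FF"
  shows "tensor_lift G f (HH #>\<^bsub>FF\<^esub> c) = frag_ext G (\<lambda>p. f (fst p) (snd p)) c"
proof -
  let ?h = "frag_ext G (\<lambda>p. f (fst p) (snd p))"
  have "?h (k + c) = ?h c" if "k \<in> HH" for k
  proof -
    have k: "k \<in> carrier FF" "?h k = \<zero>\<^bsub>G\<^esub>" using that sub_kernel by (auto simp: kernel_def)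
    show ?thesis using h.hom_mult[OF k(1) assms] k(2) h.hom_closed[OF assms] by simp
  qed
  moreover have "0 \<in> HH" using subgroup.one_closed[OF sub] by (simp only: one_free_Abelian_group)
  ultimately have "?h ` (HH #>\<^bsub>FF\<^esub> c) = {?h c}"
    unfolding r_coset_def mult_free_Abelian_group
    by (intro equalityI subsetI) (auto intro!: image_eqI[of _ _ "0 + c"])
  then show ?thesis by (simp add: tensor_lift_def frag_ext_def)
qed

lemma lift_elem: "u \<in> carrier X \<Longrightarrow> v \<in> carrier Y \<Longrightarrow> tensor_lift G f (tensor_elem R X Y u v) = f u v"
  by (simp add: tensor_elem_def lift_coset ext_elem)

lemma lift_closed: assumes "t \<in> carrier TT" shows "tensor_lift G f t \<in> carrier G"
proof -
  obtain c where c: "c \<in> carrier FF" "t = HH #>\<^bsub>FF\<^esub> c" using assms unfolding carr by blast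
  show ?thesis using h.hom_closed[OF c(1)] by (simp only: c(2) lift_coset[OF c(1)]) simp
qed

lemma lift_add: assumes "t \<in> carrier TT" "t' \<in> carrier TT"
  shows "tensor_lift G f (t \<oplus>\<^bsub>TT\<^esub> t') = tensor_lift G f t \<oplus>\<^bsub>G\<^esub> tensor_lift G f t'"
proof -
  obtain c where c: "c \<in> carrier FF" "t = HH #>\<^bsub>FF\<^esub> c" using assms(1) unfolding carr by blast
  obtain d where d: "d \<in> carrier FF" "t' = HH #>\<^bsub>FF\<^esub> d" using assms(2) unfolding carr by blast
  have cd: "c + d \<in> carrier FF" using FF.m_closed[OF c(1) d(1)] by (simp only: mult_free_Abelian_group)
  show ?thesis using h.hom_mult[OF c(1) d(1)]
    by (simp only: c(2) d(2) add_cosets[OF c(1) d(1)] lift_coset[OF cd] lift_coset[OF c(1)] lift_coset[OF d(1)]) simp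
qed

end

end

lemma reg_bimod_simps [simp]:
  "carrier (reg_bimod f M g) = carrier M" "add (reg_bimod f M g) = add M"
  "\<zero>\<^bsub>reg_bimod f M g\<^esub> = \<zero>\<^bsub>M\<^esub>"
  "lact (reg_bimod f M g) l u = f l \<otimes>\<^bsub>M\<^esub> u" "ract (reg_bimod f M g) u r = u \<otimes>\<^bsub>M\<^esub> g r"
  by (simp_all add: reg_bimod_def)

lemma tensor_indep0:
  "tensor_subgroup N (reg_bimod f M \<iota>) (reg_bimod \<iota> M g) = tensor_subgroup N (reg_bimod id M \<iota>) (reg_bimod \<iota> M id)"
  unfolding tensor_subgroup_def tensor_relators_def reg_bimod_simps ..

lemma tensor_indep:
  "tensor_add N (reg_bimod f M \<iota>) (reg_bimod \<iota> M g) = tensor_add N (reg_bimod id M \<iota>) (reg_bimod \<iota> M id)"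
  unfolding tensor_add_def tensor_group_def tensor_indep0[of N f M \<iota> g] reg_bimod_simps ..

lemma tensor_indep_elem:
  "tensor_elem N (reg_bimod f M \<iota>) (reg_bimod \<iota> M g) u v = ptensor N M \<iota> u v"
  unfolding ptensor_def tensor_elem_def tensor_indep0[of N f M \<iota> g] reg_bimod_simps ..

lemma tensor_square_simps:
  "carrier (tensor_square N M \<iota> f g) = carrier (tensor_add N (reg_bimod id M \<iota>) (reg_bimod \<iota> M id))"
  "add (tensor_square N M \<iota> f g) = add (tensor_add N (reg_bimod id M \<iota>) (reg_bimod \<iota> M id))"
  "\<zero>\<^bsub>tensor_square N M \<iota> f g\<^esub> = \<zero>\<^bsub>tensor_add N (reg_bimod id M \<iota>) (reg_bimod \<iota> M id)\<^esub>"
  "lact (tensor_square N M \<iota> f g) l = tensor_lift (tensor_add N (reg_bimod id M \<iota>) (reg_bimod \<iota> M id))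
      (\<lambda>u v. ptensor N M \<iota> (f l \<otimes>\<^bsub>M\<^esub> u) v)"
  "ract (tensor_square N M \<iota> f g) t l' = tensor_lift (tensor_add N (reg_bimod id M \<iota>) (reg_bimod \<iota> M id))
      (\<lambda>u v. ptensor N M \<iota> u (v \<otimes>\<^bsub>M\<^esub> g l')) t"
  unfolding tensor_square_def tensor_def tensor_indep[of N f M \<iota> g] tensor_indep_elem
  by simp_all

lemma finsum_hom:
  assumes "abelian_group G" "abelian_group H" "finite A" "x \<in> A \<rightarrow> carrier G"
    "\<And>u. u \<in> carrier G \<Longrightarrow> h u \<in> carrier H"
    "\<And>u v. u \<in> carrier G \<Longrightarrow> v \<in> carrier G \<Longrightarrow> h (u \<oplus>\<^bsub>G\<^esub> v) = h u \<oplus>\<^bsub>H\<^esub> h v"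
  shows "h (\<Oplus>\<^bsub>G\<^esub>i\<in>A. x i) = (\<Oplus>\<^bsub>H\<^esub>i\<in>A. h (x i))"
proof -
  interpret G: abelian_group G by fact
  interpret H: abelian_group H by fact
  have 0: "h \<zero>\<^bsub>G\<^esub> = \<zero>\<^bsub>H\<^esub>"
    using assms(5,6)[of "\<zero>\<^bsub>G\<^esub>"] assms(6)[of "\<zero>\<^bsub>G\<^esub>" "\<zero>\<^bsub>G\<^esub>"]
    by (metis G.l_zero G.zero_closed H.add.l_cancel_one')
  show ?thesis using assms(3,4)
  proof (induction A rule: finite_induct)
    case (insert a A)
    have "h (\<Oplus>\<^bsub>G\<^esub>i\<in>insert a A. x i) = h (x a \<oplus>\<^bsub>G\<^esub> (\<Oplus>\<^bsub>G\<^esub>i\<in>A. x i))"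
      using insert by (subst G.finsum_insert) auto
    also have "\<dots> = h (x a) \<oplus>\<^bsub>H\<^esub> h (\<Oplus>\<^bsub>G\<^esub>i\<in>A. x i)"
      using insert by (intro assms(6) G.finsum_closed) auto
    also have "\<dots> = (\<Oplus>\<^bsub>H\<^esub>i\<in>insert a A. h (x i))"
      using insert assms(5) by (subst H.finsum_insert) (auto simp: Pi_iff)
    finally show ?case .
  qed (simp add: 0)
qed



lemma (in abelian_group) abelian_group_reg_bimod: "abelian_group (reg_bimod f G g)"
  by (rule abelian_groupI) (auto simp: a_ac intro: add.l_inv_ex)

context algebra_extension begin

abbreviation (input) "XX \<equiv> reg_bimod id M \<iota>"
abbreviation (input) "YY \<equiv> reg_bimod \<iota> M id"
abbreviation (input) "MM \<equiv> tensor_add N XX YY"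
abbreviation (input) "pten \<equiv> ptensor N M \<iota>"

lemma \<iota>_closed: "n \<in> carrier N \<Longrightarrow> \<iota> n \<in> carrier M"
  using ring_hom_closed[OF hom] .

sublocale td: tensor_data N XX YY
  by (rule tensor_data.intro) (auto simp: \<iota>_closed intro: M.M.abelian_group_reg_bimod)

sublocale T: abelian_group MM by (rule td.TT)

lemma pten_closed: "u \<in> carrier M \<Longrightarrow> v \<in> carrier M \<Longrightarrow> pten u v \<in> carrier MM"
  using td.elem_closed[of u v] by (simp add: ptensor_def)

lemma pten_addl: "u \<in> carrier M \<Longrightarrow> u' \<in> carrier M \<Longrightarrow> v \<in> carrier M \<Longrightarrow>
    pten (u \<oplus>\<^bsub>M\<^esub> u') v = pten u v \<oplus>\<^bsub>MM\<^esub> pten u' v"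
  using td.elem_addl[of u u' v] by (simp add: ptensor_def)

lemma pten_addr: "u \<in> carrier M \<Longrightarrow> v \<in> carrier M \<Longrightarrow> v' \<in> carrier M \<Longrightarrow>
    pten u (v \<oplus>\<^bsub>M\<^esub> v') = pten u v \<oplus>\<^bsub>MM\<^esub> pten u v'"
  using td.elem_addr[of u v v'] by (simp add: ptensor_def)

lemma pten_bal: "u \<in> carrier M \<Longrightarrow> n \<in> carrier N \<Longrightarrow> v \<in> carrier M \<Longrightarrow>
    pten (u \<otimes>\<^bsub>M\<^esub> \<iota> n) v = pten u (\<iota> n \<otimes>\<^bsub>M\<^esub> v)"
  using td.elem_bal[of u n v] by (simp add: ptensor_def)

abbreviation (input) "La l \<equiv> tensor_lift MM (\<lambda>u v. pten (l \<otimes>\<^bsub>M\<^esub> u) v)"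
abbreviation (input) "Ra l \<equiv> tensor_lift MM (\<lambda>u v. pten u (v \<otimes>\<^bsub>M\<^esub> l))"

lemma La:
  assumes l: "l \<in> carrier M"
  shows "t \<in> carrier MM \<Longrightarrow> La l t \<in> carrier MM"
   "t \<in> carrier MM \<Longrightarrow> t' \<in> carrier MM \<Longrightarrow> La l (t \<oplus>\<^bsub>MM\<^esub> t') = La l t \<oplus>\<^bsub>MM\<^esub> La l t'"
   "u \<in> carrier M \<Longrightarrow> v \<in> carrier M \<Longrightarrow> La l (pten u v) = pten (l \<otimes>\<^bsub>M\<^esub> u) v"
  subgoal by (rule td.lift_closed[OF T.abelian_group_axioms])
     (simp_all add: l pten_closed pten_addl pten_addr pten_bal[symmetric] M.r_distr M.m_assoc \<iota>_closed)
  subgoal by (rule td.lift_add[OF T.abelian_group_axioms])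
     (simp_all add: l pten_closed pten_addl pten_addr pten_bal[symmetric] M.r_distr M.m_assoc \<iota>_closed)
  subgoal unfolding ptensor_def[of N M \<iota> u v] by (subst td.lift_elem[OF T.abelian_group_axioms])
     (simp_all add: l pten_closed pten_addl pten_addr pten_bal[symmetric] M.r_distr M.m_assoc \<iota>_closed)
  done

lemma Ra:
  assumes l: "l \<in> carrier M"
  shows "t \<in> carrier MM \<Longrightarrow> Ra l t \<in> carrier MM"
   "t \<in> carrier MM \<Longrightarrow> t' \<in> carrier MM \<Longrightarrow> Ra l (t \<oplus>\<^bsub>MM\<^esub> t') = Ra l t \<oplus>\<^bsub>MM\<^esub> Ra l t'"
   "u \<in> carrier M \<Longrightarrow> v \<in> carrier M \<Longrightarrow> Ra l (pten u v) = pten u (v \<otimes>\<^bsub>M\<^esub> l)"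
  subgoal by (rule td.lift_closed[OF T.abelian_group_axioms])
     (simp_all add: l pten_closed pten_addl pten_addr pten_bal M.l_distr M.m_assoc \<iota>_closed)
  subgoal by (rule td.lift_add[OF T.abelian_group_axioms])
     (simp_all add: l pten_closed pten_addl pten_addr pten_bal M.l_distr M.m_assoc \<iota>_closed)
  subgoal unfolding ptensor_def[of N M \<iota> u v] by (subst td.lift_elem[OF T.abelian_group_axioms])
     (simp_all add: l pten_closed pten_addl pten_addr pten_bal M.l_distr M.m_assoc \<iota>_closed)
  done

end

lemma bimod_power_simps [simp]:
  "carrier (bimod_power n X) = {..<n} \<rightarrow>\<^sub>E carrier X"
  "\<zero>\<^bsub>bimod_power n X\<^esub> = (\<lambda>i\<in>{..<n}. \<zero>\<^bsub>X\<^esub>)"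
  "add (bimod_power n X) = (\<lambda>u v. \<lambda>i\<in>{..<n}. u i \<oplus>\<^bsub>X\<^esub> v i)"
  "lact (bimod_power n X) = (\<lambda>l u. \<lambda>i\<in>{..<n}. lact X l (u i))"
  "ract (bimod_power n X) = (\<lambda>u r. \<lambda>i\<in>{..<n}. ract X (u i) r)"
  by (simp_all add: bimod_power_def)

lemma abelian_group_bimod_power:
  assumes "abelian_group X" shows "abelian_group (bimod_power n X)"
proof -
  interpret abelian_group X by fact
  show ?thesis
  proof (rule abelian_groupI)
    fix u assume u: "u \<in> carrier (bimod_power n X)"
    then have "(\<lambda>i\<in>{..<n}. \<ominus>\<^bsub>X\<^esub> u i) \<in> carrier (bimod_power n X)" by (auto simp: PiE_iff)
    moreover have "(\<lambda>i\<in>{..<n}. \<ominus>\<^bsub>X\<^esub> u i) \<oplus>\<^bsub>bimod_power n X\<^esub> u = \<zero>\<^bsub>bimod_power n X\<^esub>"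
      using u by (auto simp: PiE_iff l_neg intro!: restrict_ext)
    ultimately show "\<exists>v\<in>carrier (bimod_power n X). v \<oplus>\<^bsub>bimod_power n X\<^esub> u = \<zero>\<^bsub>bimod_power n X\<^esub>" by blast
    show "\<zero>\<^bsub>bimod_power n X\<^esub> \<oplus>\<^bsub>bimod_power n X\<^esub> u = u"
      using u by (auto simp: PiE_iff extensional_def fun_eq_iff)
  qed (auto simp: PiE_iff a_ac intro!: restrict_ext)
qed

lemma depth_two_imp_left_D2_quasibasis:
  assumes ext: "algebra_extension K N M \<iota>" and D2: "depth_two N M \<iota>"
  shows "\<exists>s b \<beta>. left_D2_quasibasis N M \<iota> s b \<beta>"
proof -
  interpret algebra_extension K N M \<iota> by (rule ext)
  obtain n P Q \<phi> where P: "sub_bimodule N M (bimod_power n YY) P"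
    and Q: "sub_bimodule N M (bimod_power n YY) Q"
    and PQ: "P \<inter> Q = {\<zero>\<^bsub>bimod_power n YY\<^esub>}"
    and dec: "\<And>v. v \<in> carrier (bimod_power n YY) \<Longrightarrow> \<exists>p\<in>P. \<exists>q\<in>Q. v = p \<oplus>\<^bsub>bimod_power n YY\<^esub> q"
    and \<phi>: "\<phi> \<in> bimod_hom N M (tensor_square N M \<iota> \<iota> id) (bimod_power n YY)"
    and bij: "bij_betw \<phi> (carrier (tensor_square N M \<iota> \<iota> id)) P"
    using D2 unfolding depth_two_def iso_direct_summand_def by blast
  define D where "D = bimod_power n YY"
  interpret D: abelian_group D
    unfolding D_def by (intro abelian_group_bimod_power M.M.abelian_group_reg_bimod)
  have Dlact: "lact D l v = (\<lambda>i\<in>{..<n}. \<iota> l \<otimes>\<^bsub>M\<^esub> v i)" and Dract: "ract D v m = (\<lambda>i\<in>{..<n}. v i \<otimes>\<^bsub>M\<^esub> m)"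
    and Dadd: "v \<oplus>\<^bsub>D\<^esub> w = (\<lambda>i\<in>{..<n}. v i \<oplus>\<^bsub>M\<^esub> w i)"
    and Dcarr: "carrier D = {..<n} \<rightarrow>\<^sub>E carrier M" for l v w m
    by (simp_all add: D_def)
  note PQ' = P[folded D_def, unfolded sub_bimodule_def] Q[folded D_def, unfolded sub_bimodule_def]
  have Ps: "subgroup P (add_monoid D)" and Qs: "subgroup Q (add_monoid D)" using PQ' by auto
  have Pc: "p \<in> carrier D" if "p \<in> P" for p using that subgroup.subset[OF Ps] by auto
  have Qc: "p \<in> carrier D" if "p \<in> Q" for p using that subgroup.subset[OF Qs] by auto
  have uniq: "p = p'" if "p \<in> P" "p' \<in> P" "q \<in> Q" "q' \<in> Q" "p \<oplus>\<^bsub>D\<^esub> q = p' \<oplus>\<^bsub>D\<^esub> q'" for p p' q q'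
  proof -
    have e: "\<ominus>\<^bsub>D\<^esub> p' \<oplus>\<^bsub>D\<^esub> p = q' \<oplus>\<^bsub>D\<^esub> \<ominus>\<^bsub>D\<^esub> q"
    proof -
      have "p = p' \<oplus>\<^bsub>D\<^esub> q' \<oplus>\<^bsub>D\<^esub> \<ominus>\<^bsub>D\<^esub> q" using that Pc Qc
        by (metis D.add.inv_solve_right' D.add.m_closed)
      then show ?thesis using that Pc Qc by (simp add: D.a_assoc D.r_neg1 D.r_neg2)
    qed
    moreover have "\<ominus>\<^bsub>D\<^esub> p' \<oplus>\<^bsub>D\<^esub> p \<in> P"
      using subgroup.m_closed[OF Ps subgroup.m_inv_closed[OF Ps that(2)] that(1)] by (simp add: a_inv_def)
    moreover have "q' \<oplus>\<^bsub>D\<^esub> \<ominus>\<^bsub>D\<^esub> q \<in> Q"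
      using subgroup.m_closed[OF Qs that(4) subgroup.m_inv_closed[OF Qs that(3)]] by (simp add: a_inv_def)
    ultimately have "\<ominus>\<^bsub>D\<^esub> p' \<oplus>\<^bsub>D\<^esub> p = \<zero>\<^bsub>D\<^esub>" using PQ by (auto simp: D_def[symmetric])
    then show ?thesis using that Pc by (metis D.add.inv_solve_left D.r_zero D.zero_closed)
  qed
  define \<pi> where "\<pi> v = (SOME p. p \<in> P \<and> (\<exists>q\<in>Q. v = p \<oplus>\<^bsub>D\<^esub> q))" for v
  have \<pi>: "\<pi> v \<in> P \<and> (\<exists>q\<in>Q. v = \<pi> v \<oplus>\<^bsub>D\<^esub> q)" if "v \<in> carrier D" for v
  proof -
    have "\<exists>p. p \<in> P \<and> (\<exists>q\<in>Q. v = p \<oplus>\<^bsub>D\<^esub> q)" using dec[folded D_def, OF that] by blast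
    from someI_ex[OF this] show ?thesis by (simp only: \<pi>_def)
  qed
  have \<pi>_eq: "\<pi> (p \<oplus>\<^bsub>D\<^esub> q) = p" if "p \<in> P" "q \<in> Q" for p q
    using \<pi>[of "p \<oplus>\<^bsub>D\<^esub> q"] uniq[of _ p _ q] that Pc Qc by (metis D.a_closed)
  have bij': "bij_betw \<phi> (carrier MM) P" using bij unfolding tensor_square_simps .
  define g where "g v = inv_into (carrier MM) \<phi> (\<pi> v)" for v
  have g: "g v \<in> carrier MM" "\<phi> (g v) = \<pi> v" if "v \<in> carrier D" for v
    using \<pi>[OF that] bij' unfolding g_def by (auto simp: bij_betw_def inv_into_into f_inv_into_f)
  have inj: "t = t'" if "\<phi> t = \<phi> t'" "t \<in> carrier MM" "t' \<in> carrier MM" for t t'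
    using bij' that by (auto simp: bij_betw_def inj_on_def)
  have \<phi>c: "\<phi> t \<in> P" if "t \<in> carrier MM" for t using bij' that by (auto simp: bij_betw_def)
  have \<phi>a: "\<phi> (t \<oplus>\<^bsub>MM\<^esub> t') = \<phi> t \<oplus>\<^bsub>D\<^esub> \<phi> t'" if "t \<in> carrier MM" "t' \<in> carrier MM" for t t'
    using \<phi> that unfolding bimod_hom_def tensor_square_simps D_def[symmetric] by blast
  have \<phi>l: "\<phi> (La (\<iota> l) t) = lact D l (\<phi> t)" if "t \<in> carrier MM" "l \<in> carrier N" for t l
    using \<phi> that unfolding bimod_hom_def tensor_square_simps D_def[symmetric] by blast
  have \<phi>r: "\<phi> (Ra m t) = ract D (\<phi> t) m" if "t \<in> carrier MM" "m \<in> carrier M" for t m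
    using \<phi> that unfolding bimod_hom_def tensor_square_simps D_def[symmetric] by simp
  have g\<phi>: "g (\<phi> t) = t" if "t \<in> carrier MM" for t
  proof -
    have "\<pi> (\<phi> t) = \<phi> t"
      using \<pi>_eq[OF \<phi>c[OF that] subgroup.one_closed[OF Qs]] Pc[OF \<phi>c[OF that]] by simp
    then show ?thesis using inj g[OF Pc[OF \<phi>c[OF that]]] that by metis
  qed
  have ga: "g (v \<oplus>\<^bsub>D\<^esub> w) = g v \<oplus>\<^bsub>MM\<^esub> g w" if v: "v \<in> carrier D" and w: "w \<in> carrier D" for v w
  proof -
    obtain q where q: "q \<in> Q" "v = \<pi> v \<oplus>\<^bsub>D\<^esub> q" "\<pi> v \<in> P" using \<pi>[OF v] by blast
    obtain q' where q': "q' \<in> Q" "w = \<pi> w \<oplus>\<^bsub>D\<^esub> q'" "\<pi> w \<in> P" using \<pi>[OF w] by blast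
    have "v \<oplus>\<^bsub>D\<^esub> w = (\<pi> v \<oplus>\<^bsub>D\<^esub> \<pi> w) \<oplus>\<^bsub>D\<^esub> (q \<oplus>\<^bsub>D\<^esub> q')"
      using q q' Pc Qc by (metis D.add.m_assoc D.add.m_lcomm D.a_closed)
    moreover have "\<pi> v \<oplus>\<^bsub>D\<^esub> \<pi> w \<in> P" "q \<oplus>\<^bsub>D\<^esub> q' \<in> Q"
      using subgroup.m_closed[OF Ps q(3) q'(3)] subgroup.m_closed[OF Qs q(1) q'(1)] by simp_all
    ultimately have "\<pi> (v \<oplus>\<^bsub>D\<^esub> w) = \<pi> v \<oplus>\<^bsub>D\<^esub> \<pi> w" using \<pi>_eq by metis
    then have "\<phi> (g (v \<oplus>\<^bsub>D\<^esub> w)) = \<phi> (g v \<oplus>\<^bsub>MM\<^esub> g w)"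
      using g[OF v] g[OF w] g[OF D.a_closed[OF v w]] by (simp add: \<phi>a)
    then show ?thesis by (rule inj) (use g v w in auto)
  qed
  have Plr: "lact D l p \<in> P" "ract D p m \<in> P" if "p \<in> P" "l \<in> carrier N" "m \<in> carrier M" for p l m
    using PQ'(1) that by auto
  have Qlr: "lact D l p \<in> Q" "ract D p m \<in> Q" if "p \<in> Q" "l \<in> carrier N" "m \<in> carrier M" for p l m
    using PQ'(2) that by auto
  have gl: "g (lact D l v) = La (\<iota> l) (g v)" if v: "v \<in> carrier D" and l: "l \<in> carrier N" for v l
  proof -
    obtain q where q: "q \<in> Q" "v = \<pi> v \<oplus>\<^bsub>D\<^esub> q" "\<pi> v \<in> P" using \<pi>[OF v] by blast
    have c: "lact D l v \<in> carrier D" using v \<iota>_closed[OF l] by (auto simp: Dlact Dcarr PiE_iff)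
    have "lact D l (\<pi> v \<oplus>\<^bsub>D\<^esub> q) = lact D l (\<pi> v) \<oplus>\<^bsub>D\<^esub> lact D l q"
      using Pc[OF q(3)] Qc[OF q(1)] \<iota>_closed[OF l]
      by (auto simp: Dlact Dadd Dcarr PiE_iff M.r_distr intro!: restrict_ext)
    then have "\<pi> (lact D l v) = lact D l (\<pi> v)"
      using q Plr(1)[OF q(3) l M.one_closed] Qlr(1)[OF q(1) l M.one_closed] \<pi>_eq by metis
    then have "\<phi> (g (lact D l v)) = \<phi> (La (\<iota> l) (g v))"
      using g[OF v] g[OF c] l by (simp add: \<phi>l)
    then show ?thesis by (rule inj) (use g[OF c] g[OF v] La[OF \<iota>_closed[OF l]] in auto)
  qed
  have gr: "g (ract D v m) = Ra m (g v)" if v: "v \<in> carrier D" and m: "m \<in> carrier M" for v m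
  proof -
    obtain q where q: "q \<in> Q" "v = \<pi> v \<oplus>\<^bsub>D\<^esub> q" "\<pi> v \<in> P" using \<pi>[OF v] by blast
    have c: "ract D v m \<in> carrier D" using v m by (auto simp: Dract Dcarr PiE_iff)
    have "ract D (\<pi> v \<oplus>\<^bsub>D\<^esub> q) m = ract D (\<pi> v) m \<oplus>\<^bsub>D\<^esub> ract D q m"
      using Pc[OF q(3)] Qc[OF q(1)] m
      by (auto simp: Dract Dadd Dcarr PiE_iff M.l_distr intro!: restrict_ext)
    then have "\<pi> (ract D v m) = ract D (\<pi> v) m"
      using q Plr(2)[OF q(3) _ m] Qlr(2)[OF q(1) _ m] \<pi>_eq N.one_closed by metis
    then have "\<phi> (g (ract D v m)) = \<phi> (Ra m (g v))"
      using g[OF v] g[OF c] m by (simp add: \<phi>r)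
    then show ?thesis by (rule inj) (use g[OF c] g[OF v] Ra[OF m] in auto)
  qed
  define e where "e i = (\<lambda>j\<in>{..<n}. if j = i then \<one>\<^bsub>M\<^esub> else \<zero>\<^bsub>M\<^esub>)" for i
  have e: "e i \<in> carrier D" for i by (auto simp: e_def Dcarr)
  define b where "b i = g (e i)" for i
  define \<beta> where "\<beta> i = (\<lambda>m\<in>carrier M. \<phi> (pten m \<one>\<^bsub>M\<^esub>) i)" for i
  have \<phi>pc: "\<phi> (pten m \<one>\<^bsub>M\<^esub>) \<in> carrier D" if "m \<in> carrier M" for m
    using Pc \<phi>c pten_closed[OF that M.one_closed] by blast
  have \<beta>c: "\<beta> i m \<in> carrier M" if "i < n" "m \<in> carrier M" for i m
    using \<phi>pc[OF that(2)] that by (auto simp: \<beta>_def Dcarr)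
  have "left_D2_quasibasis N M \<iota> n b \<beta>"
    unfolding left_D2_quasibasis_def tensor_square_simps
  proof (intro conjI allI impI ballI)
    fix i assume i: "i < n"
    show "b i \<in> carrier MM" using g e by (simp add: b_def)
    show "La (\<iota> l) (b i) = Ra (\<iota> l) (b i)" if l: "l \<in> carrier N" for l
    proof -
      have "lact D l (e i) = ract D (e i) (\<iota> l)"
        using \<iota>_closed[OF l] by (auto simp: Dlact Dract e_def intro!: restrict_ext)
      then show ?thesis using gl[OF e l, of i] gr[OF e \<iota>_closed[OF l], of i] by (simp add: b_def)
    qed
    show "\<beta> i \<in> carrier (bimod_End N M \<iota>)"
      unfolding bimod_End_def bimod_hom_def
    proof (simp, intro conjI ballI)
      show "\<beta> i \<in> carrier M \<rightarrow> carrier M" using \<beta>c i by auto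
      show "\<beta> i \<in> extensional (carrier M)" by (simp add: \<beta>_def)
      show "\<beta> i (u \<oplus>\<^bsub>M\<^esub> v) = \<beta> i u \<oplus>\<^bsub>M\<^esub> \<beta> i v" if "u \<in> carrier M" "v \<in> carrier M" for u v
        using that i by (simp add: \<beta>_def pten_addl \<phi>a pten_closed Dadd)
      show "\<beta> i (\<iota> l \<otimes>\<^bsub>M\<^esub> u) = \<iota> l \<otimes>\<^bsub>M\<^esub> \<beta> i u" if "l \<in> carrier N" "u \<in> carrier M" for l u
        using that i \<iota>_closed[OF that(1)] \<phi>l[OF pten_closed[OF that(2) M.one_closed] that(1)]
        by (simp add: \<beta>_def La Dlact)
      show "\<beta> i (u \<otimes>\<^bsub>M\<^esub> \<iota> l) = \<beta> i u \<otimes>\<^bsub>M\<^esub> \<iota> l" if "u \<in> carrier M" "l \<in> carrier N" for l u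
        using that i \<iota>_closed[OF that(2)] \<phi>r[OF pten_closed[OF that(1) M.one_closed] \<iota>_closed[OF that(2)]]
        by (simp add: \<beta>_def Ra Dract pten_bal)
    qed
  next
    fix m assume m: "m \<in> carrier M"
    have be: "ract D (e i) (\<beta> i m) \<in> carrier D" if "i < n" for i
      using e[of i] \<beta>c[OF that m] by (auto simp: Dract Dcarr PiE_iff)
    have pw: "(\<Oplus>\<^bsub>D\<^esub>i\<in>A. F i) j = (\<Oplus>\<^bsub>M\<^esub>i\<in>A. F i j)" if "finite A" "F \<in> A \<rightarrow> carrier D" "j < n" for A F j
      by (rule finsum_hom[OF D.abelian_group_axioms M.M.abelian_group_axioms that(1,2)])
         (use that(3) in \<open>auto simp: Dcarr Dadd\<close>)
    have sm: "(\<Oplus>\<^bsub>D\<^esub>i\<in>{..<n}. ract D (e i) (\<beta> i m)) = \<phi> (pten m \<one>\<^bsub>M\<^esub>)"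
    proof
      fix j
      show "(\<Oplus>\<^bsub>D\<^esub>i\<in>{..<n}. ract D (e i) (\<beta> i m)) j = \<phi> (pten m \<one>\<^bsub>M\<^esub>) j"
      proof (cases "j < n")
        case True
        have "(\<Oplus>\<^bsub>D\<^esub>i\<in>{..<n}. ract D (e i) (\<beta> i m)) j = (\<Oplus>\<^bsub>M\<^esub>i\<in>{..<n}. ract D (e i) (\<beta> i m) j)"
          by (rule pw) (use be True in auto)
        also have "\<dots> = (\<Oplus>\<^bsub>M\<^esub>i\<in>{..<n}. if j = i then \<beta> i m else \<zero>\<^bsub>M\<^esub>)"
          by (rule M.M.finsum_cong') (use True \<beta>c m in \<open>auto simp: Dract e_def\<close>)
        also have "\<dots> = \<beta> j m"
          by (rule M.M.finsum_singleton) (use True \<beta>c m in auto)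
        finally show ?thesis using m by (simp add: \<beta>_def)
      next
        case False
        have "(\<Oplus>\<^bsub>D\<^esub>i\<in>{..<n}. ract D (e i) (\<beta> i m)) \<in> carrier D"
          by (rule D.finsum_closed) (use be in auto)
        then show ?thesis using \<phi>pc[OF m] False by (simp add: Dcarr PiE_iff extensional_def)
      qed
    qed
    have "(\<Oplus>\<^bsub>MM\<^esub>i\<in>{..<n}. Ra (\<beta> i m) (b i)) = (\<Oplus>\<^bsub>MM\<^esub>i\<in>{..<n}. g (ract D (e i) (\<beta> i m)))"
      by (rule T.finsum_cong') (use g e be \<beta>c m in \<open>auto simp: b_def gr\<close>)
    also have "\<dots> = g (\<Oplus>\<^bsub>D\<^esub>i\<in>{..<n}. ract D (e i) (\<beta> i m))"
      by (rule finsum_hom[symmetric, OF D.abelian_group_axioms T.abelian_group_axioms])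
         (use be g ga in auto)
    also have "\<dots> = pten m \<one>\<^bsub>M\<^esub>"
      unfolding sm by (rule g\<phi>[OF pten_closed[OF m M.one_closed]])
    finally have "(\<Oplus>\<^bsub>MM\<^esub>i\<in>{..<n}. Ra (\<beta> i m) (b i)) = pten m \<one>\<^bsub>M\<^esub>" .
    then show "finsum (tensor_square N M \<iota> id id)
        (\<lambda>i. tensor_lift MM (\<lambda>u v. pten u (v \<otimes>\<^bsub>M\<^esub> id (\<beta> i m))) (b i)) {..<n} = pten m \<one>\<^bsub>M\<^esub>"
      by (simp add: finsum_def finprod_def tensor_square_simps)
  qed
  then show ?thesis by blast
qed

end

theory Submission
  imports Defs
begin

text \<open>In \<open>M\<^sub>1\<close> one has \<open>\<psi> \<alpha> \<cdot> m \<cdot> (u \<otimes> v) = \<alpha> (m u) \<otimes> v\<close>, so that the left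
  hand side is \<open>\<alpha> m\<close> for \<open>a = \<psi> \<alpha>\<close>, and the right hand side is
  \<open>\<Sum>\<^sub>i \<Sum>\<^sub>j \<alpha> (m S(\<beta>\<^sub>i)(x\<^sub>j) b\<^sub>i\<^sup>1) b\<^sub>i\<^sup>2 \<otimes> y\<^sub>j\<close>. It therefore suffices that
  \<open>\<Sum>\<^sub>i S(\<beta>\<^sub>i)(z) b\<^sub>i\<^sup>1 \<otimes> b\<^sub>i\<^sup>2 = 1 \<otimes> z\<close>. By definition
  \<open>S(\<beta>\<^sub>i)(z) = \<Sum>\<^sub>k E(z b\<^sub>k\<^sup>1) b\<^sub>k\<^sup>2 t(\<beta>\<^sub>i \<beta>\<^sub>k)\<close> with \<open>t(\<gamma>) = \<Sum>\<^sub>j \<gamma>(x\<^sub>j) y\<^sub>j\<close>. The element \<open>t(\<gamma>)\<close> centralizes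
  \<open>N\<close>, hence is a scalar by irreducibility and moves to the far right of
  \<open>b\<^sub>i\<^sup>1 \<otimes> b\<^sub>i\<^sup>2\<close>. Then the quasibasis identity, applied to the sum over \<open>i\<close> and to the sum over \<open>k\<close>,
  leaves \<open>\<Sum>\<^sub>j E(z x\<^sub>j) \<otimes> y\<^sub>j = 1 \<otimes> z\<close>. Neither coassociativity nor the antipode axiom enters.\<close>

section \<open>Additive maps on tensor products\<close>

text \<open>The same additive group sits inside several records (\<open>tensor_add\<close>,
  \<open>tensor\<close>, \<open>tensor_square\<close>, the basic construction). A finite sum reads
  only carrier, addition and zero, so it can be moved from one record to another.\<close>

lemma finsum_add_cong:
  assumes "carrier G = carrier H" "add G = add H" "\<zero>\<^bsub>G\<^esub> = \<zero>\<^bsub>H\<^esub>"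
  shows "finsum G = finsum H"
  by (intro ext) (simp add: finsum_def finprod_def assms)

lemma tensor_lift_add_cong:
  assumes "carrier G = carrier H" "add G = add H" "\<zero>\<^bsub>G\<^esub> = \<zero>\<^bsub>H\<^esub>"
  shows "tensor_lift G = tensor_lift H"
proof -
  \<comment> \<open>A negative multiple involves an inverse, but \<open>m_inv\<close> selects it
    from carrier, addition and zero alone.\<close>
  have "add_pow G (k::int) = add_pow H k" for k
    by (intro ext) (simp add: add_pow_def int_pow_def2 m_inv_def nat_pow_def assms)
  then show ?thesis
    by (intro ext) (simp add: tensor_lift_def finsum_add_cong[OF assms])
qed

lemma abelian_group_add_cong:
  assumes "abelian_group H" "carrier G = carrier H" "add G = add H" "\<zero>\<^bsub>G\<^esub> = \<zero>\<^bsub>H\<^esub>"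
  shows "abelian_group G"
proof -
  interpret H: abelian_group H by fact
  show ?thesis
    by (rule abelian_groupI) (auto simp: assms H.a_ac intro: H.add.l_inv_ex)
qed

lemma (in abelian_monoid) finsum_swap:
  assumes "finite A" "finite B" "\<And>i j. i \<in> A \<Longrightarrow> j \<in> B \<Longrightarrow> f i j \<in> carrier G"
  shows "(\<Oplus>i\<in>A. \<Oplus>j\<in>B. f i j) = (\<Oplus>j\<in>B. \<Oplus>i\<in>A. f i j)"
  using assms(1,3)
proof (induction A rule: finite_induct)
  case empty
  then show ?case by (simp add: finsum_zero)
next
  case (insert a A)
  have "(\<Oplus>i\<in>insert a A. \<Oplus>j\<in>B. f i j) = (\<Oplus>j\<in>B. f a j) \<oplus> (\<Oplus>j\<in>B. \<Oplus>i\<in>A. f i j)"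
    using insert by (subst finsum_insert) auto
  also have "\<dots> = (\<Oplus>j\<in>B. f a j \<oplus> (\<Oplus>i\<in>A. f i j))"
    using insert by (subst finsum_addf) auto
  also have "\<dots> = (\<Oplus>j\<in>B. \<Oplus>i\<in>insert a A. f i j)"
    by (rule finsum_cong') (use insert in auto)
  finally show ?case .
qed

section \<open>Existence and uniqueness of additive maps out of a tensor product\<close>

context tensor_data begin

text \<open>The conditions under which \<open>tensor_lift\<close> descends to classes, bundled so
  that each map is checked once and all facts about its lift follow together.\<close>

definition balanced :: "('g, 'gz) ring_scheme \<Rightarrow> ('x \<Rightarrow> 'y \<Rightarrow> 'g) \<Rightarrow> bool" where
  "balanced G f \<longleftrightarrow> abelian_group G \<and>
     (\<forall>u\<in>carrier X. \<forall>v\<in>carrier Y. f u v \<in> carrier G) \<and>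
     (\<forall>u\<in>carrier X. \<forall>u'\<in>carrier X. \<forall>v\<in>carrier Y. f (u \<oplus>\<^bsub>X\<^esub> u') v = f u v \<oplus>\<^bsub>G\<^esub> f u' v) \<and>
     (\<forall>u\<in>carrier X. \<forall>v\<in>carrier Y. \<forall>v'\<in>carrier Y. f u (v \<oplus>\<^bsub>Y\<^esub> v') = f u v \<oplus>\<^bsub>G\<^esub> f u v') \<and>
     (\<forall>u\<in>carrier X. \<forall>r\<in>carrier R. \<forall>v\<in>carrier Y. f (ract X u r) v = f u (lact Y r v))"

lemma lift_balanced:
  assumes "balanced G f"
  shows "u \<in> carrier X \<Longrightarrow> v \<in> carrier Y \<Longrightarrow> tensor_lift G f (tensor_elem R X Y u v) = f u v"
    and "t \<in> carrier TT \<Longrightarrow> tensor_lift G f t \<in> carrier G"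
    and "t \<in> carrier TT \<Longrightarrow> t' \<in> carrier TT \<Longrightarrow>
      tensor_lift G f (t \<oplus>\<^bsub>TT\<^esub> t') = tensor_lift G f t \<oplus>\<^bsub>G\<^esub> tensor_lift G f t'"
  using assms unfolding balanced_def
  by (auto intro!: lift_elem lift_closed lift_add)

text \<open>Uniqueness in the universal property: composed with the quotient map, both maps become
  homomorphisms out of a free abelian group, and such homomorphisms agree once they agree on the
  generators.\<close>

lemma additive_eqI:
  assumes G: "abelian_group G"
    and h: "\<And>t. t \<in> carrier TT \<Longrightarrow> h t \<in> carrier G"
      "\<And>t t'. t \<in> carrier TT \<Longrightarrow> t' \<in> carrier TT \<Longrightarrow> h (t \<oplus>\<^bsub>TT\<^esub> t') = h t \<oplus>\<^bsub>G\<^esub> h t'"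
    and g: "\<And>t. t \<in> carrier TT \<Longrightarrow> g t \<in> carrier G"
      "\<And>t t'. t \<in> carrier TT \<Longrightarrow> t' \<in> carrier TT \<Longrightarrow> g (t \<oplus>\<^bsub>TT\<^esub> t') = g t \<oplus>\<^bsub>G\<^esub> g t'"
    and eq: "\<And>u v. u \<in> carrier X \<Longrightarrow> v \<in> carrier Y \<Longrightarrow>
      h (tensor_elem R X Y u v) = g (tensor_elem R X Y u v)"
    and t: "t \<in> carrier TT"
  shows "h t = g t"
proof -
  interpret G: abelian_group G by (rule G)
  interpret TT: abelian_group TT by (rule TT)
  have hom: "group_hom FF (add_monoid G) (\<lambda>c. k (HH #>\<^bsub>FF\<^esub> c))"
    if "\<And>t. t \<in> carrier TT \<Longrightarrow> k t \<in> carrier G"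
      "\<And>t t'. t \<in> carrier TT \<Longrightarrow> t' \<in> carrier TT \<Longrightarrow> k (t \<oplus>\<^bsub>TT\<^esub> t') = k t \<oplus>\<^bsub>G\<^esub> k t'" for k
    unfolding group_hom_def group_hom_axioms_def hom_def
  proof (intro conjI CollectI funcsetI ballI)
    fix c d assume c: "c \<in> carrier FF" and d: "d \<in> carrier FF"
    then have "HH #>\<^bsub>FF\<^esub> c \<in> carrier TT" "HH #>\<^bsub>FF\<^esub> d \<in> carrier TT" by (simp_all add: carr)
    then show "k (HH #>\<^bsub>FF\<^esub> (c \<otimes>\<^bsub>FF\<^esub> d)) = k (HH #>\<^bsub>FF\<^esub> c) \<otimes>\<^bsub>add_monoid G\<^esub> k (HH #>\<^bsub>FF\<^esub> d)"
      by (simp add: that(2) flip: add_cosets[OF c d])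
  qed (auto simp: that carr FF.is_group G.add.is_group)
  interpret h: group_hom FF "add_monoid G" "\<lambda>c. h (HH #>\<^bsub>FF\<^esub> c)" by (rule hom[OF h])
  interpret g: group_hom FF "add_monoid G" "\<lambda>c. g (HH #>\<^bsub>FF\<^esub> c)" by (rule hom[OF g])
  obtain c where c: "c \<in> carrier FF" "t = HH #>\<^bsub>FF\<^esub> c" using t unfolding carr by blast
  have "Poly_Mapping.keys c \<subseteq> carrier X \<times> carrier Y" using c by simp
  \<comment> \<open>Membership in the free group is carried through the induction, because the
    composites are known to be additive only on its carrier.\<close>
  then have "c \<in> carrier FF \<and> h (HH #>\<^bsub>FF\<^esub> c) = g (HH #>\<^bsub>FF\<^esub> c)"
  proof (induction c rule: frag_induction)
    case zero
    show ?case using h.hom_one g.hom_one FF.one_closed by simp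
  next
    case (one p)
    then show ?case using eq[of "fst p" "snd p"] by (auto simp: tensor_elem_def)
  next
    case (diff a b)
    \<comment> \<open>A difference is rewritten as a product with an inverse, the operations that
      group homomorphisms respect.\<close>
    have d: "a - b = a \<otimes>\<^bsub>FF\<^esub> inv\<^bsub>FF\<^esub> b" using diff by simp
    have i: "inv\<^bsub>FF\<^esub> b \<in> carrier FF" using diff by (intro FF.inv_closed) simp
    show ?case unfolding d using diff i
      by (metis FF.m_closed g.hom_inv g.hom_mult h.hom_inv h.hom_mult)
  qed
  then show ?thesis using c by simp
qed

text \<open>Coproducts are given as finite sums of pure tensors; this evaluates a lift on them term
  by term.\<close>

lemma lift_sum_elems:
  assumes "balanced G f" "finite I" "\<And>i. i \<in> I \<Longrightarrow> u i \<in> carrier X" "\<And>i. i \<in> I \<Longrightarrow> v i \<in> carrier Y"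
  shows "tensor_lift G f (\<Oplus>\<^bsub>TT\<^esub>i\<in>I. tensor_elem R X Y (u i) (v i)) = (\<Oplus>\<^bsub>G\<^esub>i\<in>I. f (u i) (v i))"
proof -
  have G: "abelian_group G" using assms(1) by (simp add: balanced_def)
  interpret G: abelian_group G by (rule G)
  have "tensor_lift G f (\<Oplus>\<^bsub>TT\<^esub>i\<in>I. tensor_elem R X Y (u i) (v i)) =
      (\<Oplus>\<^bsub>G\<^esub>i\<in>I. tensor_lift G f (tensor_elem R X Y (u i) (v i)))"
    by (rule finsum_hom[OF TT G assms(2)]) (use assms in \<open>auto simp: lift_balanced elem_closed\<close>)
  also have "\<dots> = (\<Oplus>\<^bsub>G\<^esub>i\<in>I. f (u i) (v i))"
    by (rule G.finsum_cong') (use assms in \<open>auto simp: lift_balanced balanced_def\<close>)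
  finally show ?thesis .
qed

end

lemma sym_bimod_simps [simp]:
  "carrier (sym_bimod X) = carrier X" "add (sym_bimod X) = add X" "\<zero>\<^bsub>sym_bimod X\<^esub> = \<zero>\<^bsub>X\<^esub>"
  "lact (sym_bimod X) k u = k \<odot>\<^bsub>X\<^esub> u" "ract (sym_bimod X) u k = k \<odot>\<^bsub>X\<^esub> u"
  by (simp_all add: sym_bimod_def)

lemma tensor_simps:
  "carrier (tensor R X Y) = carrier (tensor_add R X Y)" "add (tensor R X Y) = add (tensor_add R X Y)"
  "\<zero>\<^bsub>tensor R X Y\<^esub> = \<zero>\<^bsub>tensor_add R X Y\<^esub>"
  by (simp_all add: tensor_def)

section \<open>The tensor square of \<open>M\<close> over \<open>N\<close> with its two outer
  actions\<close>

context algebra_extension begin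


lemma tensor_square_lift: "tensor_lift (tensor_square N M \<iota> f g) = tensor_lift MM"
  by (rule tensor_lift_add_cong) (simp_all only: tensor_square_simps)

lemma tensor_square_finsum: "finsum (tensor_square N M \<iota> f g) = finsum MM"
  by (rule finsum_add_cong) (simp_all only: tensor_square_simps)

text \<open>\<open>TS\<close>, \<open>lmul\<close> and \<open>rmul\<close> are opaque copies: the simplifier rewrites inside the terms that
  \<open>MM\<close>, \<open>La\<close> and \<open>Ra\<close> abbreviate.\<close>

definition TS where "TS = MM"
definition lmul where "lmul l = La l"
definition rmul where "rmul l = Ra l"

lemma abelian_group_TS: "abelian_group TS"
  unfolding TS_def by (rule T.abelian_group_axioms)

sublocale TS: abelian_group TS by (rule abelian_group_TS)

lemma ptensor_simps [simp]:
  "\<lbrakk>u \<in> carrier M; v \<in> carrier M\<rbrakk> \<Longrightarrow> pten u v \<in> carrier TS"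
  "\<lbrakk>u \<in> carrier M; u' \<in> carrier M; v \<in> carrier M\<rbrakk> \<Longrightarrow> pten (u \<oplus>\<^bsub>M\<^esub> u') v = pten u v \<oplus>\<^bsub>TS\<^esub> pten u' v"
  "\<lbrakk>u \<in> carrier M; v \<in> carrier M; v' \<in> carrier M\<rbrakk> \<Longrightarrow> pten u (v \<oplus>\<^bsub>M\<^esub> v') = pten u v \<oplus>\<^bsub>TS\<^esub> pten u v'"
  unfolding TS_def by (rule pten_closed pten_addl pten_addr; assumption)+

lemma lmul [simp]:
  assumes "l \<in> carrier M"
  shows "t \<in> carrier TS \<Longrightarrow> lmul l t \<in> carrier TS"
    "\<lbrakk>t \<in> carrier TS; t' \<in> carrier TS\<rbrakk> \<Longrightarrow> lmul l (t \<oplus>\<^bsub>TS\<^esub> t') = lmul l t \<oplus>\<^bsub>TS\<^esub> lmul l t'"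
    "\<lbrakk>u \<in> carrier M; v \<in> carrier M\<rbrakk> \<Longrightarrow> lmul l (pten u v) = pten (l \<otimes>\<^bsub>M\<^esub> u) v"
  unfolding TS_def lmul_def by (rule La[OF assms]; assumption)+

lemma rmul [simp]:
  assumes "l \<in> carrier M"
  shows "t \<in> carrier TS \<Longrightarrow> rmul l t \<in> carrier TS"
    "\<lbrakk>t \<in> carrier TS; t' \<in> carrier TS\<rbrakk> \<Longrightarrow> rmul l (t \<oplus>\<^bsub>TS\<^esub> t') = rmul l t \<oplus>\<^bsub>TS\<^esub> rmul l t'"
    "\<lbrakk>u \<in> carrier M; v \<in> carrier M\<rbrakk> \<Longrightarrow> rmul l (pten u v) = pten u (v \<otimes>\<^bsub>M\<^esub> l)"
  unfolding TS_def rmul_def by (rule Ra[OF assms]; assumption)+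

lemma balanced_iff:
  "td.balanced G f \<longleftrightarrow> abelian_group G \<and>
     (\<forall>u\<in>carrier M. \<forall>v\<in>carrier M. f u v \<in> carrier G) \<and>
     (\<forall>u\<in>carrier M. \<forall>u'\<in>carrier M. \<forall>v\<in>carrier M. f (u \<oplus>\<^bsub>M\<^esub> u') v = f u v \<oplus>\<^bsub>G\<^esub> f u' v) \<and>
     (\<forall>u\<in>carrier M. \<forall>v\<in>carrier M. \<forall>v'\<in>carrier M. f u (v \<oplus>\<^bsub>M\<^esub> v') = f u v \<oplus>\<^bsub>G\<^esub> f u v') \<and>
     (\<forall>u\<in>carrier M. \<forall>n\<in>carrier N. \<forall>v\<in>carrier M. f (u \<otimes>\<^bsub>M\<^esub> \<iota> n) v = f u (\<iota> n \<otimes>\<^bsub>M\<^esub> v))"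
  by (simp add: td.balanced_def)

lemma lift_ptensor:
  assumes "td.balanced G f"
  shows "\<lbrakk>u \<in> carrier M; v \<in> carrier M\<rbrakk> \<Longrightarrow> tensor_lift G f (pten u v) = f u v"
    and "t \<in> carrier TS \<Longrightarrow> tensor_lift G f t \<in> carrier G"
    and "\<lbrakk>t \<in> carrier TS; t' \<in> carrier TS\<rbrakk> \<Longrightarrow>
      tensor_lift G f (t \<oplus>\<^bsub>TS\<^esub> t') = tensor_lift G f t \<oplus>\<^bsub>G\<^esub> tensor_lift G f t'"
proof -
  note b = assms
  show "\<lbrakk>u \<in> carrier M; v \<in> carrier M\<rbrakk> \<Longrightarrow> tensor_lift G f (pten u v) = f u v"
    using td.lift_balanced(1)[OF b, of u v] by (simp add: ptensor_def)
  show "t \<in> carrier TS \<Longrightarrow> tensor_lift G f t \<in> carrier G"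
    unfolding TS_def by (rule td.lift_balanced(2)[OF b])
  show "\<lbrakk>t \<in> carrier TS; t' \<in> carrier TS\<rbrakk> \<Longrightarrow>
      tensor_lift G f (t \<oplus>\<^bsub>TS\<^esub> t') = tensor_lift G f t \<oplus>\<^bsub>G\<^esub> tensor_lift G f t'"
    unfolding TS_def by (rule td.lift_balanced(3)[OF b])
qed

text \<open>Working form of \<open>td.additive_eqI\<close>: an identity whose sides are additive in
  an element of the tensor square is verified on \<open>pten u v\<close> only.\<close>

lemma TS_eqI:
  assumes "abelian_group G" and "t \<in> carrier TS"
    and "\<And>t. t \<in> carrier TS \<Longrightarrow> h t \<in> carrier G"
      "\<And>t t'. \<lbrakk>t \<in> carrier TS; t' \<in> carrier TS\<rbrakk> \<Longrightarrow> h (t \<oplus>\<^bsub>TS\<^esub> t') = h t \<oplus>\<^bsub>G\<^esub> h t'"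
    and "\<And>t. t \<in> carrier TS \<Longrightarrow> g t \<in> carrier G"
      "\<And>t t'. \<lbrakk>t \<in> carrier TS; t' \<in> carrier TS\<rbrakk> \<Longrightarrow> g (t \<oplus>\<^bsub>TS\<^esub> t') = g t \<oplus>\<^bsub>G\<^esub> g t'"
    and eq: "\<And>u v. \<lbrakk>u \<in> carrier M; v \<in> carrier M\<rbrakk> \<Longrightarrow> h (pten u v) = g (pten u v)"
  shows "h t = g t"
  by (rule td.additive_eqI[OF assms(1) assms(3-6)[unfolded TS_def] _ assms(2)[unfolded TS_def]])
     (use eq in \<open>auto simp: ptensor_def\<close>)

lemma lmul_add:
  assumes "u \<in> carrier M" "v \<in> carrier M" "t \<in> carrier TS"
  shows "lmul (u \<oplus>\<^bsub>M\<^esub> v) t = lmul u t \<oplus>\<^bsub>TS\<^esub> lmul v t"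
  by (rule TS_eqI[OF abelian_group_TS assms(3)])
     (use assms in \<open>simp_all add: M.l_distr TS.a_ac\<close>)

lemma rmul_add:
  assumes "u \<in> carrier M" "v \<in> carrier M" "t \<in> carrier TS"
  shows "rmul (u \<oplus>\<^bsub>M\<^esub> v) t = rmul u t \<oplus>\<^bsub>TS\<^esub> rmul v t"
  by (rule TS_eqI[OF abelian_group_TS assms(3)])
     (use assms in \<open>simp_all add: M.r_distr TS.a_ac\<close>)

lemma lmul_sum:
  assumes "finite A" "c \<in> A \<rightarrow> carrier M" "t \<in> carrier TS"
  shows "lmul (\<Oplus>\<^bsub>M\<^esub>i\<in>A. c i) t = (\<Oplus>\<^bsub>TS\<^esub>i\<in>A. lmul (c i) t)"
  by (rule finsum_hom[OF M.M.abelian_group_axioms abelian_group_TS assms(1,2), where h = "\<lambda>l. lmul l t"])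
     (use assms(3) in \<open>simp_all add: lmul_add\<close>)

lemma rmul_sum:
  assumes "finite A" "c \<in> A \<rightarrow> carrier M" "t \<in> carrier TS"
  shows "rmul (\<Oplus>\<^bsub>M\<^esub>i\<in>A. c i) t = (\<Oplus>\<^bsub>TS\<^esub>i\<in>A. rmul (c i) t)"
  by (rule finsum_hom[OF M.M.abelian_group_axioms abelian_group_TS assms(1,2), where h = "\<lambda>l. rmul l t"])
     (use assms(3) in \<open>simp_all add: rmul_add\<close>)

lemma lmul_finsum:
  assumes "finite A" "c \<in> A \<rightarrow> carrier TS" "l \<in> carrier M"
  shows "lmul l (\<Oplus>\<^bsub>TS\<^esub>i\<in>A. c i) = (\<Oplus>\<^bsub>TS\<^esub>i\<in>A. lmul l (c i))"
  by (rule finsum_hom[OF abelian_group_TS abelian_group_TS assms(1,2)]) (use assms(3) in simp_all)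

lemma rmul_finsum:
  assumes "finite A" "c \<in> A \<rightarrow> carrier TS" "l \<in> carrier M"
  shows "rmul l (\<Oplus>\<^bsub>TS\<^esub>i\<in>A. c i) = (\<Oplus>\<^bsub>TS\<^esub>i\<in>A. rmul l (c i))"
  by (rule finsum_hom[OF abelian_group_TS abelian_group_TS assms(1,2)]) (use assms(3) in simp_all)

lemma rmul_rmul: "\<lbrakk>l \<in> carrier M; l' \<in> carrier M; t \<in> carrier TS\<rbrakk> \<Longrightarrow> rmul l (rmul l' t) = rmul (l' \<otimes>\<^bsub>M\<^esub> l) t"
  by (rule TS_eqI[OF abelian_group_TS, of t "\<lambda>t. rmul l (rmul l' t)" "rmul (l' \<otimes>\<^bsub>M\<^esub> l)"])
     (simp_all add: M.m_assoc)

lemma lmul_lmul: "\<lbrakk>l \<in> carrier M; l' \<in> carrier M; t \<in> carrier TS\<rbrakk> \<Longrightarrow> lmul l (lmul l' t) = lmul (l \<otimes>\<^bsub>M\<^esub> l') t"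
  by (rule TS_eqI[OF abelian_group_TS, of t "\<lambda>t. lmul l (lmul l' t)" "lmul (l \<otimes>\<^bsub>M\<^esub> l')"])
     (simp_all add: M.m_assoc)

lemma lmul_rmul: "\<lbrakk>l \<in> carrier M; l' \<in> carrier M; t \<in> carrier TS\<rbrakk> \<Longrightarrow> lmul l (rmul l' t) = rmul l' (lmul l t)"
  by (rule TS_eqI[OF abelian_group_TS, of t "\<lambda>t. lmul l (rmul l' t)" "\<lambda>t. rmul l' (lmul l t)"])
     simp_all

lemma ptensor_suml:
  assumes "finite A" "c \<in> A \<rightarrow> carrier M" "v \<in> carrier M"
  shows "pten (\<Oplus>\<^bsub>M\<^esub>i\<in>A. c i) v = (\<Oplus>\<^bsub>TS\<^esub>i\<in>A. pten (c i) v)"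
  by (rule finsum_hom[OF M.M.abelian_group_axioms abelian_group_TS assms(1,2), where h = "\<lambda>u. pten u v"])
     (use assms(3) in simp_all)

lemma ptensor_sumr:
  assumes "finite A" "c \<in> A \<rightarrow> carrier M" "u \<in> carrier M"
  shows "pten u (\<Oplus>\<^bsub>M\<^esub>i\<in>A. c i) = (\<Oplus>\<^bsub>TS\<^esub>i\<in>A. pten u (c i))"
  by (rule finsum_hom[OF M.M.abelian_group_axioms abelian_group_TS assms(1,2), where h = "pten u"])
     (use assms(3) in simp_all)

lemma lift_finsum:
  assumes "td.balanced G f" "finite A" "c \<in> A \<rightarrow> carrier TS"
  shows "tensor_lift G f (\<Oplus>\<^bsub>TS\<^esub>i\<in>A. c i) = (\<Oplus>\<^bsub>G\<^esub>i\<in>A. tensor_lift G f (c i))"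
  by (rule finsum_hom[OF abelian_group_TS _ assms(2,3)])
     (use assms(1) in \<open>auto simp: lift_ptensor balanced_iff\<close>)

text \<open>A scalar acts, on either side, as the image of an element of \<open>N\<close>. Hence
  \<open>N\<close>-balancedness moves scalars across the tensor sign, and \<open>N\<close>-linear
  maps are \<open>K\<close>-linear.\<close>

lemma smult_unit:
  assumes "k \<in> carrier K" "u \<in> carrier M"
  shows "k \<odot>\<^bsub>M\<^esub> u = \<iota> (k \<odot>\<^bsub>N\<^esub> \<one>\<^bsub>N\<^esub>) \<otimes>\<^bsub>M\<^esub> u" "k \<odot>\<^bsub>M\<^esub> u = u \<otimes>\<^bsub>M\<^esub> \<iota> (k \<odot>\<^bsub>N\<^esub> \<one>\<^bsub>N\<^esub>)"
  using assms hom_smult[of k "\<one>\<^bsub>N\<^esub>"] ring_hom_one[OF hom]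
  by (simp_all add: M.smult_mult_left M.smult_mult_right)

end

section \<open>The basic construction of a Frobenius extension\<close>

locale frobenius_extension = algebra_extension K N M \<iota>
  for K :: "('k, 'kz) ring_scheme" and N :: "('k, 'n, 'nz) module_scheme"
    and M :: "('k, 'm, 'mz) module_scheme" and \<iota> :: "'n \<Rightarrow> 'm" +
  fixes E :: "'m \<Rightarrow> 'n" and r :: nat and x y :: "nat \<Rightarrow> 'm"
  assumes frobenius: "frobenius_system N M \<iota> E r x y"
begin

text \<open>\<open>E\<close> followed by the structure map is an endomorphism of the
  \<open>N\<close>-bimodule \<open>M\<close>, so its values can be multiplied within
  \<open>M\<close>.\<close>

definition \<iota>E :: "'m \<Rightarrow> 'm" where "\<iota>E u = \<iota> (E u)"

lemma E_closed: "u \<in> carrier M \<Longrightarrow> E u \<in> carrier N"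
  using frobenius by (auto simp: frobenius_system_def bimod_hom_def)

lemma \<iota>E [simp]:
  "u \<in> carrier M \<Longrightarrow> \<iota>E u \<in> carrier M"
  "\<lbrakk>u \<in> carrier M; v \<in> carrier M\<rbrakk> \<Longrightarrow> \<iota>E (u \<oplus>\<^bsub>M\<^esub> v) = \<iota>E u \<oplus>\<^bsub>M\<^esub> \<iota>E v"
  "\<lbrakk>n \<in> carrier N; u \<in> carrier M\<rbrakk> \<Longrightarrow> \<iota>E (\<iota> n \<otimes>\<^bsub>M\<^esub> u) = \<iota> n \<otimes>\<^bsub>M\<^esub> \<iota>E u"
  "\<lbrakk>n \<in> carrier N; u \<in> carrier M\<rbrakk> \<Longrightarrow> \<iota>E (u \<otimes>\<^bsub>M\<^esub> \<iota> n) = \<iota>E u \<otimes>\<^bsub>M\<^esub> \<iota> n"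
  using frobenius ring_hom_add[OF hom] ring_hom_mult[OF hom] \<iota>_closed
  by (auto simp: frobenius_system_def bimod_hom_def \<iota>E_def Pi_iff)

lemma xy_closed [simp]: "j < r \<Longrightarrow> x j \<in> carrier M" "j < r \<Longrightarrow> y j \<in> carrier M"
  using frobenius by (auto simp: frobenius_system_def)

lemma dual_bases:
  assumes "m \<in> carrier M"
  shows "(\<Oplus>\<^bsub>M\<^esub>j\<in>{..<r}. x j \<otimes>\<^bsub>M\<^esub> \<iota>E (y j \<otimes>\<^bsub>M\<^esub> m)) = m"
    "(\<Oplus>\<^bsub>M\<^esub>j\<in>{..<r}. \<iota>E (m \<otimes>\<^bsub>M\<^esub> x j) \<otimes>\<^bsub>M\<^esub> y j) = m"
  using frobenius assms by (auto simp: frobenius_system_def \<iota>E_def)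

lemma ptensor_\<iota>E:
  "\<lbrakk>u \<in> carrier M; w \<in> carrier M; v \<in> carrier M\<rbrakk> \<Longrightarrow> pten (u \<otimes>\<^bsub>M\<^esub> \<iota>E w) v = pten u (\<iota>E w \<otimes>\<^bsub>M\<^esub> v)"
  unfolding \<iota>E_def by (rule pten_bal) (auto simp: E_closed)

abbreviation M1 where "M1 \<equiv> basic_construction N M \<iota> E r x y"
abbreviation inc where "inc \<equiv> basic_incl N M \<iota> r x y"

section \<open>The multiplication of the basic construction\<close>

definition mul1 where
  "mul1 s t = tensor_lift TS (\<lambda>m m'. tensor_lift TS (\<lambda>m'' m'''.
     pten (m \<otimes>\<^bsub>M\<^esub> \<iota>E (m' \<otimes>\<^bsub>M\<^esub> m'')) m''') t) s"

lemma M1_simps: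
  "carrier M1 = carrier TS" "add M1 = add TS" "\<zero>\<^bsub>M1\<^esub> = \<zero>\<^bsub>TS\<^esub>"
  "s \<otimes>\<^bsub>M1\<^esub> t = mul1 s t"
  "k \<odot>\<^bsub>M1\<^esub> t = tensor_lift TS (\<lambda>u v. pten (k \<odot>\<^bsub>M\<^esub> u) v) t"
  by (simp_all only: basic_construction_def Let_def module.simps ring.simps monoid.simps
      partial_object.simps tensor_square_simps tensor_square_lift TS_def mul1_def \<iota>E_def)

lemma finsum_M1: "finsum M1 = finsum TS"
  by (rule finsum_add_cong) (simp_all only: M1_simps)

lemma tensor_lift_M1: "tensor_lift M1 = tensor_lift TS"
  by (rule tensor_lift_add_cong) (simp_all only: M1_simps)

lemma inc_eq: "inc m = (\<Oplus>\<^bsub>TS\<^esub>j\<in>{..<r}. pten (m \<otimes>\<^bsub>M\<^esub> x j) (y j))"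
  by (simp only: basic_incl_def tensor_square_finsum TS_def)

lemma inc_closed [simp]: "m \<in> carrier M \<Longrightarrow> inc m \<in> carrier TS"
  unfolding inc_eq by (rule TS.finsum_closed) auto

lemma balanced_mul1_inner:
  "\<lbrakk>m \<in> carrier M; m' \<in> carrier M\<rbrakk> \<Longrightarrow> td.balanced TS (\<lambda>u v. pten (m \<otimes>\<^bsub>M\<^esub> \<iota>E (m' \<otimes>\<^bsub>M\<^esub> u)) v)"
  unfolding balanced_iff
  by (simp add: abelian_group_TS M.r_distr \<iota>_closed pten_bal flip: M.m_assoc)

text \<open>The function of \<open>m\<close> and \<open>m'\<close> is itself a lift evaluated at
  \<open>t\<close>, so each condition is an equality of additive maps in \<open>t\<close> and is
  checked on pure tensors. Balancedness comes from left \<open>N\<close>-linearity of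
  \<open>E\<close>.\<close>

lemma balanced_mul1_outer:
  assumes t: "t \<in> carrier TS"
  shows "td.balanced TS (\<lambda>m m'. tensor_lift TS (\<lambda>u v. pten (m \<otimes>\<^bsub>M\<^esub> \<iota>E (m' \<otimes>\<^bsub>M\<^esub> u)) v) t)"
  unfolding balanced_iff
proof (intro conjI ballI)
  fix m m' v assume c: "m \<in> carrier M" "m' \<in> carrier M" "v \<in> carrier M"
  note b = lift_ptensor[OF balanced_mul1_inner]
  show "tensor_lift TS (\<lambda>u v. pten (m \<otimes>\<^bsub>M\<^esub> \<iota>E (m' \<otimes>\<^bsub>M\<^esub> u)) v) t \<in> carrier TS"
    by (rule b(2)) (use c t in auto)
  show "tensor_lift TS (\<lambda>u v'. pten ((m \<oplus>\<^bsub>M\<^esub> m') \<otimes>\<^bsub>M\<^esub> \<iota>E (v \<otimes>\<^bsub>M\<^esub> u)) v') t =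
    tensor_lift TS (\<lambda>u v'. pten (m \<otimes>\<^bsub>M\<^esub> \<iota>E (v \<otimes>\<^bsub>M\<^esub> u)) v') t \<oplus>\<^bsub>TS\<^esub>
    tensor_lift TS (\<lambda>u v'. pten (m' \<otimes>\<^bsub>M\<^esub> \<iota>E (v \<otimes>\<^bsub>M\<^esub> u)) v') t"
    by (rule TS_eqI[OF abelian_group_TS t])
       (use c in \<open>simp_all add: b TS.a_ac M.l_distr\<close>)
  show "tensor_lift TS (\<lambda>u v'. pten (m \<otimes>\<^bsub>M\<^esub> \<iota>E ((m' \<oplus>\<^bsub>M\<^esub> v) \<otimes>\<^bsub>M\<^esub> u)) v') t =
    tensor_lift TS (\<lambda>u v'. pten (m \<otimes>\<^bsub>M\<^esub> \<iota>E (m' \<otimes>\<^bsub>M\<^esub> u)) v') t \<oplus>\<^bsub>TS\<^esub>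
    tensor_lift TS (\<lambda>u v'. pten (m \<otimes>\<^bsub>M\<^esub> \<iota>E (v \<otimes>\<^bsub>M\<^esub> u)) v') t"
    by (rule TS_eqI[OF abelian_group_TS t])
       (use c in \<open>simp_all add: b TS.a_ac M.l_distr M.r_distr\<close>)
next
  fix m n m' assume c: "m \<in> carrier M" "n \<in> carrier N" "m' \<in> carrier M"
  note b = lift_ptensor[OF balanced_mul1_inner]
  show "tensor_lift TS (\<lambda>u v. pten (m \<otimes>\<^bsub>M\<^esub> \<iota> n \<otimes>\<^bsub>M\<^esub> \<iota>E (m' \<otimes>\<^bsub>M\<^esub> u)) v) t =
    tensor_lift TS (\<lambda>u v. pten (m \<otimes>\<^bsub>M\<^esub> \<iota>E (\<iota> n \<otimes>\<^bsub>M\<^esub> m' \<otimes>\<^bsub>M\<^esub> u)) v) t"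
    by (rule TS_eqI[OF abelian_group_TS t])
       (use c in \<open>simp_all add: b \<iota>_closed M.m_assoc\<close>)
qed (rule abelian_group_TS)

lemma mul1 [simp]:
  "\<lbrakk>s \<in> carrier TS; t \<in> carrier TS\<rbrakk> \<Longrightarrow> mul1 s t \<in> carrier TS"
  "\<lbrakk>s \<in> carrier TS; s' \<in> carrier TS; t \<in> carrier TS\<rbrakk> \<Longrightarrow>
    mul1 (s \<oplus>\<^bsub>TS\<^esub> s') t = mul1 s t \<oplus>\<^bsub>TS\<^esub> mul1 s' t"
  "\<lbrakk>u \<in> carrier M; v \<in> carrier M; u' \<in> carrier M; v' \<in> carrier M\<rbrakk> \<Longrightarrow>
    mul1 (pten u v) (pten u' v') = pten (u \<otimes>\<^bsub>M\<^esub> \<iota>E (v \<otimes>\<^bsub>M\<^esub> u')) v'"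
  by (simp_all add: mul1_def lift_ptensor[OF balanced_mul1_outer] lift_ptensor[OF balanced_mul1_inner])

text \<open>The right factor sits inside the inner lift, which is exposed only when the left factor
  is a pure tensor; hence the reduction in \<open>s\<close>.\<close>

lemma mul1_addr [simp]:
  assumes "s \<in> carrier TS" "t \<in> carrier TS" "t' \<in> carrier TS"
  shows "mul1 s (t \<oplus>\<^bsub>TS\<^esub> t') = mul1 s t \<oplus>\<^bsub>TS\<^esub> mul1 s t'"
proof (rule TS_eqI[OF abelian_group_TS assms(1)])
  fix u v assume "u \<in> carrier M" "v \<in> carrier M"
  then show "mul1 (pten u v) (t \<oplus>\<^bsub>TS\<^esub> t') = mul1 (pten u v) t \<oplus>\<^bsub>TS\<^esub> mul1 (pten u v) t'"
    using assms by (simp add: mul1_def lift_ptensor[OF balanced_mul1_outer] lift_ptensor[OF balanced_mul1_inner])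
qed (use assms in \<open>simp_all add: TS.a_ac\<close>)

lemma mul1_finsum_left:
  assumes "finite A" "c \<in> A \<rightarrow> carrier TS" "t \<in> carrier TS"
  shows "mul1 (\<Oplus>\<^bsub>TS\<^esub>i\<in>A. c i) t = (\<Oplus>\<^bsub>TS\<^esub>i\<in>A. mul1 (c i) t)"
  by (rule finsum_hom[OF abelian_group_TS abelian_group_TS assms(1,2), where h = "\<lambda>s. mul1 s t"])
     (use assms(3) in simp_all)

lemma mul1_finsum_right:
  assumes "finite A" "c \<in> A \<rightarrow> carrier TS" "s \<in> carrier TS"
  shows "mul1 s (\<Oplus>\<^bsub>TS\<^esub>i\<in>A. c i) = (\<Oplus>\<^bsub>TS\<^esub>i\<in>A. mul1 s (c i))"
  by (rule finsum_hom[OF abelian_group_TS abelian_group_TS assms(1,2)]) (use assms(3) in simp_all)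

text \<open>The values of \<open>E\<close> come from \<open>N\<close> and cross the tensor sign into
  the second factor, where the second dual bases identity reassembles \<open>v\<close> times
  \<open>m\<close>.\<close>

lemma mul1_inc:
  assumes "m \<in> carrier M" "t \<in> carrier TS"
  shows "mul1 t (inc m) = rmul m t"
proof (rule TS_eqI[OF abelian_group_TS assms(2)])
  fix u v assume c: "u \<in> carrier M" "v \<in> carrier M"
  have "mul1 (pten u v) (inc m) = (\<Oplus>\<^bsub>TS\<^esub>j\<in>{..<r}. mul1 (pten u v) (pten (m \<otimes>\<^bsub>M\<^esub> x j) (y j)))"
    unfolding inc_eq by (rule mul1_finsum_right) (use assms c in auto)
  also have "\<dots> = (\<Oplus>\<^bsub>TS\<^esub>j\<in>{..<r}. pten u (\<iota>E ((v \<otimes>\<^bsub>M\<^esub> m) \<otimes>\<^bsub>M\<^esub> x j) \<otimes>\<^bsub>M\<^esub> y j))"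
    by (rule TS.finsum_cong') (use assms c in \<open>auto simp: ptensor_\<iota>E M.m_assoc\<close>)
  also have "\<dots> = pten u (\<Oplus>\<^bsub>M\<^esub>j\<in>{..<r}. \<iota>E ((v \<otimes>\<^bsub>M\<^esub> m) \<otimes>\<^bsub>M\<^esub> x j) \<otimes>\<^bsub>M\<^esub> y j)"
    by (rule ptensor_sumr[symmetric]) (use assms c in auto)
  also have "\<dots> = rmul m (pten u v)"
    using assms c by (simp add: dual_bases)
  finally show "mul1 (pten u v) (inc m) = rmul m (pten u v)" .
qed (use assms in simp_all)

text \<open>Here the values of \<open>E\<close> stay in the first factor, and the first dual bases
  identity sums them up.\<close>

lemma inc_mul1:
  assumes "m \<in> carrier M" "t \<in> carrier TS"
  shows "mul1 (inc m) t = lmul m t"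
proof (rule TS_eqI[OF abelian_group_TS assms(2)])
  fix u v assume c: "u \<in> carrier M" "v \<in> carrier M"
  have "mul1 (inc m) (pten u v) = (\<Oplus>\<^bsub>TS\<^esub>j\<in>{..<r}. mul1 (pten (m \<otimes>\<^bsub>M\<^esub> x j) (y j)) (pten u v))"
    unfolding inc_eq by (rule mul1_finsum_left) (use assms c in auto)
  also have "\<dots> = (\<Oplus>\<^bsub>TS\<^esub>j\<in>{..<r}. pten (m \<otimes>\<^bsub>M\<^esub> (x j \<otimes>\<^bsub>M\<^esub> \<iota>E (y j \<otimes>\<^bsub>M\<^esub> u))) v)"
    by (rule TS.finsum_cong') (use assms c in \<open>auto simp: M.m_assoc\<close>)
  also have "\<dots> = pten (\<Oplus>\<^bsub>M\<^esub>j\<in>{..<r}. m \<otimes>\<^bsub>M\<^esub> (x j \<otimes>\<^bsub>M\<^esub> \<iota>E (y j \<otimes>\<^bsub>M\<^esub> u))) v"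
    by (rule ptensor_suml[symmetric]) (use assms c in auto)
  also have "(\<Oplus>\<^bsub>M\<^esub>j\<in>{..<r}. m \<otimes>\<^bsub>M\<^esub> (x j \<otimes>\<^bsub>M\<^esub> \<iota>E (y j \<otimes>\<^bsub>M\<^esub> u))) = m \<otimes>\<^bsub>M\<^esub> u"
    by (subst M.finsum_rdistr[symmetric]) (use assms c in \<open>auto simp: dual_bases\<close>)
  finally show "mul1 (inc m) (pten u v) = lmul m (pten u v)"
    using assms c by simp
qed (use assms in simp_all)

section \<open>Right \<open>N\<close>-linear maps expanded in the dual bases\<close>

text \<open>Left \<open>N\<close>-linearity is left out so that the translates of a bimodule
  endomorphism, sending \<open>u\<close> to \<open>\<gamma> (m u)\<close>, are covered too.\<close>

definition right_linear :: "('m \<Rightarrow> 'm) \<Rightarrow> bool" where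
  "right_linear \<gamma> \<longleftrightarrow> \<gamma> \<in> carrier M \<rightarrow> carrier M \<and>
     (\<forall>u\<in>carrier M. \<forall>v\<in>carrier M. \<gamma> (u \<oplus>\<^bsub>M\<^esub> v) = \<gamma> u \<oplus>\<^bsub>M\<^esub> \<gamma> v) \<and>
     (\<forall>u\<in>carrier M. \<forall>n\<in>carrier N. \<gamma> (u \<otimes>\<^bsub>M\<^esub> \<iota> n) = \<gamma> u \<otimes>\<^bsub>M\<^esub> \<iota> n)"

lemma right_linearD:
  assumes "right_linear \<gamma>"
  shows "u \<in> carrier M \<Longrightarrow> \<gamma> u \<in> carrier M"
    "\<lbrakk>u \<in> carrier M; v \<in> carrier M\<rbrakk> \<Longrightarrow> \<gamma> (u \<oplus>\<^bsub>M\<^esub> v) = \<gamma> u \<oplus>\<^bsub>M\<^esub> \<gamma> v"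
    "\<lbrakk>u \<in> carrier M; n \<in> carrier N\<rbrakk> \<Longrightarrow> \<gamma> (u \<otimes>\<^bsub>M\<^esub> \<iota> n) = \<gamma> u \<otimes>\<^bsub>M\<^esub> \<iota> n"
    "\<lbrakk>u \<in> carrier M; v \<in> carrier M\<rbrakk> \<Longrightarrow> \<gamma> (u \<otimes>\<^bsub>M\<^esub> \<iota>E v) = \<gamma> u \<otimes>\<^bsub>M\<^esub> \<iota>E v"
  using assms E_closed unfolding right_linear_def \<iota>E_def by auto

text \<open>Apply \<open>\<gamma>\<close> to the first dual bases identity; right linearity lets the
  values of \<open>E\<close> out of \<open>\<gamma>\<close>.\<close>

lemma dual_bases_map:
  assumes g: "right_linear \<gamma>" and m: "m \<in> carrier M"
  shows "(\<Oplus>\<^bsub>M\<^esub>j\<in>{..<r}. \<gamma> (x j) \<otimes>\<^bsub>M\<^esub> \<iota>E (y j \<otimes>\<^bsub>M\<^esub> m)) = \<gamma> m"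
proof -
  have "\<gamma> (\<Oplus>\<^bsub>M\<^esub>j\<in>{..<r}. x j \<otimes>\<^bsub>M\<^esub> \<iota>E (y j \<otimes>\<^bsub>M\<^esub> m)) =
      (\<Oplus>\<^bsub>M\<^esub>j\<in>{..<r}. \<gamma> (x j \<otimes>\<^bsub>M\<^esub> \<iota>E (y j \<otimes>\<^bsub>M\<^esub> m)))"
    by (rule finsum_hom[OF M.M.abelian_group_axioms M.M.abelian_group_axioms])
       (use m right_linearD[OF g] in auto)
  also have "\<dots> = (\<Oplus>\<^bsub>M\<^esub>j\<in>{..<r}. \<gamma> (x j) \<otimes>\<^bsub>M\<^esub> \<iota>E (y j \<otimes>\<^bsub>M\<^esub> m))"
    by (rule M.M.finsum_cong') (use m right_linearD[OF g] in auto)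
  finally show ?thesis using m by (simp add: dual_bases)
qed

text \<open>For \<open>\<gamma>\<close> the identity map this is the Casimir property of the dual
  bases element. The second dual bases identity expands the right factor, the values of
  \<open>E\<close> cross to the left, and after exchanging the sums the first identity recombines
  them inside \<open>\<gamma>\<close>.\<close>

lemma ptensor_shift:
  assumes g: "right_linear \<gamma>" and m: "m \<in> carrier M"
  shows "(\<Oplus>\<^bsub>TS\<^esub>j\<in>{..<r}. pten (\<gamma> (x j)) (y j \<otimes>\<^bsub>M\<^esub> m)) = (\<Oplus>\<^bsub>TS\<^esub>j\<in>{..<r}. pten (\<gamma> (m \<otimes>\<^bsub>M\<^esub> x j)) (y j))"
proof -
  note g' = right_linearD[OF g]
  have "(\<Oplus>\<^bsub>TS\<^esub>j\<in>{..<r}. pten (\<gamma> (x j)) (y j \<otimes>\<^bsub>M\<^esub> m)) =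
      (\<Oplus>\<^bsub>TS\<^esub>j\<in>{..<r}. \<Oplus>\<^bsub>TS\<^esub>l\<in>{..<r}. pten (\<gamma> (x j) \<otimes>\<^bsub>M\<^esub> \<iota>E (y j \<otimes>\<^bsub>M\<^esub> (m \<otimes>\<^bsub>M\<^esub> x l))) (y l))"
  proof (rule TS.finsum_cong'[OF refl], goal_cases)
    case (2 j)
    then have j: "j < r" by simp
    have "pten (\<gamma> (x j)) (y j \<otimes>\<^bsub>M\<^esub> m) =
        pten (\<gamma> (x j)) (\<Oplus>\<^bsub>M\<^esub>l\<in>{..<r}. \<iota>E ((y j \<otimes>\<^bsub>M\<^esub> m) \<otimes>\<^bsub>M\<^esub> x l) \<otimes>\<^bsub>M\<^esub> y l)"
      using j m by (simp add: dual_bases)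
    also have "\<dots> = (\<Oplus>\<^bsub>TS\<^esub>l\<in>{..<r}. pten (\<gamma> (x j)) (\<iota>E ((y j \<otimes>\<^bsub>M\<^esub> m) \<otimes>\<^bsub>M\<^esub> x l) \<otimes>\<^bsub>M\<^esub> y l))"
      by (rule ptensor_sumr) (use j m g' in auto)
    also have "\<dots> = (\<Oplus>\<^bsub>TS\<^esub>l\<in>{..<r}. pten (\<gamma> (x j) \<otimes>\<^bsub>M\<^esub> \<iota>E (y j \<otimes>\<^bsub>M\<^esub> (m \<otimes>\<^bsub>M\<^esub> x l))) (y l))"
      by (rule TS.finsum_cong') (use j m g' in \<open>auto simp: ptensor_\<iota>E M.m_assoc\<close>)
    finally show ?case .
  qed (use m g' in \<open>auto intro!: TS.finsum_closed\<close>)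
  also have "\<dots> = (\<Oplus>\<^bsub>TS\<^esub>l\<in>{..<r}. \<Oplus>\<^bsub>TS\<^esub>j\<in>{..<r}. pten (\<gamma> (x j) \<otimes>\<^bsub>M\<^esub> \<iota>E (y j \<otimes>\<^bsub>M\<^esub> (m \<otimes>\<^bsub>M\<^esub> x l))) (y l))"
    by (rule TS.finsum_swap) (use m g' in auto)
  also have "\<dots> = (\<Oplus>\<^bsub>TS\<^esub>l\<in>{..<r}. pten (\<gamma> (m \<otimes>\<^bsub>M\<^esub> x l)) (y l))"
  proof (rule TS.finsum_cong'[OF refl], goal_cases)
    case (2 l)
    then have l: "l < r" by simp
    have "(\<Oplus>\<^bsub>TS\<^esub>j\<in>{..<r}. pten (\<gamma> (x j) \<otimes>\<^bsub>M\<^esub> \<iota>E (y j \<otimes>\<^bsub>M\<^esub> (m \<otimes>\<^bsub>M\<^esub> x l))) (y l)) =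
        pten (\<Oplus>\<^bsub>M\<^esub>j\<in>{..<r}. \<gamma> (x j) \<otimes>\<^bsub>M\<^esub> \<iota>E (y j \<otimes>\<^bsub>M\<^esub> (m \<otimes>\<^bsub>M\<^esub> x l))) (y l)"
      by (rule ptensor_suml[symmetric]) (use l m g' in auto)
    also have "\<dots> = pten (\<gamma> (m \<otimes>\<^bsub>M\<^esub> x l)) (y l)"
      using l m by (simp add: dual_bases_map[OF g])
    finally show ?case .
  qed (use m g' in auto)
  finally show ?thesis .
qed

section \<open>The map \<open>\<psi>\<close> and its products with elements of
  \<open>M\<close>\<close>

abbreviation \<psi> where "\<psi> \<equiv> psi_A N M \<iota> E r x y"

text \<open>Multiplying \<open>1 \<otimes> 1\<close> by elements of \<open>M\<close> is the outer
  action, so each summand is a pure tensor. The hypothesis asks only for a map of \<open>M\<close>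
  into itself, which makes the formula applicable to antipode values without first proving them
  linear.\<close>

lemma psi_eq:
  assumes "\<gamma> \<in> carrier M \<rightarrow> carrier M"
  shows "\<psi> \<gamma> = (\<Oplus>\<^bsub>TS\<^esub>j\<in>{..<r}. pten (\<gamma> (x j)) (y j))"
  unfolding psi_A_def Let_def finsum_M1 M1_simps jones_idem_def
  by (rule TS.finsum_cong')
     (use assms in \<open>auto simp: mul1_inc inc_mul1 Pi_iff\<close>)

lemma psi_closed [simp]: "\<gamma> \<in> carrier M \<rightarrow> carrier M \<Longrightarrow> \<psi> \<gamma> \<in> carrier TS"
  unfolding psi_eq by (rule TS.finsum_closed) (auto simp: Pi_iff)

text \<open>\<open>ptensor_shift\<close> trades the factor \<open>m\<close> behind
  \<open>y j\<close> for one inside \<open>\<gamma>\<close>.\<close>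

lemma psi_inc:
  assumes g: "right_linear \<gamma>" and m: "m \<in> carrier M"
  shows "mul1 (\<psi> \<gamma>) (inc m) = (\<Oplus>\<^bsub>TS\<^esub>j\<in>{..<r}. pten (\<gamma> (m \<otimes>\<^bsub>M\<^esub> x j)) (y j))"
proof -
  note g' = right_linearD[OF g]
  have "mul1 (\<psi> \<gamma>) (inc m) = rmul m (\<psi> \<gamma>)" using g' m by (simp add: mul1_inc)
  also have "\<dots> = (\<Oplus>\<^bsub>TS\<^esub>j\<in>{..<r}. rmul m (pten (\<gamma> (x j)) (y j)))"
    using g' m by (subst psi_eq) (auto simp: rmul_finsum)
  also have "\<dots> = (\<Oplus>\<^bsub>TS\<^esub>j\<in>{..<r}. pten (\<gamma> (x j)) (y j \<otimes>\<^bsub>M\<^esub> m))"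
    by (rule TS.finsum_cong') (use g' m in auto)
  finally show ?thesis by (simp add: ptensor_shift[OF g m])
qed

text \<open>The product formula behind both sides of the theorem: the sum in \<open>psi_inc\<close>
  acts on \<open>u\<close> as the dual bases expansion of the translate of \<open>\<gamma>\<close>
  by \<open>m\<close>, which is still right linear.\<close>

lemma psi_inc_ptensor:
  assumes g: "right_linear \<gamma>" and m: "m \<in> carrier M" and u: "u \<in> carrier M" and v: "v \<in> carrier M"
  shows "mul1 (mul1 (\<psi> \<gamma>) (inc m)) (pten u v) = pten (\<gamma> (m \<otimes>\<^bsub>M\<^esub> u)) v"
proof -
  note g' = right_linearD[OF g]
  have g2: "right_linear (\<lambda>z. \<gamma> (m \<otimes>\<^bsub>M\<^esub> z))"
    using m g' by (auto simp: right_linear_def M.r_distr \<iota>_closed M.m_assoc[symmetric])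
  have "mul1 (mul1 (\<psi> \<gamma>) (inc m)) (pten u v) = (\<Oplus>\<^bsub>TS\<^esub>j\<in>{..<r}. mul1 (pten (\<gamma> (m \<otimes>\<^bsub>M\<^esub> x j)) (y j)) (pten u v))"
    unfolding psi_inc[OF g m] by (rule mul1_finsum_left) (use m u v g' in auto)
  also have "\<dots> = (\<Oplus>\<^bsub>TS\<^esub>j\<in>{..<r}. pten (\<gamma> (m \<otimes>\<^bsub>M\<^esub> x j) \<otimes>\<^bsub>M\<^esub> \<iota>E (y j \<otimes>\<^bsub>M\<^esub> u)) v)"
    by (rule TS.finsum_cong') (use m u v g' in auto)
  also have "\<dots> = pten (\<Oplus>\<^bsub>M\<^esub>j\<in>{..<r}. \<gamma> (m \<otimes>\<^bsub>M\<^esub> x j) \<otimes>\<^bsub>M\<^esub> \<iota>E (y j \<otimes>\<^bsub>M\<^esub> u)) v"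
    by (rule ptensor_suml[symmetric]) (use m u v g' in auto)
  finally show ?thesis by (simp add: dual_bases_map[OF g2 u])
qed

subsection \<open>The isomorphism of the endomorphisms with the centralizer\<close>

abbreviation \<A> where "\<A> \<equiv> bimod_End N M \<iota>"
abbreviation \<B> where "\<B> \<equiv> hat_A N M \<iota> E r x y"

lemma End_iff:
  "\<gamma> \<in> carrier \<A> \<longleftrightarrow> right_linear \<gamma> \<and> \<gamma> \<in> extensional (carrier M) \<and>
     (\<forall>n\<in>carrier N. \<forall>u\<in>carrier M. \<gamma> (\<iota> n \<otimes>\<^bsub>M\<^esub> u) = \<iota> n \<otimes>\<^bsub>M\<^esub> \<gamma> u)"
  by (auto simp: bimod_End_def bimod_hom_def right_linear_def)

lemma End_simps:
  "\<alpha> \<oplus>\<^bsub>\<A>\<^esub> \<alpha>' = (\<lambda>z\<in>carrier M. \<alpha> z \<oplus>\<^bsub>M\<^esub> \<alpha>' z)" "\<zero>\<^bsub>\<A>\<^esub> = (\<lambda>z\<in>carrier M. \<zero>\<^bsub>M\<^esub>)"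
  "k \<odot>\<^bsub>\<A>\<^esub> \<alpha> = (\<lambda>z\<in>carrier M. k \<odot>\<^bsub>M\<^esub> \<alpha> z)"
  by (simp_all add: bimod_End_def)

lemma EndD:
  assumes "\<gamma> \<in> carrier \<A>"
  shows "right_linear \<gamma>" "u \<in> carrier M \<Longrightarrow> \<gamma> u \<in> carrier M" "\<gamma> \<in> carrier M \<rightarrow> carrier M"
    "\<gamma> \<in> extensional (carrier M)"
    "\<lbrakk>u \<in> carrier M; v \<in> carrier M\<rbrakk> \<Longrightarrow> \<gamma> (u \<oplus>\<^bsub>M\<^esub> v) = \<gamma> u \<oplus>\<^bsub>M\<^esub> \<gamma> v"
    "\<lbrakk>u \<in> carrier M; n \<in> carrier N\<rbrakk> \<Longrightarrow> \<gamma> (u \<otimes>\<^bsub>M\<^esub> \<iota> n) = \<gamma> u \<otimes>\<^bsub>M\<^esub> \<iota> n"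
    "\<lbrakk>u \<in> carrier M; n \<in> carrier N\<rbrakk> \<Longrightarrow> \<gamma> (\<iota> n \<otimes>\<^bsub>M\<^esub> u) = \<iota> n \<otimes>\<^bsub>M\<^esub> \<gamma> u"
  using assms by (auto simp: End_iff right_linear_def)

lemma End_smult: "\<lbrakk>\<gamma> \<in> carrier \<A>; k \<in> carrier K; u \<in> carrier M\<rbrakk> \<Longrightarrow> \<gamma> (k \<odot>\<^bsub>M\<^esub> u) = k \<odot>\<^bsub>M\<^esub> \<gamma> u"
  by (simp add: smult_unit(1) EndD)

lemma smult_closed_End: "\<lbrakk>k \<in> carrier K; \<alpha> \<in> carrier \<A>\<rbrakk> \<Longrightarrow> k \<odot>\<^bsub>\<A>\<^esub> \<alpha> \<in> carrier \<A>"
  by (auto simp: End_iff End_simps right_linear_def \<iota>_closed Pi_iff M.smult_r_distr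
      M.smult_mult_left M.smult_mult_right)

lemma add_closed_End: "\<lbrakk>\<alpha> \<in> carrier \<A>; \<alpha>' \<in> carrier \<A>\<rbrakk> \<Longrightarrow> \<alpha> \<oplus>\<^bsub>\<A>\<^esub> \<alpha>' \<in> carrier \<A>"
  by (auto simp: End_iff End_simps right_linear_def \<iota>_closed Pi_iff M.M.a_ac M.l_distr M.r_distr)

lemma abelian_group_End: "abelian_group \<A>"
proof (rule abelian_groupI)
  fix \<alpha> assume a: "\<alpha> \<in> carrier \<A>"
  let ?m = "\<lambda>z\<in>carrier M. \<ominus>\<^bsub>M\<^esub> \<alpha> z"
  have "?m \<in> carrier \<A>"
    using a by (auto simp: End_iff right_linear_def \<iota>_closed Pi_iff M.M.minus_add M.r_minus M.l_minus)
  moreover have "?m \<oplus>\<^bsub>\<A>\<^esub> \<alpha> = \<zero>\<^bsub>\<A>\<^esub>"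
    using a by (auto simp: End_simps EndD M.M.l_neg intro!: restrict_ext)
  ultimately show "\<exists>\<alpha>'\<in>carrier \<A>. \<alpha>' \<oplus>\<^bsub>\<A>\<^esub> \<alpha> = \<zero>\<^bsub>\<A>\<^esub>" by blast
  show "\<zero>\<^bsub>\<A>\<^esub> \<oplus>\<^bsub>\<A>\<^esub> \<alpha> = \<alpha>"
    using EndD[OF a] by (auto simp: End_simps extensional_def fun_eq_iff)
next
  show "\<zero>\<^bsub>\<A>\<^esub> \<in> carrier \<A>"
    by (auto simp: End_iff End_simps right_linear_def \<iota>_closed)
qed (auto simp: add_closed_End, auto simp: End_simps EndD M.M.a_ac intro!: restrict_ext)

lemma hat_A_simps:
  "add \<B> = add TS" "\<zero>\<^bsub>\<B>\<^esub> = \<zero>\<^bsub>TS\<^esub>" "k \<odot>\<^bsub>\<B>\<^esub> t = tensor_lift TS (\<lambda>u v. pten (k \<odot>\<^bsub>M\<^esub> u) v) t"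
  by (simp_all add: hat_A_def Let_def M1_simps)

text \<open>Multiplication by the image of \<open>N\<close> is the outer action of \<open>N\<close>,
  so the centralizer consists of the \<open>N\<close>-central elements of the tensor square.\<close>

lemma hat_A_iff: "a \<in> carrier \<B> \<longleftrightarrow> a \<in> carrier TS \<and> (\<forall>n\<in>carrier N. rmul (\<iota> n) a = lmul (\<iota> n) a)"
  by (auto simp: hat_A_def Let_def M1_simps centralizer_def mul1_inc inc_mul1 \<iota>_closed)

text \<open>The scalar multiplication, defined through a lift, becomes an instance of the left
  action and inherits its rules.\<close>

lemma smult_hat_A: "\<lbrakk>k \<in> carrier K; t \<in> carrier TS\<rbrakk> \<Longrightarrow> k \<odot>\<^bsub>\<B>\<^esub> t = lmul (k \<odot>\<^bsub>M\<^esub> \<one>\<^bsub>M\<^esub>) t"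
proof -
  assume k: "k \<in> carrier K" and t: "t \<in> carrier TS"
  have b: "td.balanced TS (\<lambda>u v. pten (k \<odot>\<^bsub>M\<^esub> u) v)"
    using k by (simp add: balanced_iff abelian_group_TS M.smult_r_distr \<iota>_closed pten_bal flip: M.smult_mult_left)
  show ?thesis unfolding hat_A_simps
    by (rule TS_eqI[OF abelian_group_TS t]) (use k in \<open>simp_all add: lift_ptensor[OF b] M.smult_mult_left\<close>)
qed

text \<open>Right multiplication by \<open>\<iota> n\<close> moves into the argument of
  \<open>\<alpha>\<close> by \<open>psi_inc\<close>; left linearity of \<open>\<alpha>\<close>
  releases it on the left.\<close>

lemma psi_in_hat_A:
  assumes a: "\<alpha> \<in> carrier \<A>" shows "\<psi> \<alpha> \<in> carrier \<B>"
  unfolding hat_A_iff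
proof (intro conjI ballI)
  note a' = EndD[OF a]
  show "\<psi> \<alpha> \<in> carrier TS" using a' by simp
  fix n assume n: "n \<in> carrier N"
  have "rmul (\<iota> n) (\<psi> \<alpha>) = (\<Oplus>\<^bsub>TS\<^esub>j\<in>{..<r}. pten (\<alpha> (\<iota> n \<otimes>\<^bsub>M\<^esub> x j)) (y j))"
    using a' n psi_inc[OF a'(1), of "\<iota> n"] by (simp add: mul1_inc \<iota>_closed)
  also have "\<dots> = (\<Oplus>\<^bsub>TS\<^esub>j\<in>{..<r}. lmul (\<iota> n) (pten (\<alpha> (x j)) (y j)))"
    by (rule TS.finsum_cong') (use a' n in \<open>auto simp: \<iota>_closed\<close>)
  also have "\<dots> = lmul (\<iota> n) (\<psi> \<alpha>)"
    using a' n by (subst psi_eq, simp) (rule lmul_finsum[symmetric], auto simp: \<iota>_closed)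
  finally show "rmul (\<iota> n) (\<psi> \<alpha>) = lmul (\<iota> n) (\<psi> \<alpha>)" .
qed

text \<open>\<open>M\<^sub>1\<close> acts on \<open>M\<close> through its identification with the right \<open>N\<close>-linear endomorphisms of \<open>M\<close>.\<close>

definition act :: "('m \<times> 'm \<Rightarrow>\<^sub>0 int) set \<Rightarrow> 'm \<Rightarrow> 'm" where
  "act t = (\<lambda>z\<in>carrier M. tensor_lift M (\<lambda>u v. u \<otimes>\<^bsub>M\<^esub> \<iota>E (v \<otimes>\<^bsub>M\<^esub> z)) t)"

lemma balanced_act: "z \<in> carrier M \<Longrightarrow> td.balanced M (\<lambda>u v. u \<otimes>\<^bsub>M\<^esub> \<iota>E (v \<otimes>\<^bsub>M\<^esub> z))"
  by (simp add: balanced_iff M.M.abelian_group_axioms M.l_distr M.r_distr M.m_assoc \<iota>_closed)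

lemma act [simp]:
  assumes "z \<in> carrier M"
  shows "t \<in> carrier TS \<Longrightarrow> act t z \<in> carrier M"
    "\<lbrakk>t \<in> carrier TS; t' \<in> carrier TS\<rbrakk> \<Longrightarrow> act (t \<oplus>\<^bsub>TS\<^esub> t') z = act t z \<oplus>\<^bsub>M\<^esub> act t' z"
    "\<lbrakk>u \<in> carrier M; v \<in> carrier M\<rbrakk> \<Longrightarrow> act (pten u v) z = u \<otimes>\<^bsub>M\<^esub> \<iota>E (v \<otimes>\<^bsub>M\<^esub> z)"
  using assms by (simp_all add: act_def lift_ptensor[OF balanced_act])

text \<open>Both maps are extensional, so agreement on \<open>carrier M\<close> suffices, and there
  it is the dual bases expansion of \<open>\<alpha>\<close>.\<close>

lemma act_psi:
  assumes a: "\<alpha> \<in> carrier \<A>" shows "act (\<psi> \<alpha>) = \<alpha>"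
proof (rule extensionalityI[where A = "carrier M"])
  note a' = EndD[OF a]
  fix z assume z: "z \<in> carrier M"
  have "act (\<psi> \<alpha>) z = (\<Oplus>\<^bsub>M\<^esub>j\<in>{..<r}. act (pten (\<alpha> (x j)) (y j)) z)"
    unfolding psi_eq[OF a'(3)]
    by (rule finsum_hom[OF abelian_group_TS M.M.abelian_group_axioms, where h = "\<lambda>t. act t z"])
       (use a' z in auto)
  also have "\<dots> = (\<Oplus>\<^bsub>M\<^esub>j\<in>{..<r}. \<alpha> (x j) \<otimes>\<^bsub>M\<^esub> \<iota>E (y j \<otimes>\<^bsub>M\<^esub> z))"
    by (rule M.M.finsum_cong') (use a' z in auto)
  finally show "act (\<psi> \<alpha>) z = \<alpha> z" by (simp add: dual_bases_map[OF a'(1) z])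
qed (use EndD[OF a] in \<open>auto simp: act_def\<close>)

text \<open>On a pure tensor, \<open>act\<close> multiplies \<open>u\<close> by the value of
  \<open>E\<close> at \<open>v\<close> times the argument; that value crosses the tensor sign and
  the second dual bases identity restores \<open>v\<close>.\<close>

lemma psi_act:
  assumes "t \<in> carrier TS" shows "\<psi> (act t) = t"
proof -
  have e: "\<psi> (act t) = (\<Oplus>\<^bsub>TS\<^esub>j\<in>{..<r}. pten (act t (x j)) (y j))" if "t \<in> carrier TS" for t
    by (rule psi_eq) (use that in auto)
  \<comment> \<open>The identity is spelled out as a map so that \<open>TS_eqI\<close> compares two
    additive functions of \<open>t\<close>.\<close>
  have "\<psi> (act t) = id t"
  proof (rule TS_eqI[OF abelian_group_TS assms])
    fix t t' assume t: "t \<in> carrier TS" "t' \<in> carrier TS"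
    have "\<psi> (act (t \<oplus>\<^bsub>TS\<^esub> t')) =
        (\<Oplus>\<^bsub>TS\<^esub>j\<in>{..<r}. pten (act t (x j)) (y j) \<oplus>\<^bsub>TS\<^esub> pten (act t' (x j)) (y j))"
      unfolding e[OF TS.a_closed[OF t]] by (rule TS.finsum_cong') (use t in auto)
    also have "\<dots> = \<psi> (act t) \<oplus>\<^bsub>TS\<^esub> \<psi> (act t')"
      unfolding e[OF t(1)] e[OF t(2)] by (rule TS.finsum_addf) (use t in auto)
    finally show "\<psi> (act (t \<oplus>\<^bsub>TS\<^esub> t')) = \<psi> (act t) \<oplus>\<^bsub>TS\<^esub> \<psi> (act t')" .
  next
    fix u v assume c: "u \<in> carrier M" "v \<in> carrier M"
    have "\<psi> (act (pten u v)) = (\<Oplus>\<^bsub>TS\<^esub>j\<in>{..<r}. pten u (\<iota>E (v \<otimes>\<^bsub>M\<^esub> x j) \<otimes>\<^bsub>M\<^esub> y j))"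
      unfolding e[OF ptensor_simps(1)[OF c]]
      by (rule TS.finsum_cong') (use c in \<open>auto simp: ptensor_\<iota>E\<close>)
    also have "\<dots> = pten u (\<Oplus>\<^bsub>M\<^esub>j\<in>{..<r}. \<iota>E (v \<otimes>\<^bsub>M\<^esub> x j) \<otimes>\<^bsub>M\<^esub> y j)"
      by (rule ptensor_sumr[symmetric]) (use c in auto)
    finally show "\<psi> (act (pten u v)) = id (pten u v)" using c by (simp add: dual_bases)
  qed auto
  then show ?thesis by simp
qed

lemma act_add:
  assumes "t \<in> carrier TS" "z \<in> carrier M" "z' \<in> carrier M"
  shows "act t (z \<oplus>\<^bsub>M\<^esub> z') = act t z \<oplus>\<^bsub>M\<^esub> act t z'"
  by (rule TS_eqI[OF M.M.abelian_group_axioms assms(1)])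
     (use assms in \<open>simp_all add: M.M.a_ac M.r_distr\<close>)

lemma act_mult:
  assumes t: "t \<in> carrier TS" and z: "z \<in> carrier M" and n: "n \<in> carrier N"
  shows "act t (z \<otimes>\<^bsub>M\<^esub> \<iota> n) = act t z \<otimes>\<^bsub>M\<^esub> \<iota> n"
    "act t (\<iota> n \<otimes>\<^bsub>M\<^esub> z) = act (rmul (\<iota> n) t) z"
    "\<iota> n \<otimes>\<^bsub>M\<^esub> act t z = act (lmul (\<iota> n) t) z"
  subgoal by (rule TS_eqI[OF M.M.abelian_group_axioms t])
      (use z n in \<open>simp_all add: \<iota>_closed M.l_distr flip: M.m_assoc\<close>)
  subgoal by (rule TS_eqI[OF M.M.abelian_group_axioms t])
      (use z n in \<open>simp_all add: \<iota>_closed M.m_assoc\<close>)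
  subgoal by (rule TS_eqI[OF M.M.abelian_group_axioms t])
      (use z n in \<open>simp_all add: \<iota>_closed M.r_distr M.m_assoc\<close>)
  done

text \<open>Right linearity of \<open>act t\<close> holds for every \<open>t\<close> in the tensor
  square; the centralizer condition supplies left linearity.\<close>

lemma act_in_End: "a \<in> carrier \<B> \<Longrightarrow> act a \<in> carrier \<A>"
  by (auto simp: hat_A_iff End_iff right_linear_def act_add act_mult) (auto simp: act_def)

lemma psi_bij: "bij_betw \<psi> (carrier \<A>) (carrier \<B>)"
  by (rule bij_betw_byWitness[where f' = act])
     (auto simp: act_psi psi_act psi_in_hat_A act_in_End hat_A_iff[THEN iffD1])

abbreviation \<psi>' where "\<psi>' \<equiv> psi_A_inv N M \<iota> E r x y"

lemma psi_inv: "\<alpha> \<in> carrier \<A> \<Longrightarrow> \<psi>' (\<psi> \<alpha>) = \<alpha>"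
  unfolding psi_A_inv_def by (rule the_inv_into_f_f) (use psi_bij in \<open>auto simp: bij_betw_def\<close>)

lemma hat_A_E: assumes "a \<in> carrier \<B>" obtains \<alpha> where "\<alpha> \<in> carrier \<A>" "a = \<psi> \<alpha>"
  using assms psi_bij by (auto simp: bij_betw_def)

section \<open>Linearity of \<open>\<psi>\<close> and the group structure of the centralizer\<close>

text \<open>The sum is described pointwise, so that the lemma serves both for sums in
  \<open>\<A>\<close> and for antipode values.\<close>

lemma psi_add:
  assumes "\<gamma> \<in> carrier M \<rightarrow> carrier M" "\<delta> \<in> carrier M \<rightarrow> carrier M"
    and "\<And>z. z \<in> carrier M \<Longrightarrow> f z = \<gamma> z \<oplus>\<^bsub>M\<^esub> \<delta> z"
  shows "\<psi> f = \<psi> \<gamma> \<oplus>\<^bsub>TS\<^esub> \<psi> \<delta>"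
proof -
  have f: "f \<in> carrier M \<rightarrow> carrier M" using assms by (auto simp: Pi_iff)
  have "\<psi> f = (\<Oplus>\<^bsub>TS\<^esub>j\<in>{..<r}. pten (\<gamma> (x j)) (y j) \<oplus>\<^bsub>TS\<^esub> pten (\<delta> (x j)) (y j))"
    unfolding psi_eq[OF f] by (rule TS.finsum_cong') (use assms in \<open>auto simp: Pi_iff\<close>)
  also have "\<dots> = \<psi> \<gamma> \<oplus>\<^bsub>TS\<^esub> \<psi> \<delta>"
    unfolding psi_eq[OF assms(1)] psi_eq[OF assms(2)]
    by (rule TS.finsum_addf) (use assms in \<open>auto simp: Pi_iff\<close>)
  finally show ?thesis .
qed

lemma psi_smult:
  assumes a: "\<alpha> \<in> carrier \<A>" and k: "k \<in> carrier K"
  shows "\<psi> (k \<odot>\<^bsub>\<A>\<^esub> \<alpha>) = k \<odot>\<^bsub>\<B>\<^esub> \<psi> \<alpha>"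
proof -
  note a' = EndD[OF a]
  have "\<psi> (k \<odot>\<^bsub>\<A>\<^esub> \<alpha>) = (\<Oplus>\<^bsub>TS\<^esub>j\<in>{..<r}. lmul (k \<odot>\<^bsub>M\<^esub> \<one>\<^bsub>M\<^esub>) (pten (\<alpha> (x j)) (y j)))"
    unfolding psi_eq[OF EndD(3)[OF smult_closed_End[OF k a]]]
    by (rule TS.finsum_cong') (use a' k in \<open>auto simp: End_simps M.smult_mult_left\<close>)
  also have "\<dots> = lmul (k \<odot>\<^bsub>M\<^esub> \<one>\<^bsub>M\<^esub>) (\<psi> \<alpha>)"
    unfolding psi_eq[OF a'(3)] by (rule lmul_finsum[symmetric]) (use a' k in auto)
  finally show ?thesis using a' k by (simp add: smult_hat_A)
qed

text \<open>Zero and negatives are carried over from \<open>\<A>\<close> along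
  \<open>\<psi>\<close>, which reaches every element of the centralizer.\<close>

lemma abelian_group_hat_A: "abelian_group \<B>"
proof (rule abelian_groupI)
  interpret A: abelian_group \<A> by (rule abelian_group_End)
  \<comment> \<open>The image of zero equals its own double, and cancellation in the tensor square
    makes it zero.\<close>
  have z: "\<psi> \<zero>\<^bsub>\<A>\<^esub> = \<zero>\<^bsub>TS\<^esub>"
    using psi_add[of "\<zero>\<^bsub>\<A>\<^esub>" "\<zero>\<^bsub>\<A>\<^esub>" "\<zero>\<^bsub>\<A>\<^esub>"] EndD[OF A.zero_closed]
    by (metis A.zero_closed M.M.l_zero M.M.zero_closed End_simps(2) TS.add.l_cancel_one' psi_closed restrict_apply')
  show "\<zero>\<^bsub>\<B>\<^esub> \<in> carrier \<B>" using psi_in_hat_A[OF A.zero_closed] by (simp add: z hat_A_simps)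
  fix a assume a: "a \<in> carrier \<B>"
  then obtain \<alpha> where al: "\<alpha> \<in> carrier \<A>" "a = \<psi> \<alpha>" by (rule hat_A_E)
  obtain \<alpha>' where al': "\<alpha>' \<in> carrier \<A>" "\<alpha>' \<oplus>\<^bsub>\<A>\<^esub> \<alpha> = \<zero>\<^bsub>\<A>\<^esub>" using A.add.l_inv_ex[OF al(1)] by auto
  have "\<psi> (\<alpha>' \<oplus>\<^bsub>\<A>\<^esub> \<alpha>) = \<psi> \<alpha>' \<oplus>\<^bsub>TS\<^esub> \<psi> \<alpha>"
    by (rule psi_add) (use al al'(1) EndD in \<open>auto simp: End_simps\<close>)
  then show "\<exists>a'\<in>carrier \<B>. a' \<oplus>\<^bsub>\<B>\<^esub> a = \<zero>\<^bsub>\<B>\<^esub>"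
    using al al' psi_in_hat_A[OF al'(1)] by (auto simp: hat_A_simps z)
qed (auto simp: hat_A_iff hat_A_simps TS.a_ac \<iota>_closed)

lemma smult_closed_hat_A: "\<lbrakk>k \<in> carrier K; a \<in> carrier \<B>\<rbrakk> \<Longrightarrow> k \<odot>\<^bsub>\<B>\<^esub> a \<in> carrier \<B>"
  by (metis hat_A_E psi_in_hat_A psi_smult smult_closed_End)

section \<open>Contraction of tensors along a right linear map\<close>

text \<open>One shape for three maps: with a translate of \<open>\<alpha>\<close> it gives the left
  factors of the coproduct, with a translate of \<open>\<iota>E\<close> the elements E(z b1) b2 of
  the antipode, and with the identity map the multiplication map \<open>E_M\<close>.\<close>

definition contract :: "('m \<Rightarrow> 'm) \<Rightarrow> ('m \<times> 'm \<Rightarrow>\<^sub>0 int) set \<Rightarrow> 'm" where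
  "contract \<gamma> = tensor_lift M (\<lambda>u v. \<gamma> u \<otimes>\<^bsub>M\<^esub> v)"

lemma balanced_contract: "right_linear \<gamma> \<Longrightarrow> td.balanced M (\<lambda>u v. \<gamma> u \<otimes>\<^bsub>M\<^esub> v)"
  by (simp add: balanced_iff M.M.abelian_group_axioms right_linearD M.l_distr M.r_distr M.m_assoc \<iota>_closed)

lemma contract [simp]:
  assumes "right_linear \<gamma>"
  shows "t \<in> carrier TS \<Longrightarrow> contract \<gamma> t \<in> carrier M"
    "\<lbrakk>t \<in> carrier TS; t' \<in> carrier TS\<rbrakk> \<Longrightarrow> contract \<gamma> (t \<oplus>\<^bsub>TS\<^esub> t') = contract \<gamma> t \<oplus>\<^bsub>M\<^esub> contract \<gamma> t'"
    "\<lbrakk>u \<in> carrier M; v \<in> carrier M\<rbrakk> \<Longrightarrow> contract \<gamma> (pten u v) = \<gamma> u \<otimes>\<^bsub>M\<^esub> v"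
  using assms by (simp_all add: contract_def lift_ptensor[OF balanced_contract])

lemma contract_finsum:
  assumes "right_linear \<gamma>" "finite A" "c \<in> A \<rightarrow> carrier TS"
  shows "contract \<gamma> (\<Oplus>\<^bsub>TS\<^esub>i\<in>A. c i) = (\<Oplus>\<^bsub>M\<^esub>i\<in>A. contract \<gamma> (c i))"
  unfolding contract_def by (rule lift_finsum[OF balanced_contract]) (use assms in auto)

lemma right_linear_translate:
  "\<lbrakk>right_linear \<gamma>; m \<in> carrier M\<rbrakk> \<Longrightarrow> right_linear (\<lambda>u. \<gamma> (m \<otimes>\<^bsub>M\<^esub> u))"
  by (auto simp: right_linear_def M.r_distr \<iota>_closed Pi_iff simp flip: M.m_assoc)

lemma right_linear_\<iota>E [simp]: "m \<in> carrier M \<Longrightarrow> right_linear (\<lambda>u. \<iota>E (m \<otimes>\<^bsub>M\<^esub> u))"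
  by (rule right_linear_translate[of \<iota>E]) (auto simp: right_linear_def)

lemma right_linear_id [simp]: "right_linear (\<lambda>u. u)"
  by (auto simp: right_linear_def)

lemma contract_lmul:
  assumes g: "right_linear \<gamma>" and m: "m \<in> carrier M" and t: "t \<in> carrier TS"
  shows "contract \<gamma> (lmul m t) = contract (\<lambda>u. \<gamma> (m \<otimes>\<^bsub>M\<^esub> u)) t"
  by (rule TS_eqI[OF M.M.abelian_group_axioms t])
     (use m in \<open>simp_all add: right_linear_translate[OF g] g\<close>)

lemma contract_rmul:
  assumes g: "right_linear \<gamma>" and m: "m \<in> carrier M" and t: "t \<in> carrier TS"
  shows "contract \<gamma> (rmul m t) = contract \<gamma> t \<otimes>\<^bsub>M\<^esub> m"
  by (rule TS_eqI[OF M.M.abelian_group_axioms t])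
     (use m in \<open>simp_all add: g M.l_distr M.m_assoc right_linearD[OF g]\<close>)

lemma contract_left:
  assumes g: "right_linear \<gamma>" and n: "n \<in> carrier N" and t: "t \<in> carrier TS"
    and l: "\<And>u. u \<in> carrier M \<Longrightarrow> \<delta> u = \<iota> n \<otimes>\<^bsub>M\<^esub> \<gamma> u"
  shows "contract \<delta> t = \<iota> n \<otimes>\<^bsub>M\<^esub> contract \<gamma> t"
proof -
  have d: "right_linear \<delta>"
    using right_linearD[OF g] n by (auto simp: right_linear_def l \<iota>_closed M.r_distr M.m_assoc)
  show ?thesis
    by (rule TS_eqI[OF M.M.abelian_group_axioms t])
       (use n in \<open>simp_all add: g d l \<iota>_closed M.r_distr M.m_assoc right_linearD[OF g]\<close>)
qed

lemma contract_add:
  assumes g: "right_linear \<gamma>" and h: "right_linear \<delta>" and f: "right_linear \<phi>" and t: "t \<in> carrier TS"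
    and l: "\<And>u. u \<in> carrier M \<Longrightarrow> \<phi> u = \<gamma> u \<oplus>\<^bsub>M\<^esub> \<delta> u"
  shows "contract \<phi> t = contract \<gamma> t \<oplus>\<^bsub>M\<^esub> contract \<delta> t"
  by (rule TS_eqI[OF M.M.abelian_group_axioms t])
     (simp_all add: f g h l M.l_distr M.M.a_ac right_linearD[OF g] right_linearD[OF h])

text \<open>Agreement is asked on \<open>carrier M\<close> only, because reassociating a product is
  justified only there.\<close>

lemma contract_cong:
  assumes g: "right_linear \<gamma>" and d: "right_linear \<delta>" and t: "t \<in> carrier TS"
    and e: "\<And>u. u \<in> carrier M \<Longrightarrow> \<gamma> u = \<delta> u"
  shows "contract \<gamma> t = contract \<delta> t"
  by (rule TS_eqI[OF M.M.abelian_group_axioms t]) (simp_all add: g d e right_linearD[OF d])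

text \<open>\<open>E\<^sub>M \<circ> \<psi>\<^sub>A\<close>.\<close>

definition functional :: "('m \<Rightarrow> 'm) \<Rightarrow> 'm" where
  "functional \<gamma> = (\<Oplus>\<^bsub>M\<^esub>j\<in>{..<r}. \<gamma> (x j) \<otimes>\<^bsub>M\<^esub> y j)"

lemma functional_closed: "\<gamma> \<in> carrier M \<rightarrow> carrier M \<Longrightarrow> functional \<gamma> \<in> carrier M"
  unfolding functional_def by (rule M.M.finsum_closed) (auto simp: Pi_iff)

text \<open>\<open>functional\<close> is the multiplication map applied to the sum of the tensors
  \<open>pten (\<gamma> (x j)) (y j)\<close>. In tensor form, \<open>ptensor_shift\<close> carries
  \<open>\<iota> n\<close> from the far right into the argument of \<open>\<gamma>\<close>, and left
  linearity takes it out.\<close>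

lemma functional_centralizes:
  assumes g: "right_linear \<gamma>" and l: "\<And>u. u \<in> carrier M \<Longrightarrow> \<gamma> (\<iota> n \<otimes>\<^bsub>M\<^esub> u) = \<iota> n \<otimes>\<^bsub>M\<^esub> \<gamma> u"
    and n: "n \<in> carrier N"
  shows "functional \<gamma> \<otimes>\<^bsub>M\<^esub> \<iota> n = \<iota> n \<otimes>\<^bsub>M\<^esub> functional \<gamma>"
proof -
  note g' = right_linearD[OF g]
  have "functional \<gamma> \<otimes>\<^bsub>M\<^esub> \<iota> n = (\<Oplus>\<^bsub>M\<^esub>j\<in>{..<r}. contract (\<lambda>u. u) (pten (\<gamma> (x j)) (y j \<otimes>\<^bsub>M\<^esub> \<iota> n)))"
    unfolding functional_def using n g'
    by (subst M.finsum_ldistr) (auto simp: \<iota>_closed M.m_assoc intro!: M.M.finsum_cong')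
  also have "\<dots> = contract (\<lambda>u. u) (\<Oplus>\<^bsub>TS\<^esub>j\<in>{..<r}. pten (\<gamma> (x j)) (y j \<otimes>\<^bsub>M\<^esub> \<iota> n))"
    by (rule contract_finsum[symmetric]) (use n g' in \<open>auto simp: \<iota>_closed\<close>)
  also have "\<dots> = contract (\<lambda>u. u) (\<Oplus>\<^bsub>TS\<^esub>j\<in>{..<r}. pten (\<gamma> (\<iota> n \<otimes>\<^bsub>M\<^esub> x j)) (y j))"
    using ptensor_shift[OF g \<iota>_closed[OF n]] by simp
  also have "\<dots> = (\<Oplus>\<^bsub>M\<^esub>j\<in>{..<r}. contract (\<lambda>u. u) (pten (\<gamma> (\<iota> n \<otimes>\<^bsub>M\<^esub> x j)) (y j)))"
    by (rule contract_finsum) (use n g' in \<open>auto simp: \<iota>_closed\<close>)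
  also have "\<dots> = \<iota> n \<otimes>\<^bsub>M\<^esub> functional \<gamma>"
    unfolding functional_def using n g'
    by (subst M.finsum_rdistr) (auto simp: \<iota>_closed M.m_assoc l intro!: M.M.finsum_cong')
  finally show ?thesis .
qed

text \<open>A scalar commutes with all of \<open>M\<close> and acts through \<open>N\<close>, so it
  passes the first factor, the tensor sign and the second factor.\<close>

lemma lmul_scalar:
  assumes k: "k \<in> carrier K" and c: "c \<in> carrier M" and t: "t \<in> carrier TS"
  shows "lmul (c \<otimes>\<^bsub>M\<^esub> (k \<odot>\<^bsub>M\<^esub> \<one>\<^bsub>M\<^esub>)) t = rmul (k \<odot>\<^bsub>M\<^esub> \<one>\<^bsub>M\<^esub>) (lmul c t)"
proof (rule TS_eqI[OF abelian_group_TS t])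
  fix u v assume uv: "u \<in> carrier M" "v \<in> carrier M"
  \<comment> \<open>This is the element of \<open>N\<close> whose image represents the scalar;
    balancedness is applied to it.\<close>
  have n: "k \<odot>\<^bsub>N\<^esub> \<one>\<^bsub>N\<^esub> \<in> carrier N" using k by simp
  have "lmul (c \<otimes>\<^bsub>M\<^esub> (k \<odot>\<^bsub>M\<^esub> \<one>\<^bsub>M\<^esub>)) (pten u v) = pten (k \<odot>\<^bsub>M\<^esub> (c \<otimes>\<^bsub>M\<^esub> u)) v"
    using k c uv by (simp add: M.smult_mult_left M.smult_mult_right)
  also have "\<dots> = pten (c \<otimes>\<^bsub>M\<^esub> u) (k \<odot>\<^bsub>M\<^esub> v)"
    using k c uv pten_bal[OF _ n, of "c \<otimes>\<^bsub>M\<^esub> u" v] by (simp add: smult_unit(1)[of k v] smult_unit(2)[of k "c \<otimes>\<^bsub>M\<^esub> u"])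
  also have "\<dots> = rmul (k \<odot>\<^bsub>M\<^esub> \<one>\<^bsub>M\<^esub>) (lmul c (pten u v))"
    using k c uv by (simp add: M.smult_mult_right)
  finally show "lmul (c \<otimes>\<^bsub>M\<^esub> (k \<odot>\<^bsub>M\<^esub> \<one>\<^bsub>M\<^esub>)) (pten u v) = rmul (k \<odot>\<^bsub>M\<^esub> \<one>\<^bsub>M\<^esub>) (lmul c (pten u v))" .
qed (use k c in simp_all)

end

section \<open>Antipode and coproduct\<close>

locale quasibasis_extension = frobenius_extension K N M \<iota> E r x y
  for K :: "('k, 'kz) ring_scheme" and N :: "('k, 'n, 'nz) module_scheme"
    and M :: "('k, 'm, 'mz) module_scheme" and \<iota> :: "'n \<Rightarrow> 'm"
    and E :: "'m \<Rightarrow> 'n" and r :: nat and x y :: "nat \<Rightarrow> 'm" +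
  fixes s :: nat and b :: "nat \<Rightarrow> ('m \<times> 'm \<Rightarrow>\<^sub>0 int) set" and \<beta> :: "nat \<Rightarrow> 'm \<Rightarrow> 'm"
  assumes irreducible: "irreducible_extension K N M \<iota>"
    and quasibasis: "left_D2_quasibasis N M \<iota> s b \<beta>"
begin

lemma b_closed [simp]: "i < s \<Longrightarrow> b i \<in> carrier TS"
  using quasibasis by (auto simp: left_D2_quasibasis_def tensor_square_simps TS_def)

lemma b_central: "\<lbrakk>i < s; n \<in> carrier N\<rbrakk> \<Longrightarrow> lmul (\<iota> n) (b i) = rmul (\<iota> n) (b i)"
  using quasibasis by (auto simp: left_D2_quasibasis_def tensor_square_simps lmul_def rmul_def)

lemma \<beta>_in_End: "i < s \<Longrightarrow> \<beta> i \<in> carrier \<A>"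
  using quasibasis by (auto simp: left_D2_quasibasis_def)

lemma \<beta>_closed [simp]: "\<lbrakk>i < s; m \<in> carrier M\<rbrakk> \<Longrightarrow> \<beta> i m \<in> carrier M"
  by (rule EndD(2)[OF \<beta>_in_End])

lemma quasibasis_sum:
  "m \<in> carrier M \<Longrightarrow> (\<Oplus>\<^bsub>TS\<^esub>i\<in>{..<s}. rmul (\<beta> i m) (b i)) = pten m \<one>\<^bsub>M\<^esub>"
  using quasibasis
  by (simp only: left_D2_quasibasis_def tensor_square_simps tensor_square_finsum rmul_def TS_def id_apply)

text \<open>Irreducibility enters here: the value centralizes \<open>N\<close>, and \<open>K\<close>
  maps onto the centralizer.\<close>

lemma functional_scalar:
  assumes g: "right_linear \<gamma>"
    and l: "\<And>n u. \<lbrakk>n \<in> carrier N; u \<in> carrier M\<rbrakk> \<Longrightarrow> \<gamma> (\<iota> n \<otimes>\<^bsub>M\<^esub> u) = \<iota> n \<otimes>\<^bsub>M\<^esub> \<gamma> u"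
  obtains k where "k \<in> carrier K" "functional \<gamma> = k \<odot>\<^bsub>M\<^esub> \<one>\<^bsub>M\<^esub>"
proof -
  have "functional \<gamma> \<in> centralizer M (\<iota> ` carrier N)"
    using functional_closed right_linearD[OF g] functional_centralizes[OF g l] by (auto simp: centralizer_def)
  then show thesis
    using irreducible that by (auto simp: irreducible_extension_def bij_betw_def)
qed

section \<open>The antipode and its interplay with the quasibasis\<close>

abbreviation S where "S \<equiv> End_antipode M \<iota> E r x y s b \<beta>"

text \<open>Only the last two factors depend on \<open>j\<close>, so their sum splits off as
  \<open>functional\<close> of the composite of \<open>\<alpha>\<close> with
  \<open>\<beta> i\<close>.\<close>

lemma antipode_eq:
  assumes a: "\<alpha> \<in> carrier M \<rightarrow> carrier M" and z: "z \<in> carrier M"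
  shows "S \<alpha> z = (\<Oplus>\<^bsub>M\<^esub>i\<in>{..<s}. contract (\<lambda>u. \<iota>E (z \<otimes>\<^bsub>M\<^esub> u)) (b i) \<otimes>\<^bsub>M\<^esub> functional (\<lambda>w. \<alpha> (\<beta> i w)))"
proof -
  have a': "\<alpha> u \<in> carrier M" if "u \<in> carrier M" for u using a that by auto
  \<comment> \<open>Fixed factors on the right leave the lift, which becomes a contraction.\<close>
  have t: "tensor_lift M (\<lambda>u v. \<iota> (E (z \<otimes>\<^bsub>M\<^esub> u)) \<otimes>\<^bsub>M\<^esub> v \<otimes>\<^bsub>M\<^esub> c \<otimes>\<^bsub>M\<^esub> d) t =
      contract (\<lambda>u. \<iota>E (z \<otimes>\<^bsub>M\<^esub> u)) t \<otimes>\<^bsub>M\<^esub> (c \<otimes>\<^bsub>M\<^esub> d)"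
    if c: "c \<in> carrier M" and d: "d \<in> carrier M" and t: "t \<in> carrier TS" for c d t
  proof -
    have B: "td.balanced M (\<lambda>u v. \<iota>E (z \<otimes>\<^bsub>M\<^esub> u) \<otimes>\<^bsub>M\<^esub> v \<otimes>\<^bsub>M\<^esub> c \<otimes>\<^bsub>M\<^esub> d)"
      using z c d right_linear_\<iota>E[OF z, THEN right_linearD(3)]
      by (simp add: balanced_iff M.M.abelian_group_axioms M.l_distr M.r_distr M.m_assoc \<iota>_closed)
    show ?thesis unfolding \<iota>E_def[symmetric]
      by (rule TS_eqI[OF M.M.abelian_group_axioms t])
         (use z c d in \<open>simp_all add: lift_ptensor[OF B] M.l_distr M.m_assoc\<close>)
  qed
  have "S \<alpha> z = (\<Oplus>\<^bsub>M\<^esub>i\<in>{..<s}. \<Oplus>\<^bsub>M\<^esub>j\<in>{..<r}.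
      contract (\<lambda>u. \<iota>E (z \<otimes>\<^bsub>M\<^esub> u)) (b i) \<otimes>\<^bsub>M\<^esub> (\<alpha> (\<beta> i (x j)) \<otimes>\<^bsub>M\<^esub> y j))"
    unfolding End_antipode_def restrict_apply'[OF z]
    by (intro M.M.finsum_cong' refl funcsetI M.M.finsum_closed) (use a' z in \<open>simp_all add: t\<close>)
  also have "\<dots> = (\<Oplus>\<^bsub>M\<^esub>i\<in>{..<s}. contract (\<lambda>u. \<iota>E (z \<otimes>\<^bsub>M\<^esub> u)) (b i) \<otimes>\<^bsub>M\<^esub> functional (\<lambda>w. \<alpha> (\<beta> i w)))"
    unfolding functional_def
    by (intro M.M.finsum_cong' refl funcsetI M.finsum_rdistr[symmetric])
       (use a' z in \<open>auto intro!: M.m_closed M.M.finsum_closed\<close>)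
  finally show ?thesis .
qed

lemma antipode_closed:
  assumes "\<alpha> \<in> carrier M \<rightarrow> carrier M" "z \<in> carrier M" shows "S \<alpha> z \<in> carrier M"
  unfolding antipode_eq[OF assms]
  by (rule M.M.finsum_closed) (use assms in \<open>auto intro!: M.m_closed functional_closed\<close>)

lemma antipode_add:
  assumes a: "\<alpha> \<in> carrier \<A>" "\<alpha>' \<in> carrier \<A>" and z: "z \<in> carrier M"
  shows "S (\<alpha> \<oplus>\<^bsub>\<A>\<^esub> \<alpha>') z = S \<alpha> z \<oplus>\<^bsub>M\<^esub> S \<alpha>' z"
proof -
  note c = EndD(2)[OF a(1)] EndD(2)[OF a(2)]
  have l: "functional (\<lambda>w. (\<alpha> \<oplus>\<^bsub>\<A>\<^esub> \<alpha>') (\<beta> i w)) = functional (\<lambda>w. \<alpha> (\<beta> i w)) \<oplus>\<^bsub>M\<^esub> functional (\<lambda>w. \<alpha>' (\<beta> i w))"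
    if i: "i < s" for i
  proof -
    have "functional (\<lambda>w. (\<alpha> \<oplus>\<^bsub>\<A>\<^esub> \<alpha>') (\<beta> i w)) =
        (\<Oplus>\<^bsub>M\<^esub>j\<in>{..<r}. \<alpha> (\<beta> i (x j)) \<otimes>\<^bsub>M\<^esub> y j \<oplus>\<^bsub>M\<^esub> \<alpha>' (\<beta> i (x j)) \<otimes>\<^bsub>M\<^esub> y j)"
      unfolding functional_def by (rule M.M.finsum_cong') (use c i in \<open>auto simp: End_simps M.l_distr\<close>)
    also have "\<dots> = functional (\<lambda>w. \<alpha> (\<beta> i w)) \<oplus>\<^bsub>M\<^esub> functional (\<lambda>w. \<alpha>' (\<beta> i w))"
      unfolding functional_def by (rule M.M.finsum_addf) (use c i in auto)
    finally show ?thesis .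
  qed
  have lc: "functional (\<lambda>w. \<alpha> (\<beta> i w)) \<in> carrier M" "functional (\<lambda>w. \<alpha>' (\<beta> i w)) \<in> carrier M" if "i < s" for i
    by (rule functional_closed, rule funcsetI, use that c in simp)+
  have "S (\<alpha> \<oplus>\<^bsub>\<A>\<^esub> \<alpha>') z = (\<Oplus>\<^bsub>M\<^esub>i\<in>{..<s}.
      contract (\<lambda>u. \<iota>E (z \<otimes>\<^bsub>M\<^esub> u)) (b i) \<otimes>\<^bsub>M\<^esub> functional (\<lambda>w. \<alpha> (\<beta> i w)) \<oplus>\<^bsub>M\<^esub>
      contract (\<lambda>u. \<iota>E (z \<otimes>\<^bsub>M\<^esub> u)) (b i) \<otimes>\<^bsub>M\<^esub> functional (\<lambda>w. \<alpha>' (\<beta> i w)))"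
    unfolding antipode_eq[OF EndD(3)[OF add_closed_End[OF a]] z]
    by (rule M.M.finsum_cong') (use z lc in \<open>auto simp: l M.r_distr\<close>)
  also have "\<dots> = S \<alpha> z \<oplus>\<^bsub>M\<^esub> S \<alpha>' z"
    unfolding antipode_eq[OF EndD(3)[OF a(1)] z] antipode_eq[OF EndD(3)[OF a(2)] z]
    by (rule M.M.finsum_addf) (use z lc in auto)
  finally show ?thesis .
qed

text \<open>Together with \<open>antipode_add\<close>, this lets the right-hand side of the theorem
  descend to the tensor product over \<open>K\<close>.\<close>

lemma antipode_smult:
  assumes a: "\<alpha> \<in> carrier \<A>" and k: "k \<in> carrier K" and z: "z \<in> carrier M"
  shows "S (k \<odot>\<^bsub>\<A>\<^esub> \<alpha>) z = k \<odot>\<^bsub>M\<^esub> S \<alpha> z"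
proof -
  note c = EndD(2)[OF a]
  have l: "functional (\<lambda>w. (k \<odot>\<^bsub>\<A>\<^esub> \<alpha>) (\<beta> i w)) = k \<odot>\<^bsub>M\<^esub> functional (\<lambda>w. \<alpha> (\<beta> i w))" if i: "i < s" for i
  proof -
    have "functional (\<lambda>w. (k \<odot>\<^bsub>\<A>\<^esub> \<alpha>) (\<beta> i w)) = (\<Oplus>\<^bsub>M\<^esub>j\<in>{..<r}. k \<odot>\<^bsub>M\<^esub> (\<alpha> (\<beta> i (x j)) \<otimes>\<^bsub>M\<^esub> y j))"
      unfolding functional_def by (rule M.M.finsum_cong') (use c i k in \<open>auto simp: End_simps M.smult_mult_left\<close>)
    also have "\<dots> = k \<odot>\<^bsub>M\<^esub> functional (\<lambda>w. \<alpha> (\<beta> i w))"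
      unfolding functional_def
      by (rule finsum_hom[symmetric, OF M.M.abelian_group_axioms M.M.abelian_group_axioms])
         (use c i k in \<open>auto simp: M.smult_r_distr\<close>)
    finally show ?thesis .
  qed
  have lc: "functional (\<lambda>w. \<alpha> (\<beta> i w)) \<in> carrier M" if "i < s" for i
    by (rule functional_closed, rule funcsetI, use that c in simp)+
  have "S (k \<odot>\<^bsub>\<A>\<^esub> \<alpha>) z = (\<Oplus>\<^bsub>M\<^esub>i\<in>{..<s}.
      k \<odot>\<^bsub>M\<^esub> (contract (\<lambda>u. \<iota>E (z \<otimes>\<^bsub>M\<^esub> u)) (b i) \<otimes>\<^bsub>M\<^esub> functional (\<lambda>w. \<alpha> (\<beta> i w))))"
    unfolding antipode_eq[OF EndD(3)[OF smult_closed_End[OF k a]] z]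
    by (rule M.M.finsum_cong') (use z k lc in \<open>auto simp: l M.smult_mult_right\<close>)
  also have "\<dots> = k \<odot>\<^bsub>M\<^esub> S \<alpha> z"
    unfolding antipode_eq[OF EndD(3)[OF a] z]
    by (rule finsum_hom[symmetric, OF M.M.abelian_group_axioms M.M.abelian_group_axioms])
       (use z k lc in \<open>auto simp: M.smult_r_distr\<close>)
  finally show ?thesis .
qed

text \<open>Contract the quasibasis identity for \<open>m\<close> along the translate of
  \<open>\<iota>E\<close> by \<open>z\<close>: the right factors \<open>\<beta> k m\<close> come
  out, and \<open>m \<otimes> 1\<close> contracts to the value at \<open>m\<close>.\<close>

lemma \<iota>E_quasibasis:
  assumes z: "z \<in> carrier M" and m: "m \<in> carrier M"
  shows "(\<Oplus>\<^bsub>M\<^esub>k\<in>{..<s}. contract (\<lambda>u. \<iota>E (z \<otimes>\<^bsub>M\<^esub> u)) (b k) \<otimes>\<^bsub>M\<^esub> \<beta> k m) = \<iota>E (z \<otimes>\<^bsub>M\<^esub> m)"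
proof -
  have "(\<Oplus>\<^bsub>M\<^esub>k\<in>{..<s}. contract (\<lambda>u. \<iota>E (z \<otimes>\<^bsub>M\<^esub> u)) (b k) \<otimes>\<^bsub>M\<^esub> \<beta> k m) =
      (\<Oplus>\<^bsub>M\<^esub>k\<in>{..<s}. contract (\<lambda>u. \<iota>E (z \<otimes>\<^bsub>M\<^esub> u)) (rmul (\<beta> k m) (b k)))"
    by (rule M.M.finsum_cong') (use z m in \<open>auto simp: contract_rmul\<close>)
  also have "\<dots> = contract (\<lambda>u. \<iota>E (z \<otimes>\<^bsub>M\<^esub> u)) (\<Oplus>\<^bsub>TS\<^esub>k\<in>{..<s}. rmul (\<beta> k m) (b k))"
    by (rule contract_finsum[symmetric]) (use z m in auto)
  finally show ?thesis using z m by (simp add: quasibasis_sum)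
qed

text \<open>The inverse property of the antipode in the only form used: inserted in front of the
  quasibasis, it moves \<open>z\<close> to the right-hand factor.\<close>

lemma antipode_quasibasis:
  assumes z: "z \<in> carrier M"
  shows "(\<Oplus>\<^bsub>TS\<^esub>i\<in>{..<s}. lmul (S (\<beta> i) z) (b i)) = pten \<one>\<^bsub>M\<^esub> z"
proof -
  define c where "c k = contract (\<lambda>u. \<iota>E (z \<otimes>\<^bsub>M\<^esub> u)) (b k)" for k
  have c: "c k \<in> carrier M" if "k < s" for k using that z by (simp add: c_def)
  have "(\<Oplus>\<^bsub>TS\<^esub>i\<in>{..<s}. lmul (S (\<beta> i) z) (b i)) =
      (\<Oplus>\<^bsub>TS\<^esub>i\<in>{..<s}. \<Oplus>\<^bsub>TS\<^esub>k\<in>{..<s}. \<Oplus>\<^bsub>TS\<^esub>j\<in>{..<r}. rmul (y j) (lmul (c k) (rmul (\<beta> i (\<beta> k (x j))) (b i))))"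
  proof (rule TS.finsum_cong'[OF refl], goal_cases)
    case (2 i)
    then have i: "i < s" by simp
    note bi = EndD[OF \<beta>_in_End[OF i]]
    have lc: "functional (\<lambda>w. \<beta> i (\<beta> k w)) \<in> carrier M" if "k < s" for k
      using that i by (auto intro!: functional_closed)
    have "lmul (S (\<beta> i) z) (b i) = (\<Oplus>\<^bsub>TS\<^esub>k\<in>{..<s}. lmul (c k \<otimes>\<^bsub>M\<^esub> functional (\<lambda>w. \<beta> i (\<beta> k w))) (b i))"
      unfolding antipode_eq[OF bi(3) z] c_def[symmetric]
      by (rule lmul_sum) (use i c lc in auto)
    also have "\<dots> = (\<Oplus>\<^bsub>TS\<^esub>k\<in>{..<s}. \<Oplus>\<^bsub>TS\<^esub>j\<in>{..<r}. rmul (y j) (lmul (c k) (rmul (\<beta> i (\<beta> k (x j))) (b i))))"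
    proof (rule TS.finsum_cong'[OF refl], goal_cases)
      case (2 k)
      then have k: "k < s" by simp
      note bk = EndD[OF \<beta>_in_End[OF k]]
      \<comment> \<open>The composite of \<open>\<beta> i\<close> with \<open>\<beta> k\<close> is
        linear over \<open>N\<close> on both sides, so its \<open>functional\<close> is a scalar and
        may leave the left of \<open>b i\<close> for the far right.\<close>
      obtain \<kappa> where kap: "\<kappa> \<in> carrier K" "functional (\<lambda>w. \<beta> i (\<beta> k w)) = \<kappa> \<odot>\<^bsub>M\<^esub> \<one>\<^bsub>M\<^esub>"
        by (rule functional_scalar[of "\<lambda>w. \<beta> i (\<beta> k w)"]) (auto simp: right_linear_def bi bk i k)
      have "lmul (c k \<otimes>\<^bsub>M\<^esub> functional (\<lambda>w. \<beta> i (\<beta> k w))) (b i) = rmul (functional (\<lambda>w. \<beta> i (\<beta> k w))) (lmul (c k) (b i))"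
        unfolding kap(2) by (rule lmul_scalar) (use kap c i k in auto)
      \<comment> \<open>On the right the scalar is expanded into its defining sum again, which puts
        \<open>\<beta> i (\<beta> k (x j))\<close> next to \<open>b i\<close>, as the quasibasis
        identity at \<open>\<beta> k (x j)\<close> requires.\<close>
      also have "\<dots> = (\<Oplus>\<^bsub>TS\<^esub>j\<in>{..<r}. rmul (\<beta> i (\<beta> k (x j)) \<otimes>\<^bsub>M\<^esub> y j) (lmul (c k) (b i)))"
        unfolding functional_def by (rule rmul_sum) (use c i k in auto)
      also have "\<dots> = (\<Oplus>\<^bsub>TS\<^esub>j\<in>{..<r}. rmul (y j) (lmul (c k) (rmul (\<beta> i (\<beta> k (x j))) (b i))))"
        by (rule TS.finsum_cong') (use c i k in \<open>auto simp: lmul_rmul rmul_rmul\<close>)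
      finally show ?case .
    qed (use c i in \<open>auto intro!: TS.finsum_closed\<close>)
    finally show ?case .
  qed (use c in \<open>auto intro!: TS.finsum_closed\<close>)
  \<comment> \<open>The sum over \<open>i\<close> is brought inside, where the quasibasis identity
    collapses it; \<open>c k\<close> and \<open>y j\<close> are then multiplied onto
    \<open>\<beta> k (x j) \<otimes> 1\<close>.\<close>
  also have "\<dots> = (\<Oplus>\<^bsub>TS\<^esub>k\<in>{..<s}. \<Oplus>\<^bsub>TS\<^esub>i\<in>{..<s}. \<Oplus>\<^bsub>TS\<^esub>j\<in>{..<r}. rmul (y j) (lmul (c k) (rmul (\<beta> i (\<beta> k (x j))) (b i))))"
    by (rule TS.finsum_swap) (use c in \<open>auto intro!: TS.finsum_closed\<close>)
  also have "\<dots> = (\<Oplus>\<^bsub>TS\<^esub>k\<in>{..<s}. \<Oplus>\<^bsub>TS\<^esub>j\<in>{..<r}. pten (c k \<otimes>\<^bsub>M\<^esub> \<beta> k (x j)) (y j))"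
  proof (rule TS.finsum_cong'[OF refl], goal_cases)
    case (2 k)
    then have k: "k < s" by simp
    have "(\<Oplus>\<^bsub>TS\<^esub>i\<in>{..<s}. \<Oplus>\<^bsub>TS\<^esub>j\<in>{..<r}. rmul (y j) (lmul (c k) (rmul (\<beta> i (\<beta> k (x j))) (b i)))) =
        (\<Oplus>\<^bsub>TS\<^esub>j\<in>{..<r}. \<Oplus>\<^bsub>TS\<^esub>i\<in>{..<s}. rmul (y j) (lmul (c k) (rmul (\<beta> i (\<beta> k (x j))) (b i))))"
      by (rule TS.finsum_swap) (use c k in auto)
    also have "\<dots> = (\<Oplus>\<^bsub>TS\<^esub>j\<in>{..<r}. pten (c k \<otimes>\<^bsub>M\<^esub> \<beta> k (x j)) (y j))"
    proof (rule TS.finsum_cong'[OF refl], goal_cases)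
      case (2 j)
      then have j: "j < r" by simp
      have "(\<Oplus>\<^bsub>TS\<^esub>i\<in>{..<s}. rmul (y j) (lmul (c k) (rmul (\<beta> i (\<beta> k (x j))) (b i)))) =
          rmul (y j) (\<Oplus>\<^bsub>TS\<^esub>i\<in>{..<s}. lmul (c k) (rmul (\<beta> i (\<beta> k (x j))) (b i)))"
        by (rule rmul_finsum[symmetric]) (use c k j in auto)
      also have "(\<Oplus>\<^bsub>TS\<^esub>i\<in>{..<s}. lmul (c k) (rmul (\<beta> i (\<beta> k (x j))) (b i))) =
          lmul (c k) (\<Oplus>\<^bsub>TS\<^esub>i\<in>{..<s}. rmul (\<beta> i (\<beta> k (x j))) (b i))"
        by (rule lmul_finsum[symmetric]) (use c k j in auto)
      finally show ?case using c k j by (simp add: quasibasis_sum)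
    qed (use c k in auto)
    finally show ?case .
  qed (use c in \<open>auto intro!: TS.finsum_closed\<close>)
  \<comment> \<open>Now the sum over \<open>k\<close> goes inside, for the second use of the
    quasibasis through \<open>\<iota>E_quasibasis\<close>.\<close>
  also have "\<dots> = (\<Oplus>\<^bsub>TS\<^esub>j\<in>{..<r}. \<Oplus>\<^bsub>TS\<^esub>k\<in>{..<s}. pten (c k \<otimes>\<^bsub>M\<^esub> \<beta> k (x j)) (y j))"
    by (rule TS.finsum_swap) (use c in auto)
  also have "\<dots> = (\<Oplus>\<^bsub>TS\<^esub>j\<in>{..<r}. pten \<one>\<^bsub>M\<^esub> (\<iota>E (z \<otimes>\<^bsub>M\<^esub> x j) \<otimes>\<^bsub>M\<^esub> y j))"
  proof (rule TS.finsum_cong'[OF refl], goal_cases)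
    case (2 j)
    then have j: "j < r" by simp
    have "(\<Oplus>\<^bsub>TS\<^esub>k\<in>{..<s}. pten (c k \<otimes>\<^bsub>M\<^esub> \<beta> k (x j)) (y j)) = pten (\<Oplus>\<^bsub>M\<^esub>k\<in>{..<s}. c k \<otimes>\<^bsub>M\<^esub> \<beta> k (x j)) (y j)"
      by (rule ptensor_suml[symmetric]) (use c j in auto)
    also have "\<dots> = pten (\<iota>E (z \<otimes>\<^bsub>M\<^esub> x j)) (y j)"
      unfolding c_def using \<iota>E_quasibasis z j by simp
    \<comment> \<open>The value of \<open>E\<close> crosses to the second factor, so that the
      remaining sum over \<open>j\<close> is a dual bases expansion of \<open>z\<close>.\<close>
    finally show ?case using z j ptensor_\<iota>E[of "\<one>\<^bsub>M\<^esub>" "z \<otimes>\<^bsub>M\<^esub> x j" "y j"] by simp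
  qed (use z in auto)
  also have "\<dots> = pten \<one>\<^bsub>M\<^esub> (\<Oplus>\<^bsub>M\<^esub>j\<in>{..<r}. \<iota>E (z \<otimes>\<^bsub>M\<^esub> x j) \<otimes>\<^bsub>M\<^esub> y j)"
    by (rule ptensor_sumr[symmetric]) (use z in auto)
  finally show ?thesis using z by (simp add: dual_bases)
qed

text \<open>The left tensor factors of the coproduct of \<open>\<alpha>\<close>, the right ones being the \<open>\<beta> i\<close>.\<close>

definition coproduct_left :: "('m \<Rightarrow> 'm) \<Rightarrow> nat \<Rightarrow> 'm \<Rightarrow> 'm" where
  "coproduct_left \<alpha> i = (\<lambda>z\<in>carrier M. contract (\<lambda>u. \<alpha> (z \<otimes>\<^bsub>M\<^esub> u)) (b i))"

lemma coproduct_left_in_End: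
  assumes a: "\<alpha> \<in> carrier \<A>" and i: "i < s" shows "coproduct_left \<alpha> i \<in> carrier \<A>"
proof -
  note a' = EndD[OF a] and rt = right_linear_translate[OF EndD(1)[OF a]]
  have 0: "contract (\<lambda>u. \<alpha> (z \<otimes>\<^bsub>M\<^esub> u)) (b i) \<in> carrier M" if "z \<in> carrier M" for z
    using that i rt by simp
  have 1: "contract (\<lambda>u. \<alpha> ((z \<oplus>\<^bsub>M\<^esub> z') \<otimes>\<^bsub>M\<^esub> u)) (b i) =
      contract (\<lambda>u. \<alpha> (z \<otimes>\<^bsub>M\<^esub> u)) (b i) \<oplus>\<^bsub>M\<^esub> contract (\<lambda>u. \<alpha> (z' \<otimes>\<^bsub>M\<^esub> u)) (b i)"
    if "z \<in> carrier M" "z' \<in> carrier M" for z z'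
    by (rule contract_add) (use that i in \<open>auto simp: rt M.l_distr a'\<close>)
  \<comment> \<open>Centrality of \<open>b i\<close> enters here: \<open>\<iota> n\<close> in front
    of its first leg may be moved behind its second leg, hence out of the contraction on the
    right.\<close>
  have 2: "contract (\<lambda>u. \<alpha> (z \<otimes>\<^bsub>M\<^esub> \<iota> n \<otimes>\<^bsub>M\<^esub> u)) (b i) = contract (\<lambda>u. \<alpha> (z \<otimes>\<^bsub>M\<^esub> u)) (b i) \<otimes>\<^bsub>M\<^esub> \<iota> n"
    if "z \<in> carrier M" "n \<in> carrier N" for z n
  proof -
    have "contract (\<lambda>u. \<alpha> (z \<otimes>\<^bsub>M\<^esub> \<iota> n \<otimes>\<^bsub>M\<^esub> u)) (b i) = contract \<alpha> (lmul z (lmul (\<iota> n) (b i)))"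
      using that i a' by (simp add: contract_lmul lmul_lmul \<iota>_closed)
    then show ?thesis
      using that i a' by (simp add: b_central contract_lmul contract_rmul rt \<iota>_closed)
  qed
  have 3: "contract (\<lambda>u. \<alpha> (\<iota> n \<otimes>\<^bsub>M\<^esub> z \<otimes>\<^bsub>M\<^esub> u)) (b i) = \<iota> n \<otimes>\<^bsub>M\<^esub> contract (\<lambda>u. \<alpha> (z \<otimes>\<^bsub>M\<^esub> u)) (b i)"
    if "z \<in> carrier M" "n \<in> carrier N" for z n
    by (rule contract_left) (use that i in \<open>auto simp: rt M.m_assoc \<iota>_closed a'\<close>)
  show ?thesis
    using i by (auto simp: End_iff right_linear_def coproduct_left_def 0 1 2 3 \<iota>_closed)
qed

section \<open>The transported antipode\<close>

abbreviation S' where "S' \<equiv> hat_antipode N M \<iota> E r x y s b \<beta>"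

lemma hat_antipode_psi: "\<alpha> \<in> carrier \<A> \<Longrightarrow> S' (\<psi> \<alpha>) = \<psi> (S \<alpha>)"
  by (simp add: hat_antipode_def psi_inv)

text \<open>The product with the antipode is formed in \<open>M1\<close>, so membership in the
  carrier of \<open>M1\<close> is what the lift calls for.\<close>

lemma hat_antipode_closed: "a \<in> carrier \<B> \<Longrightarrow> S' a \<in> carrier TS"
  by (erule hat_A_E) (auto simp: hat_antipode_psi EndD(3) antipode_closed)

lemma hat_antipode_add:
  assumes "a \<in> carrier \<B>" "a' \<in> carrier \<B>" shows "S' (a \<oplus>\<^bsub>TS\<^esub> a') = S' a \<oplus>\<^bsub>TS\<^esub> S' a'"
proof -
  obtain \<alpha> \<alpha>' where al: "\<alpha> \<in> carrier \<A>" "\<alpha>' \<in> carrier \<A>" "a = \<psi> \<alpha>" "a' = \<psi> \<alpha>'"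
    using assms by (metis hat_A_E)
  have "\<psi> (\<alpha> \<oplus>\<^bsub>\<A>\<^esub> \<alpha>') = \<psi> \<alpha> \<oplus>\<^bsub>TS\<^esub> \<psi> \<alpha>'"
    by (rule psi_add) (use al EndD in \<open>auto simp: End_simps\<close>)
  moreover have "\<psi> (S (\<alpha> \<oplus>\<^bsub>\<A>\<^esub> \<alpha>')) = \<psi> (S \<alpha>) \<oplus>\<^bsub>TS\<^esub> \<psi> (S \<alpha>')"
    by (rule psi_add) (use al EndD(3) in \<open>auto simp: antipode_add antipode_closed\<close>)
  ultimately show ?thesis
    using al hat_antipode_psi[OF add_closed_End[OF al(1,2)]] by (simp add: hat_antipode_psi)
qed

text \<open>\<open>psi_inc_ptensor\<close> applied to each summand of
  \<open>\<psi> (S \<delta>)\<close>.\<close>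

lemma psi_inc_hat_antipode:
  assumes g: "\<gamma> \<in> carrier \<A>" and d: "\<delta> \<in> carrier \<A>" and m: "m \<in> carrier M"
  shows "mul1 (mul1 (\<psi> \<gamma>) (inc m)) (S' (\<psi> \<delta>)) =
    (\<Oplus>\<^bsub>TS\<^esub>l\<in>{..<r}. pten (\<gamma> (m \<otimes>\<^bsub>M\<^esub> S \<delta> (x l))) (y l))"
proof -
  have c: "S \<delta> \<in> carrier M \<rightarrow> carrier M" using EndD(3)[OF d] by (auto intro: antipode_closed)
  have "mul1 (mul1 (\<psi> \<gamma>) (inc m)) (S' (\<psi> \<delta>)) =
      (\<Oplus>\<^bsub>TS\<^esub>l\<in>{..<r}. mul1 (mul1 (\<psi> \<gamma>) (inc m)) (pten (S \<delta> (x l)) (y l)))"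
    unfolding hat_antipode_psi[OF d] psi_eq[OF c]
    by (rule mul1_finsum_right) (use c m EndD[OF g] in \<open>auto simp: Pi_iff\<close>)
  also have "\<dots> = (\<Oplus>\<^bsub>TS\<^esub>l\<in>{..<r}. pten (\<gamma> (m \<otimes>\<^bsub>M\<^esub> S \<delta> (x l))) (y l))"
    by (rule TS.finsum_cong') (use c m EndD[OF g] in \<open>auto simp: Pi_iff psi_inc_ptensor\<close>)
  finally show ?thesis .
qed

section \<open>The transported coproduct and maps on tensor squares over \<open>K\<close>\<close>

sublocale AA: tensor_data K "sym_bimod \<A>" "sym_bimod \<A>"
  by (rule tensor_data.intro; (rule abelian_group_add_cong[OF abelian_group_End])?)
     (simp_all add: smult_closed_End)

sublocale BB: tensor_data K "sym_bimod \<B>" "sym_bimod \<B>"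
  by (rule tensor_data.intro; (rule abelian_group_add_cong[OF abelian_group_hat_A])?)
     (simp_all add: smult_closed_hat_A)

lemma psi_add_End:
  "\<lbrakk>\<alpha> \<in> carrier \<A>; \<alpha>' \<in> carrier \<A>\<rbrakk> \<Longrightarrow> \<psi> (\<alpha> \<oplus>\<^bsub>\<A>\<^esub> \<alpha>') = \<psi> \<alpha> \<oplus>\<^bsub>\<B>\<^esub> \<psi> \<alpha>'"
  unfolding hat_A_simps by (rule psi_add) (auto simp: End_simps EndD)

text \<open>Since \<open>\<psi>\<close> is additive and \<open>K\<close>-linear, its tensor square
  is well defined over \<open>K\<close> and can be applied to each summand of the coproduct on
  \<open>\<A>\<close>.\<close>

lemma hat_coproduct_psi:
  assumes a: "\<alpha> \<in> carrier \<A>"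
  shows "hat_coproduct K N M \<iota> E r x y s b \<beta> (\<psi> \<alpha>) =
    (\<Oplus>\<^bsub>tensor_add K (sym_bimod \<B>) (sym_bimod \<B>)\<^esub>i\<in>{..<s}.
       tensor_elem K (sym_bimod \<B>) (sym_bimod \<B>) (\<psi> (coproduct_left \<alpha> i)) (\<psi> (\<beta> i)))"
proof -
  have f: "finsum (tensor K X Y) = finsum (tensor_add K X Y)" for X Y
    by (rule finsum_add_cong) (simp_all add: tensor_simps)
  have l: "tensor_lift (tensor K X Y) = tensor_lift (tensor_add K X Y)" for X Y
    by (rule tensor_lift_add_cong) (simp_all add: tensor_simps)
  have B: "AA.balanced (tensor_add K (sym_bimod \<B>) (sym_bimod \<B>))
      (\<lambda>\<gamma> \<delta>. tensor_elem K (sym_bimod \<B>) (sym_bimod \<B>) (\<psi> \<gamma>) (\<psi> \<delta>))"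
    unfolding AA.balanced_def
    using BB.TT BB.elem_closed BB.elem_addl BB.elem_addr BB.elem_bal psi_in_hat_A
    by (simp add: psi_add_End psi_smult)
  have "End_coproduct K N M \<iota> s b \<beta> \<alpha> = (\<Oplus>\<^bsub>tensor_add K (sym_bimod \<A>) (sym_bimod \<A>)\<^esub>i\<in>{..<s}.
       tensor_elem K (sym_bimod \<A>) (sym_bimod \<A>) (coproduct_left \<alpha> i) (\<beta> i))"
    by (simp only: End_coproduct_def Let_def f coproduct_left_def contract_def)
  then show ?thesis
    unfolding hat_coproduct_def Let_def psi_inv[OF a] l
    by (simp only:) (rule AA.lift_sum_elems[OF B]; simp add: a coproduct_left_in_End \<beta>_in_End)
qed

text \<open>Makes the Sweedler expression of the theorem independent of how the coproduct is written
  as a sum of pure tensors.\<close>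

lemma balanced_inc_hat_antipode:
  assumes m: "m \<in> carrier M"
  shows "BB.balanced TS (\<lambda>a\<^sub>1 a\<^sub>2. mul1 (mul1 a\<^sub>1 (inc m)) (S' a\<^sub>2))"
  unfolding BB.balanced_def sym_bimod_simps
proof (intro conjI ballI)
  fix a k a' assume "a \<in> carrier \<B>" and k: "k \<in> carrier K" and "a' \<in> carrier \<B>"
  then obtain \<gamma> \<delta> where g: "\<gamma> \<in> carrier \<A>" "a = \<psi> \<gamma>" and d: "\<delta> \<in> carrier \<A>" "a' = \<psi> \<delta>"
    by (metis hat_A_E)
  have c: "S \<delta> z \<in> carrier M" if "z \<in> carrier M" for z
    using that EndD(3)[OF d(1)] by (rule antipode_closed[rotated])
  have c': "S (k \<odot>\<^bsub>\<A>\<^esub> \<delta>) z \<in> carrier M" if "z \<in> carrier M" for z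
    using that EndD(3)[OF smult_closed_End[OF k d(1)]] by (rule antipode_closed[rotated])
  \<comment> \<open>The scalar passes through \<open>\<gamma>\<close> into its argument by
    \<open>K\<close>-linearity, and from there into the antipode.\<close>
  have e: "(k \<odot>\<^bsub>\<A>\<^esub> \<gamma>) (m \<otimes>\<^bsub>M\<^esub> S \<delta> z) = \<gamma> (m \<otimes>\<^bsub>M\<^esub> S (k \<odot>\<^bsub>\<A>\<^esub> \<delta>) z)" if "z \<in> carrier M" for z
    using that k m c[OF that] EndD[OF g(1)] antipode_smult[OF d(1) k that] End_smult[OF g(1) k]
    by (simp add: End_simps M.smult_mult_right)
  show "mul1 (mul1 (k \<odot>\<^bsub>\<B>\<^esub> a) (inc m)) (S' a') = mul1 (mul1 a (inc m)) (S' (k \<odot>\<^bsub>\<B>\<^esub> a'))"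
    using k m smult_closed_End[OF k g(1)] smult_closed_End[OF k d(1)] EndD[OF g(1)] c'
    by (simp add: g d psi_inc_hat_antipode flip: psi_smult)
       (rule TS.finsum_cong', auto simp: e)
qed (use m in \<open>auto simp: abelian_group_TS hat_A_simps hat_antipode_closed hat_antipode_add hat_A_iff[THEN iffD1]\<close>)

text \<open>For fixed \<open>l\<close>, the sum over \<open>i\<close> is the contraction of
  \<open>antipode_quasibasis\<close> at \<open>x l\<close> along the translate of
  \<open>\<alpha>\<close> by \<open>m\<close>, which yields \<open>\<alpha> m\<close> times
  \<open>x l\<close>. The sum over \<open>l\<close> is then the defining sum of
  \<open>inc (\<alpha> m)\<close>.\<close>

lemma inc_coproduct_antipode:
  assumes a: "\<alpha> \<in> carrier \<A>" and m: "m \<in> carrier M"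
  shows "(\<Oplus>\<^bsub>TS\<^esub>i\<in>{..<s}. mul1 (mul1 (\<psi> (coproduct_left \<alpha> i)) (inc m)) (S' (\<psi> (\<beta> i)))) = inc (\<alpha> m)"
proof -
  note a' = EndD[OF a]
  have c: "S (\<beta> i) z \<in> carrier M" if "i < s" "z \<in> carrier M" for i z
    using that(2) EndD(3)[OF \<beta>_in_End[OF that(1)]] by (rule antipode_closed[rotated])
  have cc: "coproduct_left \<alpha> i z \<in> carrier M" if "i < s" "z \<in> carrier M" for i z
    using EndD(2)[OF coproduct_left_in_End[OF a that(1)] that(2)] .
  have "(\<Oplus>\<^bsub>TS\<^esub>i\<in>{..<s}. mul1 (mul1 (\<psi> (coproduct_left \<alpha> i)) (inc m)) (S' (\<psi> (\<beta> i)))) =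
      (\<Oplus>\<^bsub>TS\<^esub>i\<in>{..<s}. \<Oplus>\<^bsub>TS\<^esub>l\<in>{..<r}. pten (coproduct_left \<alpha> i (m \<otimes>\<^bsub>M\<^esub> S (\<beta> i) (x l))) (y l))"
    by (rule TS.finsum_cong')
       (use m in \<open>auto simp: psi_inc_hat_antipode coproduct_left_in_End[OF a] \<beta>_in_End c cc intro!: TS.finsum_closed\<close>)
  also have "\<dots> = (\<Oplus>\<^bsub>TS\<^esub>l\<in>{..<r}. \<Oplus>\<^bsub>TS\<^esub>i\<in>{..<s}. pten (coproduct_left \<alpha> i (m \<otimes>\<^bsub>M\<^esub> S (\<beta> i) (x l))) (y l))"
    by (rule TS.finsum_swap) (use m c cc in auto)
  also have "\<dots> = (\<Oplus>\<^bsub>TS\<^esub>l\<in>{..<r}. pten (\<alpha> m \<otimes>\<^bsub>M\<^esub> x l) (y l))"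
  proof (rule TS.finsum_cong'[OF refl], goal_cases)
    case (2 l)
    then have l: "l < r" by simp
    have rt: "right_linear (\<lambda>u. \<alpha> (m \<otimes>\<^bsub>M\<^esub> u))" by (rule right_linear_translate[OF a'(1) m])
    have "(\<Oplus>\<^bsub>M\<^esub>i\<in>{..<s}. coproduct_left \<alpha> i (m \<otimes>\<^bsub>M\<^esub> S (\<beta> i) (x l))) =
        (\<Oplus>\<^bsub>M\<^esub>i\<in>{..<s}. contract (\<lambda>u. \<alpha> (m \<otimes>\<^bsub>M\<^esub> u)) (lmul (S (\<beta> i) (x l)) (b i)))"
    proof (rule M.M.finsum_cong'[OF refl], goal_cases)
      case (2 i)
      then have i: "i < s" by simp
      \<comment> \<open>\<open>coproduct_left\<close> multiplies \<open>m\<close> with the antipode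
        value first, while \<open>contract_lmul\<close> needs that value next to
        \<open>u\<close>.\<close>
      have "contract (\<lambda>u. \<alpha> (m \<otimes>\<^bsub>M\<^esub> S (\<beta> i) (x l) \<otimes>\<^bsub>M\<^esub> u)) (b i) =
          contract (\<lambda>u. \<alpha> (m \<otimes>\<^bsub>M\<^esub> (S (\<beta> i) (x l) \<otimes>\<^bsub>M\<^esub> u))) (b i)"
        by (rule contract_cong)
           (use m l i c right_linear_translate[OF a'(1)] right_linear_translate[OF rt] in \<open>auto simp: M.m_assoc\<close>)
      then show ?case using m l i c rt by (simp add: coproduct_left_def contract_lmul)
    qed (use m l c rt in auto)
    also have "\<dots> = contract (\<lambda>u. \<alpha> (m \<otimes>\<^bsub>M\<^esub> u)) (\<Oplus>\<^bsub>TS\<^esub>i\<in>{..<s}. lmul (S (\<beta> i) (x l)) (b i))"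
      by (rule contract_finsum[symmetric]) (use l c rt in auto)
    also have "\<dots> = \<alpha> m \<otimes>\<^bsub>M\<^esub> x l" using l m rt by (simp add: antipode_quasibasis)
    finally have e: "(\<Oplus>\<^bsub>M\<^esub>i\<in>{..<s}. coproduct_left \<alpha> i (m \<otimes>\<^bsub>M\<^esub> S (\<beta> i) (x l))) = \<alpha> m \<otimes>\<^bsub>M\<^esub> x l" .
    show ?case unfolding e[symmetric]
      by (rule ptensor_suml[symmetric]) (use m l c cc in auto)
  qed (use m a' in auto)
  finally show ?thesis by (simp add: inc_eq)
qed

text \<open>The Jones element is \<open>1 \<otimes> 1\<close>, so the product is
  \<open>\<alpha> m \<otimes> 1\<close>, which multiplies out to \<open>\<alpha> m\<close>.\<close>

lemma frob_E\<^sub>M_psi: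
  assumes a: "\<alpha> \<in> carrier \<A>" and m: "m \<in> carrier M"
  shows "frob_E\<^sub>M M (mul1 (mul1 (\<psi> \<alpha>) (inc m)) (jones_idem N M \<iota>)) = \<alpha> m"
proof -
  have "frob_E\<^sub>M M (mul1 (mul1 (\<psi> \<alpha>) (inc m)) (jones_idem N M \<iota>)) = contract (\<lambda>u. u) (pten (\<alpha> m) \<one>\<^bsub>M\<^esub>)"
    unfolding frob_E\<^sub>M_def contract_def jones_idem_def using m EndD[OF a] by (simp add: psi_inc_ptensor)
  then show ?thesis using m EndD[OF a] by simp
qed

end

theorem proposition8p2:
  fixes K :: "('k, 'kz) ring_scheme"
    and N :: "('k, 'n, 'nz) module_scheme"
    and M :: "('k, 'm, 'mz) module_scheme"
    and \<iota> :: "'n \<Rightarrow> 'm"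
    and E :: "'m \<Rightarrow> 'n"
    and r :: nat and x y :: "nat \<Rightarrow> 'm"
    and s :: nat and b :: "nat \<Rightarrow> ('m \<times> 'm \<Rightarrow>\<^sub>0 int) set" and \<beta> :: "nat \<Rightarrow> 'm \<Rightarrow> 'm"
  defines "M\<^sub>1 \<equiv> basic_construction N M \<iota> E r x y"
    and "incl \<equiv> basic_incl N M \<iota> r x y"
    and "e\<^sub>1 \<equiv> jones_idem N M \<iota>"
  assumes "algebra_extension K N M \<iota>"
    and "irreducible_extension K N M \<iota>"
    and "depth_two N M \<iota>"
    and "frobenius_system N M \<iota> E r x y"
    and "left_D2_quasibasis N M \<iota> s b \<beta>"
    and "a \<in> carrier (hat_A N M \<iota> E r x y)"
    and "m \<in> carrier M"
  shows "incl (frob_E\<^sub>M M (a \<otimes>\<^bsub>M\<^sub>1\<^esub> incl m \<otimes>\<^bsub>M\<^sub>1\<^esub> e\<^sub>1)) =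
    tensor_lift M\<^sub>1
      (\<lambda>a\<^sub>1 a\<^sub>2. a\<^sub>1 \<otimes>\<^bsub>M\<^sub>1\<^esub> incl m \<otimes>\<^bsub>M\<^sub>1\<^esub> hat_antipode N M \<iota> E r x y s b \<beta> a\<^sub>2)
      (hat_coproduct K N M \<iota> E r x y s b \<beta> a)"
proof -
  interpret quasibasis_extension K N M \<iota> E r x y s b \<beta>
    using assms(4,5,7,8)
    by (simp add: quasibasis_extension_def quasibasis_extension_axioms_def
        frobenius_extension_def frobenius_extension_axioms_def)
  obtain \<alpha> where \<alpha>: "\<alpha> \<in> carrier \<A>" "a = \<psi> \<alpha>" using assms(9) by (rule hat_A_E)
  \<comment> \<open>By balancedness the lift may be evaluated on the particular sum that represents
    the coproduct of \<open>\<psi> \<alpha>\<close>.\<close>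
  have "tensor_lift TS (\<lambda>a\<^sub>1 a\<^sub>2. mul1 (mul1 a\<^sub>1 (inc m)) (S' a\<^sub>2)) (hat_coproduct K N M \<iota> E r x y s b \<beta> a) =
      (\<Oplus>\<^bsub>TS\<^esub>i\<in>{..<s}. mul1 (mul1 (\<psi> (coproduct_left \<alpha> i)) (inc m)) (S' (\<psi> (\<beta> i))))"
    unfolding \<alpha>(2) hat_coproduct_psi[OF \<alpha>(1)]
    by (rule BB.lift_sum_elems[OF balanced_inc_hat_antipode])
       (simp_all add: assms(10) psi_in_hat_A coproduct_left_in_End[OF \<alpha>(1)] \<beta>_in_End)
  \<comment> \<open>Both sides become \<open>inc (\<alpha> m)\<close>.\<close>
  then show ?thesis
    using \<alpha> assms(10)
    by (simp add: M\<^sub>1_def incl_def e\<^sub>1_def M1_simps tensor_lift_M1 frob_E\<^sub>M_psi inc_coproduct_antipode)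
qed

end
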